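(* Let $s_j=\sigma_j+it_j\in\mathbb{C}$ ($j=1,2,3$) with $\sigma_1\ge0$, $\sigma_3>0$, $\tfrac12<\sigma_1+\sigma_3\le1$, $\sigma_1+\sigma_2+\sigma_3>2$, $t_1\ge0$ and $t_3\ge2$, with $s_1,s_2,\sigma_3$ fixed. Assume that as $t_3$ runs from $2$ to $T$ the point $(s_1,s_2,s_3)$ never lies on the hyperplane $s_1+s_3=1$. Then as $T\to\infty$, $$\int_2^T|\zeta_{AV,2}(s_1,s_2,s_3)|^2dt_3=\zeta_{AV,2}^{[2]}(s_1,s_2,2\sigma_3)T+\begin{cases}O(T^{2-2\sigma_1-2\sigma_3}\log T)&(\tfrac12<\sigma_1+\sigma_3\le\tfrac34),\\ O(T^{1/2})&(\tfrac34<\sigma_1+\sigma_3\le1),\end{cases}$$ where the implied constants depend on $s_1,s_2$ and $\sigma_3$.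
   Context: Write $s_j=\sigma_j+it_j$ with $\sigma_j,t_j\in\mathbb{R}$; complex powers $n^{s}=e^{s\log n}$ use the real logarithm. The Apostol–Vu double zeta-function is $\zeta_{AV,2}(s_1,s_2,s_3)=\sum_{m=1}^\infty\sum_{n<m}m^{-s_1}n^{-s_2}(m+n)^{-s_3}$ (positive integers $n<m$), absolutely convergent for $\sigma_1+\sigma_3>1$, $\sigma_1+\sigma_2+\sigma_3>2$, and extended meromorphically to $\mathbb{C}^3$ (singularities only on $s_1+s_3=1-l$, $s_1+s_2+s_3=2-l$, $l\in\mathbb{Z}_{\ge0}$); $\zeta_{AV,2}$ denotes this continuation. Also $\zeta_{AV,2}^{[2]}(s_1,s_2,s_3)=\sum_{k=2}^\infty\left|\sum_{k/2<m\le k-1}m^{-s_1}(k-m)^{-s_2}\right|^2k^{-s_3}$. *)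

theory Defs
  imports "HOL-Analysis.Analysis" "HOL-Library.Landau_Symbols"
begin

definition zeta_AV2_series :: "complex \<Rightarrow> complex \<Rightarrow> complex \<Rightarrow> complex" where
  "zeta_AV2_series s1 s2 s3 =
     infsum (\<lambda>(m::nat, n::nat). of_nat m powr (-s1) * of_nat n powr (-s2) * of_nat (m + n) powr (-s3))
            {(m, n). 0 < n \<and> n < m}"

definition AV2_sing :: "complex \<Rightarrow> complex \<Rightarrow> complex set" where
  "AV2_sing s1 s2 = {z. \<exists>l::nat. s1 + z = 1 - of_nat l \<or> s1 + s2 + z = 2 - of_nat l}"

text \<open>Meromorphic continuation, taken along the s3-slice: the unique function holomorphic off
  the singular locus agreeing with the series on the region of absolute convergence
  (set to 0 on the singular points by convention).\<close>
definition zeta_AV2 :: "complex \<Rightarrow> complex \<Rightarrow> complex \<Rightarrow> complex" where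
  "zeta_AV2 s1 s2 s3 =
     (THE f. f holomorphic_on (UNIV - AV2_sing s1 s2)
          \<and> (\<forall>z\<in>AV2_sing s1 s2. f z = 0)
          \<and> (\<forall>z. Re s1 + Re z > 1 \<and> Re s1 + Re s2 + Re z > 2 \<longrightarrow> f z = zeta_AV2_series s1 s2 z)) s3"

definition zeta_AV2_sq :: "complex \<Rightarrow> complex \<Rightarrow> real \<Rightarrow> real" where
  "zeta_AV2_sq s1 s2 s3 =
     infsum (\<lambda>k::nat. (cmod (\<Sum>m\<in>{m. k < 2 * m \<and> m \<le> k - 1}.
                  of_nat m powr (-s1) * of_nat (k - m) powr (-s2)))^2 * real k powr (-s3)) {2..}"

end

theory Submission
  imports Defs "HOL-Complex_Analysis.Complex_Analysis"
begin

text \<open>With \<open>k = m + n\<close> and \<open>w = s1 + s3\<close> the series is the Dirichlet series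
  \<open>\<Sum>a\<^sub>k k powr (-s3)\<close>, and expanding \<open>(1 - n / k) powr (-s1)\<close> binomially (which converges geometrically
  because \<open>n / k < 1/2\<close>) turns it into \<open>\<Sum> c\<^sub>l n powr (l - s2) k powr (-w - l)\<close> over \<open>k > 2 n\<close>. Euler-Maclaurin
  summation over \<open>k\<close> leaves zeta functions of \<open>s1 + s2 + s3 - 1 + j\<close> with coefficients meromorphic in \<open>w\<close>,
  up to a remainder converging in an arbitrarily large half-plane; this gives the continuation.

  For the mean square over \<open>[T, 2 T]\<close> the sum is cut at \<open>k \<le> N\<close> with \<open>N\<close> of order \<open>T\<close>. The tails
  \<open>\<Sum>k>K. k powr (-w - l)\<close>, coupled for different \<open>l\<close> by telescoping \<open>k powr (1 - w)\<close>, are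
  bounded by \<open>K powr (1 - Re w - l) / T\<close>, so that the remainder is \<open>O(T powr (- Re w))\<close>. Expanding the square of the
  finite sum, the diagonal yields the main term, and the off-diagonal terms are controlled by
  \<open>1 / ln (k / j) \<le> 1 + sqrt (j k) / (k - j)\<close>. Summing over dyadic intervals finishes the proof.\<close>

subsection \<open>Sums of powers and holomorphic series\<close>

text \<open>Estimating an Euler-Maclaurin remainder of fixed order termwise is too weak at height T:
  every extra power of 1/K comes with a factor of size T, so for K of order T the outcome is only
  \<open>K powr (1 - Re w)\<close>, without the division by T. Such estimates therefore serve
  convergence, continuation and holomorphy, while the quantitative bound rests on the recurrence
  \<open>em_sum_0_recurrence\<close>, whose weights form a binomial series at 1/K. Demanding
  \<open>K \<ge> 6 * Im u\<close> keeps that series below 2.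

  The binomial index l shifts w to w + l, so all estimates have to be uniform in l: polynomial
  growth in l is admissible, because 2 * n < k supplies a factor \<open>(1/2) ^ l\<close>.

  The mean square is carried out with a free exponent s \<le> Re s1 + \<sigma>3, s < 1, since the
  constants contain 1 / (1 - s) and the case Re s1 + \<sigma>3 = 1 is included. In the upper range
  the slack between s and 3/4 absorbs the logarithm.\<close>

lemma holomorphic_on_infsum:
  fixes f :: "'i \<Rightarrow> complex \<Rightarrow> complex"
  assumes "open S" and hol: "\<And>i. i \<in> I \<Longrightarrow> f i holomorphic_on S"
    and loc: "\<And>z. z \<in> S \<Longrightarrow> \<exists>e>0. \<exists>M. M summable_on I \<and> (\<forall>i\<in>I. \<forall>y\<in>ball z e \<inter> S. norm (f i y) \<le> M i)"
  shows "(\<lambda>z. \<Sum>\<^sub>\<infinity>i\<in>I. f i z) holomorphic_on S"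
proof -
  have "\<exists>r>0. (\<lambda>z. \<Sum>\<^sub>\<infinity>i\<in>I. f i z) holomorphic_on ball z r" if z: "z \<in> S" for z
  proof -
    obtain e M where e: "e > 0" "M summable_on I" "\<forall>i\<in>I. \<forall>y\<in>ball z e \<inter> S. norm (f i y) \<le> M i"
      using loc[OF z] by blast
    obtain d where d: "d > 0" "ball z d \<subseteq> S"
      using \<open>open S\<close> z open_contains_ball by blast
    define r where "r = min e d / 2"
    have r: "r > 0" "cball z r \<subseteq> ball z e \<inter> S"
      using e d by (auto simp: r_def subset_iff)
    \<comment> \<open>The M-test runs along the filter of finite subsets of \<open>I\<close>, so
      sums indexed by pairs and triples are covered without enumerating them.\<close>
    have "uniform_limit (cball z r) (\<lambda>X y. \<Sum>x\<in>X. f x y) (\<lambda>y. \<Sum>\<^sub>\<infinity>x\<in>I. f x y) (finite_subsets_at_top I)"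
      by (rule Weierstrass_m_test_general[of _ _ _ M]) (use e r in blast)+
    moreover have "\<forall>\<^sub>F X in finite_subsets_at_top I. continuous_on (cball z r) (\<lambda>y. \<Sum>x\<in>X. f x y)
        \<and> (\<lambda>y. \<Sum>x\<in>X. f x y) holomorphic_on ball z r"
    proof (rule eventually_finite_subsets_at_top_weakI)
      fix X assume X: "finite X" "X \<subseteq> I"
      have "(\<lambda>y. \<Sum>x\<in>X. f x y) holomorphic_on S"
        using X hol by (intro holomorphic_intros) auto
      then show "continuous_on (cball z r) (\<lambda>y. \<Sum>x\<in>X. f x y)
          \<and> (\<lambda>y. \<Sum>x\<in>X. f x y) holomorphic_on ball z r"
        using r by (meson ball_subset_cball holomorphic_on_imp_continuous_on holomorphic_on_subset le_inf_iff)
    qed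
    ultimately show ?thesis
      using holomorphic_uniform_limit[of z r "\<lambda>X y. \<Sum>x\<in>X. f x y" "finite_subsets_at_top I"
          "\<lambda>y. \<Sum>\<^sub>\<infinity>x\<in>I. f x y"] r by auto
  qed
  then show ?thesis
    by (metis \<open>open S\<close> analytic_on_def analytic_on_open)
qed

text \<open>Telescoping determines only the ordered sum. Unordered summability is therefore assumed,
  and uniqueness of limits identifies the two values.\<close>

lemma has_sum_telescope:
  fixes f G :: "nat \<Rightarrow> complex"
  assumes "f summable_on {K<..}" and eq: "\<And>k. k > K \<Longrightarrow> f k = G (k - 1) - G k"
    and "G \<longlonglongrightarrow> 0"
  shows "(f has_sum G K) {K<..}"
proof -
  obtain S where S: "(f has_sum S) {K<..}"
    using assms(1) summable_on_def by blast
  have "((\<lambda>i. f (Suc (K + i))) has_sum S) UNIV \<longleftrightarrow> (f has_sum S) {K<..}"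
    by (rule has_sum_reindex_bij_witness[where i = "\<lambda>k. k - Suc K" and j = "\<lambda>i. Suc (K + i)"]) auto
  then have "(\<lambda>i. f (Suc (K + i))) sums S"
    using S has_sum_imp_sums by blast
  moreover have "(\<lambda>i. f (Suc (K + i))) sums G K"
  proof -
    have "(\<lambda>i. G (K + i)) \<longlonglongrightarrow> 0"
      using LIMSEQ_ignore_initial_segment[OF assms(3), of K] by (simp add: add.commute)
    from telescope_sums'[OF this] show ?thesis
      using eq by simp
  qed
  ultimately show ?thesis
    using S sums_unique2 by blast
qed

text \<open>Mean value theorem for the primitive on \<open>[k - 1, k]\<close>; both signs of 1 - a
  are kept so that it serves partial sums (a < 1) and tails (a > 1). At k = 1 the convention
  \<open>0 powr x = 0\<close> is the true value of the primitive only for a < 1.\<close>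

lemma powr_le_diff:
  fixes a :: real and k :: nat
  assumes a: "a > 0" "a \<noteq> 1" and k: "k \<ge> 1" "a < 1 \<or> k \<ge> 2"
  shows "real k powr (-a) \<le> (real k powr (1 - a) - real (k - 1) powr (1 - a)) / (1 - a)"
proof (cases "k = 1")
  case True
  then show ?thesis using k a by (auto simp: field_simps)
next
  case False
  have "\<exists>x. real (k - 1) < x \<and> x < real k \<and>
     (\<lambda>x. x powr (1 - a) / (1 - a)) (real k) - (\<lambda>x. x powr (1 - a) / (1 - a)) (real (k - 1)) =
      (real k - real (k - 1)) * (\<lambda>x. x powr (-a)) x"
  proof (rule MVT2)
    fix x assume x: "real (k - 1) \<le> x" "x \<le> real k"
    then have "x > 0" using False k by linarith
    then show "((\<lambda>x. x powr (1 - a) / (1 - a)) has_real_derivative x powr (-a)) (at x)"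
      using a by (auto intro!: derivative_eq_intros)
  qed (use False k in auto)
  then obtain x where x: "real (k - 1) < x" "x < real k"
    "real k powr (1 - a) / (1 - a) - real (k - 1) powr (1 - a) / (1 - a) = x powr (-a)"
    using k by (auto simp: of_nat_diff)
  have "real k powr (-a) \<le> x powr (-a)"
    by (rule powr_mono2') (use x a False k in auto)
  with x(3) show ?thesis
    by (simp add: diff_divide_distrib)
qed

lemma sum_powr_le:
  fixes a :: real
  assumes "0 < a" "a < 1"
  shows "(\<Sum>k=1..N. real k powr (-a)) \<le> real N powr (1 - a) / (1 - a)"
proof (induction N)
  case (Suc N)
  then show ?case
    using powr_le_diff[of a "Suc N"] assms by (simp add: diff_divide_distrib)
qed simp

lemma powr_tail_summable:
  fixes a :: real
  assumes a: "a > 1" and K: "K \<ge> 1"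
  shows "(\<lambda>k. real k powr (-a)) summable_on {K<..}" (is ?t1)
    and "(\<Sum>\<^sub>\<infinity>k\<in>{K<..}. real k powr (-a)) \<le> real K powr (1 - a) / (a - 1)" (is ?t2)
proof -
  have fin: "(\<Sum>k\<in>F. real k powr (-a)) \<le> real K powr (1 - a) / (a - 1)"
    if F: "finite F" "F \<subseteq> {K<..}" for F
  proof -
    obtain M where M: "F \<subseteq> {..M}"
      using F(1) finite_nat_set_iff_bounded_le by fastforce
    \<comment> \<open>The subtracted term at K + n is what lets the induction close; it is dropped
      only afterwards.\<close>
    have *: "(\<Sum>k\<in>{K<..K+n}. real k powr (-a)) \<le> (real K powr (1 - a) - real (K+n) powr (1 - a)) / (a - 1)" for n
    proof (induction n)
      case (Suc n)
      have "{K<..K + Suc n} = insert (K + Suc n) {K<..K+n}" by auto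
      then have "(\<Sum>k\<in>{K<..K+Suc n}. real k powr (-a)) \<le> (real K powr (1 - a) - real (K+n) powr (1 - a)) / (a - 1)
         + real (K + Suc n) powr (-a)"
        using Suc by simp
      also have "real (K + Suc n) powr (-a) \<le> (real (K + Suc n) powr (1 - a) - real (K + n) powr (1 - a)) / (1 - a)"
        using powr_le_diff[of a "K + Suc n"] a K by simp
      also have "\<dots> = (real (K + n) powr (1 - a) - real (K + Suc n) powr (1 - a)) / (a - 1)"
        using a by (simp add: field_simps)
      finally show ?case by (simp add: diff_divide_distrib)
    qed simp
    have "(\<Sum>k\<in>F. real k powr (-a)) \<le> (\<Sum>k\<in>{K<..K+M}. real k powr (-a))"
      by (rule sum_mono2) (use F M in \<open>auto simp: subset_iff intro: trans_le_add2\<close>)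
    also have "\<dots> \<le> real K powr (1 - a) / (a - 1)"
      using *[of M] a by (smt (verit) divide_right_mono powr_ge_zero)
    finally show ?thesis .
  qed
  show t1: ?t1
    by (rule nonneg_bdd_above_summable_on) (use fin in \<open>auto intro!: bdd_aboveI2\<close>)
  show ?t2
    by (rule infsum_le_finite_sums[OF t1]) (use fin in auto)
qed

lemma powr_summable:
  fixes a :: real
  assumes a: "a > 1"
  shows "(\<lambda>k. real k powr (-a)) summable_on A"
proof -
  have "{1<..} \<union> {0,1::nat} = UNIV" by auto
  moreover have "(\<lambda>k. real k powr (-a)) summable_on ({1<..} \<union> {0,1::nat})"
    by (rule summable_on_union) (use powr_tail_summable[of a 1] a in auto)
  ultimately show ?thesis
    by (metis summable_on_subset subset_UNIV)
qed

lemma norm_nat_powr: "norm (of_nat k powr (z::complex)) = real k powr Re z"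
  by (subst norm_powr_real_powr) auto

subsection \<open>Euler-Maclaurin summation for powers\<close>

text \<open>This is the Bernoulli number \<open>B\<^sub>m / m!\<close>; the recursion makes \<open>bern_fun j\<close> below take equal values
  at \<open>0\<close> and \<open>1\<close> for \<open>j \<ge> 2\<close>.\<close>

fun bern_coeff :: "nat \<Rightarrow> complex" where
  "bern_coeff m = (if m = 0 then 1 else - (\<Sum>i\<in>{1..m}. (if i = 0 then 0 else bern_coeff (m - i)) / fact (i + 1)))"

declare bern_coeff.simps [simp del]

lemma bern_coeff_0: "bern_coeff 0 = 1"
  by (simp add: bern_coeff.simps)

lemma bern_coeff_Suc: "m > 0 \<Longrightarrow> (\<Sum>i\<le>m. bern_coeff (m - i) / fact (i + 1)) = 0"
proof -
  assume m: "m > 0"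
  have "{..m} = insert 0 {1..m}" by auto
  then have "(\<Sum>i\<le>m. bern_coeff (m - i) / fact (i + 1)) = bern_coeff m + (\<Sum>i\<in>{1..m}. bern_coeff (m - i) / fact (i + 1))"
    by simp
  also have "(\<Sum>i\<in>{1..m}. bern_coeff (m - i) / fact (i + 1)) = - bern_coeff m"
    using m by (subst (2) bern_coeff.simps) (auto intro!: sum.cong)
  finally show ?thesis by simp
qed

text \<open>The Bernoulli polynomial \<open>B_j(x) / j!\<close>. In this normalisation
  differentiation just lowers the index.\<close>

definition bern_fun :: "nat \<Rightarrow> complex \<Rightarrow> complex" where
  "bern_fun j x = (\<Sum>i\<le>j. bern_coeff (j - i) * x ^ i / fact i)"

lemma bern_fun_deriv: "(bern_fun (Suc j) has_field_derivative bern_fun j x) (at x within S)"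
proof -
  have eq: "bern_fun (Suc j) = (\<lambda>x. bern_coeff (Suc j) + (\<Sum>i\<le>j. bern_coeff (j - i) * x ^ Suc i / fact (Suc i)))"
    by (rule ext, unfold bern_fun_def, subst sum.atMost_Suc_shift) simp
  have "((\<lambda>x. c * x ^ Suc i / fact (Suc i)) has_field_derivative c * x ^ i / fact i) (at x within S)" for c i
  proof -
    have "((\<lambda>x. c / fact (Suc i) * x ^ Suc i) has_field_derivative c / fact (Suc i) * (of_nat (Suc i) * x ^ i)) (at x within S)"
      by (rule derivative_eq_intros refl | simp)+
    moreover have "of_nat (Suc i) / fact (Suc i) = (1 / fact i :: complex)"
      by (metis fact_Suc nonzero_divide_mult_cancel_left of_nat_neq_0)
    then have "c / fact (Suc i) * (of_nat (Suc i) * x ^ i) = c * x ^ i / fact i"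
      by (metis (no_types, lifting) mult.assoc mult.commute mult_1 times_divide_eq_left times_divide_eq_right)
    ultimately show ?thesis by (simp only: times_divide_eq_left)
  qed
  then have "(bern_fun (Suc j) has_field_derivative 0 + (\<Sum>i\<le>j. bern_coeff (j - i) * x ^ i / fact i)) (at x within S)"
    unfolding eq by (intro DERIV_add DERIV_const DERIV_sum)
  then show ?thesis
    by (simp add: bern_fun_def)
qed

lemma bern_fun_0: "bern_fun j 0 = bern_coeff j"
  unfolding bern_fun_def by (subst sum.remove[of _ 0]) auto

text \<open>The single jump between 0 and 1, at j = 1, is what reproduces the summand
  \<open>k powr (-u)\<close> in Euler-Maclaurin summation.\<close>

lemma bern_fun_1: "bern_fun j 1 = bern_coeff j + (if j = 1 then 1 else 0)"
proof (cases j)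
  case 0
  then show ?thesis by (simp add: bern_fun_def)
next
  case (Suc m)
  have "bern_fun j 1 = bern_coeff j + (\<Sum>i\<le>m. bern_coeff (m - i) / fact (i + 1))"
    unfolding bern_fun_def Suc by (subst sum.atMost_Suc_shift) simp
  then show ?thesis
    using bern_coeff_Suc[of m] Suc by (cases "m = 0") (auto simp: bern_coeff_0)
qed

lemma bern_fun_bounded: "\<exists>B\<ge>0. \<forall>x. norm x \<le> 1 \<longrightarrow> norm (bern_fun j x) \<le> B"
proof (intro exI[of _ "\<Sum>i\<le>j. norm (bern_coeff (j - i))"] conjI allI impI)
  fix x :: complex assume x: "norm x \<le> 1"
  show "norm (bern_fun j x) \<le> (\<Sum>i\<le>j. norm (bern_coeff (j - i)))"
    unfolding bern_fun_def
  proof (rule sum_norm_le)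
    fix i
    have "norm x ^ i / fact i \<le> 1"
      using x by (simp add: power_le_one divide_le_eq order_trans[OF _ fact_ge_1])
    then have "norm (bern_coeff (j - i)) * (norm x ^ i / fact i) \<le> norm (bern_coeff (j - i))"
      by (intro mult_left_le) auto
    then show "norm (bern_coeff (j - i) * x ^ i / fact i) \<le> norm (bern_coeff (j - i))"
      by (simp add: norm_mult norm_divide norm_power)
  qed
qed (auto intro: sum_nonneg)

text \<open>Up to sign, the iterated derivatives of a primitive of \<open>y powr (-u)\<close>.\<close>

definition pow_prim :: "nat \<Rightarrow> complex \<Rightarrow> complex \<Rightarrow> complex" where
  "pow_prim j u y = pochhammer (u - 1) j / (u - 1) * y powr (1 - u - of_nat j)"

lemma pow_prim_deriv:
  assumes "Re y > 0"
  shows "(pow_prim j u has_field_derivative - pow_prim (Suc j) u y) (at y within S)"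
proof -
  have y: "y \<notin> \<real>\<^sub>\<le>\<^sub>0" using assms complex_nonpos_Reals_iff by auto
  have *: "(pow_prim j u has_field_derivative
     pochhammer (u - 1) j / (u - 1) * ((1 - u - of_nat j) * y powr (1 - u - of_nat j - 1))) (at y within S)"
    unfolding pow_prim_def
    by (intro DERIV_cmult has_field_derivative_at_within[OF has_field_derivative_powr] y)
  have "u - 1 + of_nat j = - (1 - u - of_nat j)" "1 - u - of_nat j - 1 = 1 - u - of_nat (Suc j)"
    by simp_all
  moreover have "p / d * (X * Y) = - (p * - X / d * Y)" for p d X Y :: complex
    by simp
  ultimately have "pochhammer (u - 1) j / (u - 1) * ((1 - u - of_nat j) * y powr (1 - u - of_nat j - 1)) = - pow_prim (Suc j) u y"
    unfolding pow_prim_def pochhammer_Suc by (simp only:)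
  with * show ?thesis by simp
qed

text \<open>The divisor u - 1 cancels against the first Pochhammer factor, so only j = 0 has a pole
  at u = 1. At u = 1 itself the left side would be 0 because division by zero is 0.\<close>

lemma pow_prim_Suc: "u \<noteq> 1 \<Longrightarrow> pow_prim (Suc j) u y = pochhammer u j * y powr (- u - of_nat j)"
proof -
  assume "u \<noteq> 1"
  moreover have "1 - u - of_nat (Suc j) = - u - of_nat j" by simp
  ultimately show ?thesis unfolding pow_prim_def pochhammer_rec by (simp only:) simp
qed

text \<open>The local Euler-Maclaurin error on \<open>[k - 1, k]\<close>. The subtracted differences
  telescope in k, so that summation over k > K leaves boundary terms at K.\<close>

definition em_rem :: "nat \<Rightarrow> nat \<Rightarrow> complex \<Rightarrow> complex" where
  "em_rem J k u = of_nat k powr (-u)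
     - (\<Sum>j\<le>J. bern_coeff j * (pow_prim j u (of_nat (k - 1)) - pow_prim j u (of_nat k)))"

text \<open>All integrations by parts are done at once: the derivative of \<open>H\<close>
  telescopes in j down to its last term, \<open>H 1 - H 0\<close> is the remainder, and the mean
  value inequality on the unit segment replaces the remainder integral. The order must be at least 1
  for the jump of \<open>bern_fun 1\<close> to enter.\<close>

lemma em_rem_bound:
  assumes "J \<ge> 1"
  shows "\<exists>B\<ge>0. \<forall>u k. u \<noteq> 1 \<and> k \<ge> 2 \<and> Re u + real J \<ge> 0 \<longrightarrow>
     norm (em_rem J k u) \<le> B * norm (pochhammer u J) * real (k - 1) powr (- Re u - real J)"
proof -
  obtain B where B: "B \<ge> 0" "\<And>x. norm x \<le> 1 \<Longrightarrow> norm (bern_fun J x) \<le> B"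
    using bern_fun_bounded[of J] by blast
  have "norm (em_rem J k u) \<le> B * norm (pochhammer u J) * real (k - 1) powr (- Re u - real J)"
    if u: "u \<noteq> 1" "k \<ge> 2" "Re u + real J \<ge> 0" for u k
  proof -
    define a where "a = real (k - 1)"
    have a: "a \<ge> 1" "real k = a + 1" using u by (auto simp: a_def)
    define H where "H = (\<lambda>x. \<Sum>j\<le>J. bern_fun j x * pow_prim j u (of_real a + x))"
    define C where "C = B * norm (pochhammer u J) * a powr (- Re u - real J)"
    have seg: "\<exists>t. x = of_real t \<and> 0 \<le> t \<and> t \<le> 1" if "x \<in> closed_segment 0 (1::complex)" for x
      using that by (auto simp: closed_segment_def scaleR_conv_of_real)
    have D: "(H has_field_derivative - (bern_fun J x * pow_prim (Suc J) u (of_real a + x))) (at x within S)"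
      if x: "Re x \<ge> 0" for x S
    proof -
      have pp: "((\<lambda>x. pow_prim j u (of_real a + x)) has_field_derivative - pow_prim (Suc j) u (of_real a + x)) (at x within S)" for j
      proof -
        have "((\<lambda>x. of_real a + x) has_field_derivative 1) (at x within S)"
          by (auto intro!: derivative_eq_intros)
        then show ?thesis
          using DERIV_chain2[of "pow_prim j u" "- pow_prim (Suc j) u (of_real a + x)" "\<lambda>x. of_real a + x" x 1 S]
            pow_prim_deriv[of "of_real a + x" j u UNIV] x a
          by simp
      qed
      show ?thesis
        unfolding H_def
      proof (induction J)
        case 0
        have "(\<lambda>x. bern_fun 0 x * pow_prim 0 u (of_real a + x)) = (\<lambda>x. pow_prim 0 u (of_real a + x))"
          by (simp add: bern_fun_def bern_coeff_0)
        then show ?case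
          using pp[of 0] by (simp add: bern_fun_def bern_coeff_0)
      next
        case (Suc J)
        have "((\<lambda>x. (\<Sum>j\<le>J. bern_fun j x * pow_prim j u (of_real a + x)) + bern_fun (Suc J) x * pow_prim (Suc J) u (of_real a + x))
           has_field_derivative (- (bern_fun J x * pow_prim (Suc J) u (of_real a + x))) +
             (bern_fun J x * pow_prim (Suc J) u (of_real a + x)
               + - pow_prim (Suc (Suc J)) u (of_real a + x) * bern_fun (Suc J) x)) (at x within S)"
          by (intro DERIV_add Suc DERIV_mult bern_fun_deriv pp)
        then show ?case by (simp add: mult.commute)
      qed
    qed
    have "norm (H 1 - H 0) \<le> C * norm (1 - (0::complex))"
    proof (rule field_differentiable_bound[of "closed_segment 0 1" H
          "\<lambda>x. - (bern_fun J x * pow_prim (Suc J) u (of_real a + x))"])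
      fix x :: complex assume "x \<in> closed_segment 0 1"
      then obtain t where t: "x = of_real t" "0 \<le> t" "t \<le> 1" using seg by blast
      show "(H has_field_derivative - (bern_fun J x * pow_prim (Suc J) u (of_real a + x))) (at x within closed_segment 0 1)"
        using t by (intro D) auto
      have "norm (of_real (a + t) powr (- u - of_nat J)) = (a + t) powr (- Re u - real J)"
        using a t by (subst norm_powr_real_powr) auto
      also have "\<dots> \<le> a powr (- Re u - real J)"
        using a t u by (intro powr_mono2') auto
      finally have "norm (of_real a + x) \<ge> 0 \<and> norm ((of_real a + x) powr (- u - of_nat J)) \<le> a powr (- Re u - real J)"
        using t by simp
      then show "norm (- (bern_fun J x * pow_prim (Suc J) u (of_real a + x))) \<le> C"
        unfolding C_def pow_prim_Suc[OF u(1)] norm_mult norm_minus_cancel mult.assoc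
        using t B by (intro mult_mono) auto
    qed auto
    moreover have "H 1 - H 0 = em_rem J k u"
    proof -
      have ak: "of_real a + 1 = (of_nat k :: complex)" "of_real a = (of_nat (k - 1) :: complex)"
        using u by (auto simp: a_def of_nat_diff)
      have "H 1 = (\<Sum>j\<le>J. bern_coeff j * pow_prim j u (of_nat k)) + (\<Sum>j\<le>J. if j = 1 then pow_prim j u (of_nat k) else 0)"
        unfolding H_def bern_fun_1 ak(1) sum.distrib[symmetric] by (intro sum.cong) (auto simp: algebra_simps)
      also have "(\<Sum>j\<le>J. if j = 1 then pow_prim j u (of_nat k) else 0) = of_nat k powr (-u)"
        using assms u(1) pow_prim_Suc[OF u(1), of 0] by (simp add: sum.delta)
      finally have "H 1 = (\<Sum>j\<le>J. bern_coeff j * pow_prim j u (of_nat k)) + of_nat k powr (-u)" .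
      moreover have "H 0 = (\<Sum>j\<le>J. bern_coeff j * pow_prim j u (of_nat (k - 1)))"
        by (simp add: H_def bern_fun_0 ak(2))
      ultimately show ?thesis
        unfolding em_rem_def by (simp add: right_diff_distrib sum_subtractf)
    qed
    ultimately show ?thesis
      by (simp add: C_def a_def)
  qed
  then show ?thesis using B(1) by blast
qed

lemma norm_pochhammer_le: "norm (pochhammer (u::complex) n) \<le> (norm u + real n) ^ n"
proof -
  have "norm (pochhammer u n) = (\<Prod>i<n. norm (u + of_nat i))"
    by (simp add: pochhammer_prod prod_norm atLeast0LessThan)
  also have "\<dots> \<le> (\<Prod>i<n. norm u + real n)"
  proof (rule prod_mono)
    fix i assume "i \<in> {..<n}"
    then show "0 \<le> norm (u + of_nat i) \<and> norm (u + of_nat i) \<le> norm u + real n"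
      using norm_triangle_ineq[of u "of_nat i"] by simp
  qed
  finally show ?thesis by simp
qed

text \<open>Order 0 is as good as order 1: the two remainders differ by a multiple of a difference
  of \<open>pow_prim 1 u\<close> over a unit interval, and taking the difference gains one power of
  k. The estimates at large height work with order 0.\<close>

lemma em_rem_bound_max:
  shows "\<exists>B\<ge>0. \<forall>u k. u \<noteq> 1 \<and> k \<ge> 2 \<and> Re u + real (max 1 J) \<ge> 0 \<longrightarrow>
     norm (em_rem J k u) \<le> B * norm (pochhammer u (max 1 J)) * real (k - 1) powr (- Re u - real (max 1 J))"
proof (cases "J \<ge> 1")
  case True
  then show ?thesis using em_rem_bound[of J] by simp
next
  case False
  then have J: "J = 0" by simp
  obtain B where B: "B \<ge> 0" "\<And>u k. u \<noteq> 1 \<Longrightarrow> k \<ge> 2 \<Longrightarrow> Re u + 1 \<ge> 0 \<Longrightarrow>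
     norm (em_rem 1 k u) \<le> B * norm u * real (k - 1) powr (- Re u - 1)"
    using em_rem_bound[of 1] by auto
  have "norm (em_rem 0 k u) \<le> (B + norm (bern_coeff 1)) * norm u * real (k - 1) powr (- Re u - 1)"
    if u: "u \<noteq> 1" "k \<ge> 2" "Re u + 1 \<ge> 0" for u k
  proof -
    define C where "C = norm u * real (k - 1) powr (- Re u - 1)"
    have "norm (pow_prim 1 u (of_nat (k - 1)) - pow_prim 1 u (of_nat k)) \<le> C * norm (of_nat (k - 1) - (of_nat k :: complex))"
    proof (rule field_differentiable_bound[of "closed_segment (of_nat (k - 1)) (of_nat k)" _ "\<lambda>y. - pow_prim (Suc 1) u y"])
      fix y :: complex assume "y \<in> closed_segment (of_nat (k - 1)) (of_nat k)"
      then obtain t where t: "y = (1 - of_real t) * of_nat (k - 1) + of_real t * of_nat k" "0 \<le> t" "t \<le> 1"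
        by (auto simp: closed_segment_def scaleR_conv_of_real)
      have y: "y = of_real (real (k - 1) + t)"
        using u by (simp add: t(1) of_nat_diff algebra_simps)
      have "norm (of_real (real (k - 1) + t) powr (- u - of_nat 1)) = (real (k - 1) + t) powr (- Re u - 1)"
        using u t by (subst norm_powr_real_powr) auto
      also have "\<dots> \<le> real (k - 1) powr (- Re u - 1)"
        using u t by (intro powr_mono2') auto
      finally have "norm (y powr (- u - of_nat 1)) \<le> real (k - 1) powr (- Re u - 1)"
        by (simp add: y)
      then show "norm (- pow_prim (Suc 1) u y) \<le> C"
        unfolding C_def pow_prim_Suc[OF u(1)] by (simp add: norm_mult mult_left_mono)
      show "(pow_prim 1 u has_field_derivative - pow_prim (Suc 1) u y)
         (at y within closed_segment (of_nat (k - 1)) (of_nat k))"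
      proof (rule pow_prim_deriv)
        have "Re y = real (k - 1) + t" unfolding y by (rule Re_complex_of_real)
        then show "Re y > 0" using u t by simp
      qed
    qed auto
    also have "norm (of_nat (k - 1) - (of_nat k :: complex)) = 1"
      using u by (simp add: of_nat_diff)
    finally have 1: "norm (pow_prim 1 u (of_nat (k - 1)) - pow_prim 1 u (of_nat k)) \<le> C" by simp
    have "em_rem 0 k u = em_rem 1 k u + bern_coeff 1 * (pow_prim 1 u (of_nat (k - 1)) - pow_prim 1 u (of_nat k))"
      by (simp add: em_rem_def)
    also have "norm \<dots> \<le> B * C + norm (bern_coeff 1) * C"
      using norm_triangle_ineq B(2)[of u k] u 1
      by (intro order_trans[OF norm_triangle_ineq] add_mono) (auto simp: C_def norm_mult mult_left_mono mult.assoc)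
    finally show ?thesis by (simp add: C_def algebra_simps)
  qed
  moreover have "B + norm (bern_coeff 1) \<ge> 0" using B by simp
  ultimately show ?thesis unfolding J by auto
qed

lemma powr_pred_summable:
  assumes "b > 1"
  shows "(\<lambda>k. real (k - 1) powr (-b)) summable_on {1<..}"
proof -
  have "(\<lambda>k. real k powr (-b)) summable_on (\<lambda>k. k - 1) ` {1<..}"
    using powr_summable[OF assms] .
  moreover have "inj_on (\<lambda>k::nat. k - 1) {1<..}"
    by (auto simp: inj_on_def)
  ultimately show ?thesis
    by (simp add: summable_on_reindex o_def)
qed

lemma em_rem_summable:
  assumes "u \<noteq> 1" "K \<ge> 1" "Re u + real (max 1 J) > 1"
  shows "(\<lambda>k. norm (em_rem J k u)) summable_on {K<..}"
proof -
  obtain B where B: "B \<ge> 0" "\<And>u k. u \<noteq> 1 \<Longrightarrow> k \<ge> 2 \<Longrightarrow> Re u + real (max 1 J) \<ge> 0 \<Longrightarrow>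
     norm (em_rem J k u) \<le> B * norm (pochhammer u (max 1 J)) * real (k - 1) powr (- Re u - real (max 1 J))"
    using em_rem_bound_max[of J] by blast
  have "(\<lambda>k. B * norm (pochhammer u (max 1 J)) * real (k - 1) powr (- (Re u + real (max 1 J)))) summable_on {1<..}"
    by (intro summable_on_cmult_right powr_pred_summable assms)
  then have "(\<lambda>k. B * norm (pochhammer u (max 1 J)) * real (k - 1) powr (- (Re u + real (max 1 J)))) summable_on {K<..}"
    by (rule summable_on_subset) (use assms in auto)
  then show ?thesis
    by (rule Infinite_Sum.abs_summable_on_comparison_test') (use B(2)[OF assms(1)] assms in auto)
qed

text \<open>The continuation of \<open>\<Sum>k>K. k powr (-u)\<close> to the half-plane \<open>Re u > 1 - max 1 J\<close>.\<close>

definition em_sum :: "nat \<Rightarrow> nat \<Rightarrow> complex \<Rightarrow> complex" where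
  "em_sum J K u = (\<Sum>j\<le>J. bern_coeff j * pow_prim j u (of_nat K)) + (\<Sum>\<^sub>\<infinity>k\<in>{K<..}. em_rem J k u)"

lemma powr_tail_summable_complex:
  assumes "Re u > 1"
  shows "(\<lambda>k. norm (of_nat k powr (-u))) summable_on A"
  using powr_summable[OF assms] by (simp add: norm_nat_powr)

text \<open>For Re u > 1 the value does not depend on \<open>J\<close>; a larger \<open>J\<close>
  only enlarges the half-plane in which \<open>em_sum\<close> remains meaningful.\<close>

lemma em_sum_eq:
  assumes "Re u > 1" "K \<ge> 1"
  shows "((\<lambda>k. of_nat k powr (-u)) has_sum em_sum J K u) {K<..}"
proof -
  have u1: "u \<noteq> 1" using assms by auto
  define G where "G = (\<lambda>k. \<Sum>j\<le>J. bern_coeff j * pow_prim j u (of_nat k))"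
  have eq: "of_nat k powr (-u) = G (k - 1) - G k + em_rem J k u" for k
    by (simp add: em_rem_def G_def right_diff_distrib sum_subtractf)
  have s1: "(\<lambda>k. em_rem J k u) summable_on {K<..}"
    by (rule abs_summable_summable[OF em_rem_summable]) (use assms u1 in auto)
  have s2: "(\<lambda>k. of_nat k powr (-u)) summable_on {K<..}"
    by (rule abs_summable_summable[OF powr_tail_summable_complex]) fact
  have "(\<lambda>k. of_nat k powr (-u) - em_rem J k u) summable_on {K<..}"
    using summable_on_add[OF s2 summable_on_uminus[THEN iffD2, OF s1]] by simp
  then have "(\<lambda>k. G (k - 1) - G k) summable_on {K<..}"
    by (rule summable_on_cong[THEN iffD1, rotated]) (use eq in auto)
  moreover have "G \<longlonglongrightarrow> 0"
    unfolding G_def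
  proof (intro tendsto_null_sum tendsto_mult_right_zero)
    fix j
    have "(\<lambda>k. real k powr (1 - Re u - real j)) \<longlonglongrightarrow> 0"
      by (rule tendsto_neg_powr) (use assms filterlim_real_sequentially in auto)
    then have "(\<lambda>k. of_nat k powr (1 - u - of_nat j)) \<longlonglongrightarrow> 0"
      by (subst tendsto_norm_zero_iff[symmetric]) (simp add: norm_nat_powr)
    then show "(\<lambda>k. pow_prim j u (of_nat k)) \<longlonglongrightarrow> 0"
      unfolding pow_prim_def by (rule tendsto_mult_right_zero)
  qed
  ultimately have "((\<lambda>k. G (k - 1) - G k) has_sum G K) {K<..}"
    by (intro has_sum_telescope) auto
  from has_sum_add[OF this has_sum_infsum[OF s1]] show ?thesis
    unfolding eq[symmetric] by (simp add: em_sum_def G_def)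
qed

lemma pow_prim_holomorphic: "k > 0 \<Longrightarrow> (\<lambda>u. pow_prim j u (of_nat k)) holomorphic_on - {1}"
  unfolding pow_prim_def by (intro holomorphic_intros) auto

lemma em_rem_holomorphic: "k \<ge> 2 \<Longrightarrow> em_rem J k holomorphic_on - {1}"
  unfolding em_rem_def
  by (intro holomorphic_intros pow_prim_holomorphic) auto

lemma em_sum_holomorphic:
  assumes "K \<ge> 1"
  shows "em_sum J K holomorphic_on {u. Re u + real (max 1 J) > 1} - {1}" (is "_ holomorphic_on ?S")
proof -
  obtain B where B: "B \<ge> 0" "\<And>u k. u \<noteq> 1 \<Longrightarrow> k \<ge> 2 \<Longrightarrow> Re u + real (max 1 J) \<ge> 0 \<Longrightarrow>
     norm (em_rem J k u) \<le> B * norm (pochhammer u (max 1 J)) * real (k - 1) powr (- Re u - real (max 1 J))"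
    using em_rem_bound_max[of J] by blast
  have "{u. Re u + real (max 1 J) > 1} = {u. Re u > 1 - real (max 1 J)}" by auto
  then have op: "open ?S"
    by (simp add: open_halfspace_Re_gt open_delete)
  have "(\<lambda>u. \<Sum>\<^sub>\<infinity>k\<in>{K<..}. em_rem J k u) holomorphic_on ?S"
  proof (rule holomorphic_on_infsum[OF op])
    fix k assume "k \<in> {K<..}"
    then show "em_rem J k holomorphic_on ?S"
      using em_rem_holomorphic[of k J] assms by (auto elim: holomorphic_on_subset)
  next
    fix z assume z: "z \<in> ?S"
    \<comment> \<open>Half the distance to the boundary line: on the ball of radius d the exponent
      stays at most -(1 + d), which gives one convergent majorant.\<close>
    define d where "d = (Re z + real (max 1 J) - 1) / 2"
    have d: "d > 0" using z by (simp add: d_def)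
    define P where "P = (norm z + d + real (max 1 J)) ^ (max 1 J)"
    have bd: "norm (em_rem J k u) \<le> B * P * real (k - 1) powr (- (1 + d))"
      if "k \<in> {K<..}" "u \<in> ball z d \<inter> ?S" for k u
    proof -
      have "\<bar>Re z - Re u\<bar> \<le> norm (z - u)" using abs_Re_le_cmod[of "z - u"] by simp
      then have re: "Re u + real (max 1 J) - 1 \<ge> d"
        using that by (auto simp: d_def dist_norm)
      have nu: "norm u \<le> norm z + d"
        using that norm_triangle_ineq2[of u z] by (auto simp: dist_norm norm_minus_commute)
      have "norm (pochhammer u (max 1 J)) \<le> P"
        unfolding P_def
        by (rule order_trans[OF norm_pochhammer_le], rule power_mono) (use nu in auto)
      moreover have "real (k - 1) powr (- Re u - real (max 1 J)) \<le> real (k - 1) powr (- (1 + d))"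
        by (rule powr_mono) (use re that assms in auto)
      ultimately have "B * norm (pochhammer u (max 1 J)) * real (k - 1) powr (- Re u - real (max 1 J))
         \<le> B * P * real (k - 1) powr (- (1 + d))"
        using B(1) d by (intro mult_mono) (auto simp: P_def)
      then show ?thesis
        using B(2)[of u k] that assms re d by (auto elim: order_trans[rotated])
    qed
    have "(\<lambda>k. B * P * real (k - 1) powr (- (1 + d))) summable_on {1<..}"
      by (intro summable_on_cmult_right powr_pred_summable) (use d in auto)
    then have "(\<lambda>k. B * P * real (k - 1) powr (- (1 + d))) summable_on {K<..}"
      by (rule summable_on_subset) (use assms in auto)
    then show "\<exists>e>0. \<exists>M. M summable_on {K<..} \<and> (\<forall>i\<in>{K<..}. \<forall>y\<in>ball z e \<inter> ?S. cmod (em_rem J i y) \<le> M i)"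
      using d bd by blast
  qed
  moreover have "(\<lambda>u. \<Sum>j\<le>J. bern_coeff j * pow_prim j u (of_nat K)) holomorphic_on ?S"
    using assms by (intro holomorphic_intros holomorphic_on_subset[OF pow_prim_holomorphic]) auto
  ultimately show ?thesis
    unfolding em_sum_def by (intro holomorphic_on_add)
qed

subsection \<open>Products of series and binomial coefficients\<close>

lemma summable_on_mult_nonneg:
  fixes f :: "'a \<Rightarrow> real" and g :: "'b \<Rightarrow> real"
  assumes "f summable_on A" "g summable_on B" "\<And>x. x \<in> A \<Longrightarrow> f x \<ge> 0" "\<And>x. x \<in> B \<Longrightarrow> g x \<ge> 0"
  shows "(\<lambda>(a, b). f a * g b) summable_on A \<times> B"
proof (rule summable_on_SigmaI)
  fix x assume "x \<in> A"
  show "((\<lambda>y. case (x, y) of (a, b) \<Rightarrow> f a * g b) has_sum f x * infsum g B) B"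
    using has_sum_cmult_right[OF has_sum_infsum[OF assms(2)]] by simp
next
  show "(\<lambda>x. f x * infsum g B) summable_on A"
    by (rule summable_on_cmult_left) fact
qed (use assms in auto)

lemma has_sum_mult_complex:
  fixes f :: "'a \<Rightarrow> complex" and g :: "'b \<Rightarrow> complex"
  assumes "(f has_sum F) A" "(g has_sum G) B"
    and "(\<lambda>x. norm (f x)) summable_on A" "(\<lambda>x. norm (g x)) summable_on B"
  shows "((\<lambda>(a, b). f a * g b) has_sum F * G) (A \<times> B)"
proof (rule has_sum_SigmaI)
  show "((\<lambda>y. case (x, y) of (a, b) \<Rightarrow> f a * g b) has_sum f x * G) B" for x
    using has_sum_cmult_right[OF assms(2)] by simp
  show "((\<lambda>x. f x * G) has_sum F * G) A"
    by (rule has_sum_cmult_left) fact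
  have "(\<lambda>(a, b). norm (f a) * norm (g b)) summable_on A \<times> B"
    by (rule summable_on_mult_nonneg) (use assms in auto)
  then have "(\<lambda>x. norm ((\<lambda>(a, b). f a * g b) x)) summable_on A \<times> B"
    by (simp add: case_prod_unfold norm_mult)
  then show "(\<lambda>(a, b). f a * g b) summable_on A \<times> B"
    by (rule abs_summable_summable)
qed

text \<open>The coefficient of \<open>y ^ l\<close> in \<open>(1 - y) powr (- a)\<close>.\<close>

definition bin_coeff :: "complex \<Rightarrow> nat \<Rightarrow> complex" where
  "bin_coeff a l = pochhammer a l / fact l"

text \<open>The majorant is the same coefficient for the real parameter \<open>norm a\<close>, so
  majorising series can again be evaluated in closed form.\<close>

lemma norm_bin_coeff_le: "norm (bin_coeff a l) \<le> pochhammer (norm a) l / fact l"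
proof -
  have "norm (pochhammer a l) \<le> pochhammer (norm a) l"
    unfolding pochhammer_prod by (subst prod_norm[symmetric], rule prod_mono)
      (auto intro: order_trans[OF norm_triangle_ineq])
  then show ?thesis
    by (simp add: bin_coeff_def norm_divide divide_right_mono)
qed

lemma pochhammer_sums:
  fixes a y :: real
  assumes "\<bar>y\<bar> < 1"
  shows "(\<lambda>l. pochhammer a l / fact l * y ^ l) sums (1 - y) powr (- a)"
proof -
  have "(\<lambda>n. ((-a) gchoose n) * (-y)^n) sums (1 + (-y)) powr (-a)"
    by (rule gen_binomial_real) (use assms in auto)
  moreover have "((-a) gchoose n) * (-y)^n = pochhammer a n / fact n * y ^ n" for n
    by (simp add: gbinomial_pochhammer power_minus[of y])
  ultimately show ?thesis by simp
qed

lemma bin_coeff_sums: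
  fixes a y :: complex
  assumes "norm y < 1"
  shows "(\<lambda>l. bin_coeff a l * y ^ l) sums (1 - y) powr (- a)"
proof -
  have "(\<lambda>n. ((-a) gchoose n) * (-y)^n) sums (1 + (-y)) powr (-a)"
    by (rule gen_binomial_complex) (use assms in auto)
  moreover have "((-a) gchoose n) * (-y)^n = bin_coeff a n * y ^ n" for n
    by (simp add: gbinomial_pochhammer power_minus[of y] bin_coeff_def)
  ultimately show ?thesis by simp
qed

lemma poly_times_power_tendsto_0:
  fixes A x :: real
  assumes "0 < x" "x < 1"
  shows "(\<lambda>l. (A + real l) ^ p * x ^ l) \<longlonglongrightarrow> 0"
  using assms
proof (induction p arbitrary: x)
  case 0
  then show ?case by (simp add: LIMSEQ_realpow_zero)
next
  case (Suc p)
  \<comment> \<open>One factor sqrt x is spent on a single linear factor, the other on the remaining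
    power by induction.\<close>
  define y where "y = sqrt x"
  have y: "0 < y" "y < 1" "x = y * y" using Suc.prems by (auto simp: y_def)
  have "(\<lambda>l. A * y ^ l + real l * y ^ l) \<longlonglongrightarrow> A * 0 + 0"
    using y by (intro tendsto_add tendsto_mult tendsto_const LIMSEQ_realpow_zero powser_times_n_limit_0) auto
  then have "(\<lambda>l. (A * y ^ l + real l * y ^ l) * ((A + real l) ^ p * y ^ l)) \<longlonglongrightarrow> (A * 0 + 0) * 0"
    using Suc.IH[OF y(1,2)] by (rule tendsto_mult)
  then show ?case
    by (simp add: y(3) power_mult_distrib algebra_simps)
qed

text \<open>Write 1/2 = 2/3 * 3/4: the powers of 2/3 absorb the polynomial, and the binomial series
  still converges at 3/4.\<close>

lemma bin_coeff_poly_summable: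
  fixes A :: real
  assumes "A \<ge> 0"
  shows "(\<lambda>l. norm (bin_coeff a l) * (A + real l) ^ p * (1/2) ^ l) summable_on UNIV"
proof -
  have "(\<lambda>l. (A + real l) ^ p * (2/3::real) ^ l) \<longlonglongrightarrow> 0"
    by (rule poly_times_power_tendsto_0) auto
  then have "Bseq (\<lambda>l. (A + real l) ^ p * (2/3::real) ^ l)"
    by (intro convergent_imp_Bseq convergentI)
  then obtain C where C: "C > 0" "\<And>l. norm ((A + real l) ^ p * (2/3::real) ^ l) \<le> C"
    by (auto simp: Bseq_def)
  have "summable (\<lambda>l. C * (pochhammer (norm a) l / fact l * (3/4::real) ^ l))"
    using pochhammer_sums[of "3/4" "norm a"] by (intro summable_mult) (auto simp: sums_iff)
  then have "(\<lambda>l. C * (pochhammer (norm a) l / fact l * (3/4::real) ^ l)) summable_on UNIV"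
  proof (rule summable_nonneg_imp_summable_on)
    fix l :: nat
    have "0 \<le> pochhammer (norm a) l / fact l"
      by (rule order_trans[OF norm_ge_zero norm_bin_coeff_le])
    then show "0 \<le> C * (pochhammer (norm a) l / fact l * (3/4) ^ l)"
      using C(1) by (intro mult_nonneg_nonneg) auto
  qed
  then show ?thesis
  proof (rule summable_on_comparison_test)
    fix l :: nat
    have "(1/2::real) ^ l = (2/3) ^ l * (3/4) ^ l" by (simp flip: power_mult_distrib)
    then have "norm (bin_coeff a l) * (A + real l) ^ p * (1/2) ^ l
       = ((A + real l) ^ p * (2/3) ^ l) * (norm (bin_coeff a l) * (3/4) ^ l)" by simp
    also have "\<dots> \<le> C * (pochhammer (norm a) l / fact l * (3/4) ^ l)"
      using C(2)[of l] C(1) norm_bin_coeff_le[of a l] assms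
      by (intro mult_mono) (auto intro!: mult_nonneg_nonneg order_trans[OF norm_ge_zero norm_bin_coeff_le])
    finally show "norm (bin_coeff a l) * (A + real l) ^ p * (1/2) ^ l \<le> C * (pochhammer (norm a) l / fact l * (3/4) ^ l)" .
  qed (use assms in auto)
qed

subsection \<open>Meromorphic continuation\<close>

text \<open>The summation variables are \<open>n\<close> and \<open>k = m + n\<close>, so that \<open>n < m\<close> becomes \<open>2 * n < k\<close>; the index \<open>l\<close>
  comes from the binomial expansion of \<open>(1 - n / k) powr (-s1)\<close>.\<close>

definition AV2_dom :: "(nat \<Rightarrow> nat) \<Rightarrow> (nat \<times> nat) set" where
  "AV2_dom K = (SIGMA n:{1..}. {K n<..})"

text \<open>\<open>F\<close> is either the power of k itself or its Euler-Maclaurin remainder, so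
  that both are handled by the same estimates.\<close>

definition AV2_term :: "complex \<Rightarrow> complex \<Rightarrow> (nat \<Rightarrow> nat \<Rightarrow> complex) \<Rightarrow> (nat \<times> nat) \<times> nat \<Rightarrow> complex" where
  "AV2_term s1 s2 F = (\<lambda>((n, k), l). bin_coeff s1 l * of_nat n powr (of_nat l - s2) * F k l)"

text \<open>The base k - 1 instead of k matches the left endpoint in the remainder bounds, and the
  power of A + l makes room for Pochhammer symbols at w + l.\<close>

definition AV2_majorant :: "complex \<Rightarrow> complex \<Rightarrow> real \<Rightarrow> real \<Rightarrow> nat \<Rightarrow> (nat \<times> nat) \<times> nat \<Rightarrow> real" where
  "AV2_majorant s1 s2 b A p = (\<lambda>((n, k), l). real n powr (- Re s2) * real (k - 1) powr (- b) *
      (norm (bin_coeff s1 l) * (A + real l) ^ p * (1/2) ^ l))"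

lemma AV2_majorant_summable:
  assumes "Re s2 > 1" "b > 1" "A \<ge> 0" "\<And>n. n \<ge> 1 \<Longrightarrow> K n \<ge> 1"
  shows "AV2_majorant s1 s2 b A p summable_on AV2_dom K \<times> UNIV"
proof -
  have "(\<lambda>(n, k). real n powr (- Re s2) * real (k - 1) powr (- b)) summable_on {1..} \<times> {1<..}"
    by (rule summable_on_mult_nonneg) (use assms powr_summable powr_pred_summable in auto)
  then have 1: "(\<lambda>(n, k). real n powr (- Re s2) * real (k - 1) powr (- b)) summable_on AV2_dom K"
    by (rule summable_on_subset) (use assms in \<open>force simp: AV2_dom_def\<close>)
  have "(\<lambda>(x, l). (\<lambda>(n, k). real n powr (- Re s2) * real (k - 1) powr (- b)) x *
      (norm (bin_coeff s1 l) * (A + real l) ^ p * (1/2) ^ l)) summable_on AV2_dom K \<times> UNIV"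
    by (rule summable_on_mult_nonneg[OF 1 bin_coeff_poly_summable]) (use assms in auto)
  then show ?thesis
    by (simp add: AV2_majorant_def case_prod_unfold)
qed

text \<open>For integers 2 * n < k means 2 * n \<le> k - 1, so the factor
  \<open>(n / (k - 1)) ^ l\<close> is at most \<open>(1/2) ^ l\<close> even with the shifted
  base.\<close>

lemma norm_AV2_term_le:
  assumes nk: "n \<ge> 1" "2 * n < k" and F: "norm (F k l) \<le> C * (A + real l) ^ p * real (k - 1) powr (- b - real l)"
    and C: "C \<ge> 0" "A \<ge> 0"
  shows "norm (AV2_term s1 s2 F ((n, k), l)) \<le> C * AV2_majorant s1 s2 b A p ((n, k), l)"
proof -
  have k: "real (k - 1) \<ge> 2 * real n" "real n \<ge> 1" using nk by auto
  have "real n ^ l * real (k - 1) powr (- real l) = (real n / real (k - 1)) ^ l"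
    using k by (simp add: powr_minus powr_realpow power_divide divide_inverse power_mult_distrib power_inverse)
  also have "\<dots> \<le> (1 / 2) ^ l"
    using k by (intro power_mono) (auto simp: field_simps)
  finally have 1: "real n ^ l * real (k - 1) powr (- real l) \<le> (1 / 2) ^ l" .
  have e: "real n powr (real l - Re s2) = real n powr (- Re s2) * real n ^ l"
    using k by (simp add: powr_diff powr_minus powr_realpow divide_inverse mult.commute)
  have e2: "real (k - 1) powr (- b - real l) = real (k - 1) powr (- b) * real (k - 1) powr (- real l)"
    by (simp flip: powr_add)
  have "norm (AV2_term s1 s2 F ((n, k), l)) = norm (bin_coeff s1 l) * real n powr (real l - Re s2) * norm (F k l)"
    by (simp add: AV2_term_def norm_mult norm_nat_powr)
  also have "\<dots> \<le> norm (bin_coeff s1 l) * real n powr (real l - Re s2) * (C * (A + real l) ^ p * real (k - 1) powr (- b - real l))"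
    by (intro mult_left_mono F mult_nonneg_nonneg) auto
  also have "\<dots> = (C * (norm (bin_coeff s1 l) * (A + real l) ^ p * (real n powr (- Re s2) * real (k - 1) powr (- b)))) *
      (real n ^ l * real (k - 1) powr (- real l))"
    unfolding e e2 by (simp only: mult_ac)
  also have "\<dots> \<le> (C * (norm (bin_coeff s1 l) * (A + real l) ^ p * (real n powr (- Re s2) * real (k - 1) powr (- b)))) * (1 / 2) ^ l"
    using C by (intro mult_left_mono 1 mult_nonneg_nonneg) auto
  finally show ?thesis
    by (simp add: AV2_majorant_def mult_ac)
qed

lemma AV2_dom_cases:
  assumes "x \<in> AV2_dom K \<times> (UNIV :: nat set)"
  obtains n k l where "x = ((n, k), l)" "n \<ge> 1" "K n < k"
  using assms by (auto simp: AV2_dom_def)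

lemma AV2_term_summable:
  assumes "Re s2 > 1" "b > 1" "A \<ge> 0" "C \<ge> 0" and K: "\<And>n. n \<ge> 1 \<Longrightarrow> K n \<ge> 2 * n"
    and F: "\<And>k l. k \<ge> 3 \<Longrightarrow> norm (F k l) \<le> C * (A + real l) ^ p * real (k - 1) powr (- b - real l)"
  shows "(\<lambda>x. norm (AV2_term s1 s2 F x)) summable_on AV2_dom K \<times> UNIV"
proof (rule Infinite_Sum.abs_summable_on_comparison_test')
  show "(\<lambda>x. C * AV2_majorant s1 s2 b A p x) summable_on AV2_dom K \<times> UNIV"
    by (intro summable_on_cmult_right AV2_majorant_summable) (use assms in force)+
next
  fix x assume "x \<in> AV2_dom K \<times> (UNIV :: nat set)"
  then obtain n k l where x: "x = ((n, k), l)" "n \<ge> 1" "K n < k" by (rule AV2_dom_cases)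
  then have "2 * n < k" using K[of n] by simp
  then show "norm (AV2_term s1 s2 F x) \<le> C * AV2_majorant s1 s2 b A p x"
    unfolding x(1) using x assms by (intro norm_AV2_term_le) auto
qed

lemma pow_term_bound:
  assumes "Re w > 0" "k \<ge> 3"
  shows "norm (of_nat k powr (- (w + of_nat l))) \<le> 1 * (0 + real l) ^ 0 * real (k - 1) powr (- Re w - real l)"
proof -
  have "norm (of_nat k powr (- (w + of_nat l))) = real k powr (- Re w - real l)"
    by (simp add: norm_nat_powr)
  also have "\<dots> \<le> real (k - 1) powr (- Re w - real l)"
    using assms by (intro powr_mono2') auto
  finally show ?thesis by simp
qed

lemma pow_term_summable:
  assumes "Re s2 > 1" "Re w > 1" "\<And>n. n \<ge> 1 \<Longrightarrow> K n \<ge> 2 * n"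
  shows "(\<lambda>x. norm (AV2_term s1 s2 (\<lambda>k l. of_nat k powr (- (w + of_nat l))) x)) summable_on AV2_dom K \<times> UNIV"
  by (rule AV2_term_summable[where b = "Re w" and A = 0 and C = 1 and p = 0])
     (use assms pow_term_bound[of w] in auto)

text \<open>The Pochhammer symbol at w + l has a fixed number of factors, hence grows only
  polynomially in l.\<close>

lemma em_term_bound:
  "\<exists>B\<ge>0. \<forall>w k l. k \<ge> 3 \<and> w + of_nat l \<noteq> 1 \<and> Re w + real (max 1 J) \<ge> 0 \<longrightarrow>
     norm (em_rem J k (w + of_nat l)) \<le> B * ((norm w + real (max 1 J)) + real l) ^ max 1 J *
        real (k - 1) powr (- (Re w + real (max 1 J)) - real l)"
proof -
  obtain B where B: "B \<ge> 0" "\<And>u k. u \<noteq> 1 \<Longrightarrow> k \<ge> 2 \<Longrightarrow> Re u + real (max 1 J) \<ge> 0 \<Longrightarrow>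
     norm (em_rem J k u) \<le> B * norm (pochhammer u (max 1 J)) * real (k - 1) powr (- Re u - real (max 1 J))"
    using em_rem_bound_max[of J] by blast
  have "norm (em_rem J k (w + of_nat l)) \<le> B * ((norm w + real (max 1 J)) + real l) ^ max 1 J *
        real (k - 1) powr (- (Re w + real (max 1 J)) - real l)"
    if "k \<ge> 3" "w + of_nat l \<noteq> 1" "Re w + real (max 1 J) \<ge> 0" for w k l
  proof -
    have "norm (pochhammer (w + of_nat l) (max 1 J)) \<le> ((norm w + real (max 1 J)) + real l) ^ max 1 J"
      by (rule order_trans[OF norm_pochhammer_le], rule power_mono)
         (use norm_triangle_ineq[of w "of_nat l"] in auto)
    then have "B * norm (pochhammer (w + of_nat l) (max 1 J)) * real (k - 1) powr (- Re (w + of_nat l) - real (max 1 J))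
       \<le> B * ((norm w + real (max 1 J)) + real l) ^ max 1 J * real (k - 1) powr (- Re (w + of_nat l) - real (max 1 J))"
      using B(1) by (intro mult_right_mono mult_left_mono) auto
    then show ?thesis
      using B(2)[of "w + of_nat l" k] that by (simp add: algebra_simps)
  qed
  then show ?thesis using B(1) by blast
qed

lemma em_term_summable:
  assumes "Re s2 > 1" "Re w + real (max 1 J) > 1" "\<And>n. n \<ge> 1 \<Longrightarrow> K n \<ge> 2 * n" "\<And>l. w + of_nat l \<noteq> 1"
  shows "(\<lambda>x. norm (AV2_term s1 s2 (\<lambda>k l. em_rem J k (w + of_nat l)) x)) summable_on AV2_dom K \<times> UNIV"
proof -
  obtain B where B: "B \<ge> 0" "\<And>w k l. k \<ge> 3 \<Longrightarrow> w + of_nat l \<noteq> 1 \<Longrightarrow> Re w + real (max 1 J) \<ge> 0 \<Longrightarrow>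
     norm (em_rem J k (w + of_nat l)) \<le> B * ((norm w + real (max 1 J)) + real l) ^ max 1 J *
        real (k - 1) powr (- (Re w + real (max 1 J)) - real l)"
    using em_term_bound[of J] by blast
  show ?thesis
    by (rule AV2_term_summable[OF assms(1,2) _ B(1) assms(3) B(2)]) (use assms in auto)
qed

definition AV2_pair :: "complex \<Rightarrow> complex \<Rightarrow> complex \<Rightarrow> nat \<times> nat \<Rightarrow> complex" where
  "AV2_pair s1 s2 z = (\<lambda>(n, k). of_nat n powr (- s2) * of_nat (k - n) powr (- s1) * of_nat k powr (- z))"

lemma AV2_series_eq_pair: "zeta_AV2_series s1 s2 z = infsum (AV2_pair s1 s2 z) (AV2_dom (\<lambda>n. 2 * n))"
  unfolding zeta_AV2_series_def
  by (rule infsum_reindex_bij_witness[where i = "\<lambda>(n, k). (k - n, n)" and j = "\<lambda>(m, n). (n, m + n)"])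
     (auto simp: AV2_dom_def AV2_pair_def)

text \<open>For fixed n and k the sum over l is the binomial series at n / k < 1/2; absolute
  summability of the triple family allows it to be carried out first. \<open>K\<close> stays free so
  that tails obey the same identity.\<close>

lemma AV2_pair_has_sum:
  assumes "Re s2 > 1" "Re (s1 + z) > 1" and K: "\<And>n. n \<ge> 1 \<Longrightarrow> K n \<ge> 2 * n"
  shows "(AV2_pair s1 s2 z has_sum
    infsum (AV2_term s1 s2 (\<lambda>k l. of_nat k powr (- (s1 + z + of_nat l)))) (AV2_dom K \<times> UNIV)) (AV2_dom K)"
proof -
  let ?g = "AV2_pair s1 s2 z"
  let ?T = "AV2_term s1 s2 (\<lambda>k l. of_nat k powr (- (s1 + z + of_nat l)))"
  have "(?T has_sum infsum ?T (AV2_dom K \<times> UNIV)) (AV2_dom K \<times> UNIV)"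
    by (rule has_sum_infsum, rule abs_summable_summable, rule pow_term_summable) (use assms in auto)
  then show ?thesis
  proof (rule has_sum_Sigma')
    fix x assume "x \<in> AV2_dom K"
    then obtain n k where x0: "x = (n, k)" "n \<ge> 1" "K n < k" by (auto simp: AV2_dom_def)
    then have x: "x = (n, k)" "n \<ge> 1" "2 * n < k" using K[of n] by auto
    define y where "y = real n / real k"
    have y: "0 \<le> y" "y < 1/2" using x by (auto simp: y_def field_simps)
    have "(\<lambda>l. bin_coeff s1 l * of_real y ^ l) sums (1 - of_real y) powr (- s1)"
      by (rule bin_coeff_sums) (use y in auto)
    moreover have "summable (\<lambda>l. norm (bin_coeff s1 l * of_real y ^ l))"
    proof (rule summable_comparison_test)
      show "summable (\<lambda>l. norm (bin_coeff s1 l) * (0 + real l) ^ 0 * (1/2) ^ l)"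
        by (rule summable_on_imp_summable[OF bin_coeff_poly_summable]) simp
      show "\<exists>N. \<forall>l\<ge>N. norm (norm (bin_coeff s1 l * of_real y ^ l)) \<le> norm (bin_coeff s1 l) * (0 + real l) ^ 0 * (1/2) ^ l"
        using y by (auto simp: norm_mult norm_power intro!: mult_left_mono power_mono exI[of _ 0])
    qed
    ultimately have "((\<lambda>l. bin_coeff s1 l * of_real y ^ l) has_sum (1 - of_real y) powr (- s1)) UNIV"
      by (rule norm_summable_imp_has_sum[rotated])
    then have hs: "((\<lambda>l. of_nat n powr (- s2) * of_nat k powr (- (s1 + z)) * (bin_coeff s1 l * of_real y ^ l))
       has_sum of_nat n powr (- s2) * of_nat k powr (- (s1 + z)) * (1 - of_real y) powr (- s1)) UNIV"
      by (rule has_sum_cmult_right)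
    have "of_nat n powr (- s2) * of_nat k powr (- (s1 + z)) * (bin_coeff s1 l * of_real y ^ l) = ?T (x, l)" for l
    proof -
      have "of_nat n powr (of_nat l - s2) = of_nat n powr (- s2) * (of_nat n ^ l :: complex)"
        using x powr_add[of "of_nat n :: complex" "- s2" "of_nat l"] by (simp add: powr_nat')
      moreover have "of_nat k powr (- (s1 + z + of_nat l)) = of_nat k powr (- (s1 + z)) / (of_nat k ^ l :: complex)"
        using x powr_diff[of "of_nat k :: complex" "- (s1 + z)" "of_nat l"] by (simp add: powr_nat' algebra_simps)
      ultimately show ?thesis
        by (simp add: x(1) AV2_term_def y_def power_divide)
    qed
    moreover have "of_nat n powr (- s2) * of_nat k powr (- (s1 + z)) * (1 - of_real y) powr (- s1) = ?g x"
    proof -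
      have "of_nat k * (1 - of_real y) = (of_nat (k - n) :: complex)"
        using x by (simp add: y_def of_nat_diff field_simps)
      then have "of_nat (k - n) powr (- s1) = of_nat k powr (- s1) * (1 - complex_of_real y) powr (- s1)"
        using powr_times_real_left[of "of_nat k" "1 - complex_of_real y" "- s1"] by simp
      moreover have "of_nat k powr (- (s1 + z)) = of_nat k powr (- s1) * (of_nat k powr (- z) :: complex)"
        by (simp flip: powr_add)
      ultimately show ?thesis by (simp add: x(1) AV2_pair_def)
    qed
    ultimately show "((\<lambda>l. ?T (x, l)) has_sum ?g x) UNIV"
      using hs by simp
  qed
qed

text \<open>Makes k the innermost variable, so that for every n and l a whole tail of powers
  appears, ready for Euler-Maclaurin summation.\<close>

lemma has_sum_regroup:
  fixes f :: "('a \<times> 'b) \<times> 'c \<Rightarrow> complex"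
  assumes "(\<lambda>x. norm (f x)) summable_on (Sigma A B) \<times> C"
    and g: "\<And>n l. n \<in> A \<Longrightarrow> l \<in> C \<Longrightarrow> ((\<lambda>k. f ((n, k), l)) has_sum g (n, l)) (B n)"
  shows "(g has_sum infsum f (Sigma A B \<times> C)) (A \<times> C)"
proof -
  have "(f has_sum infsum f (Sigma A B \<times> C)) (Sigma A B \<times> C)"
    using abs_summable_summable[OF assms(1)] by simp
  also have "?this \<longleftrightarrow> ((\<lambda>((n, l), k). f ((n, k), l)) has_sum infsum f (Sigma A B \<times> C)) (SIGMA x:A \<times> C. B (fst x))"
    by (rule has_sum_reindex_bij_witness[where i = "\<lambda>((n, l), k). ((n, k), l)" and j = "\<lambda>((n, k), l). ((n, l), k)"]) auto
  finally show ?thesis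
    by (rule has_sum_Sigma') (use g in auto)
qed

lemma tail_eq_em_sum:
  assumes "Re s2 > 1" "Re w > 1" and K: "\<And>n. n \<ge> 1 \<Longrightarrow> K n \<ge> 2 * n"
  shows "((\<lambda>(n, l). bin_coeff s1 l * of_nat n powr (of_nat l - s2) * em_sum J (K n) (w + of_nat l)) has_sum
     infsum (AV2_term s1 s2 (\<lambda>k l. of_nat k powr (- (w + of_nat l)))) (AV2_dom K \<times> UNIV)) ({1..} \<times> UNIV)"
  unfolding AV2_dom_def
proof (rule has_sum_regroup)
  show "(\<lambda>x. norm (AV2_term s1 s2 (\<lambda>k l. of_nat k powr (- (w + of_nat l))) x)) summable_on
     (SIGMA n:{1..}. {K n<..}) \<times> UNIV"
    using pow_term_summable[OF assms] by (simp add: AV2_dom_def)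
next
  fix n l :: nat assume n: "n \<in> {1..}"
  then have "K n \<ge> 2 * n" using K by auto
  with n have K1: "K n \<ge> 1" by simp
  show "((\<lambda>k. AV2_term s1 s2 (\<lambda>k l. of_nat k powr (- (w + of_nat l))) ((n, k), l)) has_sum
    (case (n, l) of (n, l) \<Rightarrow> bin_coeff s1 l * of_nat n powr (of_nat l - s2) * em_sum J (K n) (w + of_nat l))) {K n<..}"
    unfolding AV2_term_def prod.case
    by (intro has_sum_cmult_right em_sum_eq) (use assms K1 in auto)
qed

section \<open>Singular locus and boundary terms\<close>

lemma closed_one_minus_nat: "closed {w::complex. \<exists>l::nat. w = 1 - of_nat l}"
proof -
  have "{w::complex. \<exists>l::nat. w = 1 - of_nat l} = (+) 1 ` \<int>\<^sub>\<le>\<^sub>0"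
  proof (intro equalityI subsetI)
    fix x :: complex assume "x \<in> (+) 1 ` \<int>\<^sub>\<le>\<^sub>0"
    then obtain y where y: "y \<in> \<int>\<^sub>\<le>\<^sub>0" "x = 1 + y" by auto
    then obtain n :: nat where "y = - of_nat n" by (elim nonpos_Ints_cases')
    then have "x = 1 - of_nat n" using y by simp
    then show "x \<in> {w. \<exists>l::nat. w = 1 - of_nat l}" by blast
  next
    fix x :: complex assume "x \<in> {w. \<exists>l::nat. w = 1 - of_nat l}"
    then obtain l :: nat where "x = 1 - of_nat l" by blast
    then have "x = 1 + (- of_nat l)" by simp
    then show "x \<in> (+) 1 ` \<int>\<^sub>\<le>\<^sub>0"
      by (metis image_eqI minus_of_nat_in_nonpos_Ints)
  qed
  then show ?thesis
    using closed_translation[OF closed_nonpos_Ints, of "1::complex"] by simp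
qed

lemma closed_AV2_sing: "closed (AV2_sing s1 s2)"
proof -
  have "AV2_sing s1 s2 = (\<lambda>z. s1 + z) -` {w. \<exists>l::nat. w = 1 - of_nat l} \<union> (\<lambda>z. s1 + s2 + z - 1) -` {w. \<exists>l::nat. w = 1 - of_nat l}"
    by (auto simp: AV2_sing_def algebra_simps)
  then show ?thesis
    by (simp only:) (intro closed_Un closed_vimage closed_one_minus_nat continuous_intros)
qed

text \<open>Countability keeps the complement connected, as the identity theorem demands.\<close>

lemma countable_AV2_sing: "countable (AV2_sing s1 s2)"
proof (rule countable_subset)
  show "AV2_sing s1 s2 \<subseteq> (\<Union>l::nat. {1 - of_nat l - s1, 2 - of_nat l - s1 - s2})"
  proof
    fix z assume "z \<in> AV2_sing s1 s2"
    then obtain l :: nat where "s1 + z = 1 - of_nat l \<or> s1 + s2 + z = 2 - of_nat l"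
      by (auto simp: AV2_sing_def)
    then have "z = 1 - of_nat l - s1 \<or> z = 2 - of_nat l - s1 - s2"
      by (metis add_diff_cancel_left' diff_diff_add)
    then show "z \<in> (\<Union>l::nat. {1 - of_nat l - s1, 2 - of_nat l - s1 - s2})" by blast
  qed
qed auto

text \<open>The l-part of the boundary term of order j. The 2 comes from the lower limit 2 * n of
  the k-summation, after the power of n has been split off.\<close>

definition AV2_Q :: "complex \<Rightarrow> nat \<Rightarrow> complex \<Rightarrow> complex" where
  "AV2_Q a j w = (\<Sum>\<^sub>\<infinity>l. bin_coeff a l * pow_prim j (w + of_nat l) 2)"

text \<open>The points 1 - l form a closed set, so w + l - 1 stays away from 0 uniformly in l near
  \<open>w0\<close>; the power of 2 then yields the geometric decay.\<close>

lemma AV2_Q_term_bound: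
  assumes w0: "\<And>l. w0 + of_nat l \<noteq> 1"
  shows "\<exists>e>0. \<exists>C\<ge>0. \<exists>A\<ge>0. \<forall>w\<in>ball w0 e. \<forall>l.
    norm (bin_coeff a l * pow_prim j (w + of_nat l) 2) \<le> C * (norm (bin_coeff a l) * (A + real l) ^ j * (1/2) ^ l)"
proof -
  have "w0 \<in> - {w. \<exists>l::nat. w = 1 - of_nat l}"
    using w0 by (auto simp: algebra_simps)
  then obtain d where d: "d > 0" "ball w0 d \<subseteq> - {w. \<exists>l::nat. w = 1 - of_nat l}"
    using closed_one_minus_nat by (meson open_Compl open_contains_ball)
  define e where "e = d / 2"
  have e: "e > 0" using d by (simp add: e_def)
  have low: "norm (w + of_nat l - 1) \<ge> e" if "w \<in> ball w0 e" for w and l :: nat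
  proof (rule ccontr)
    assume "\<not> norm (w + of_nat l - 1) \<ge> e"
    then have "dist w (1 - of_nat l) < e" by (simp add: dist_norm algebra_simps)
    moreover have "dist w0 w < e" using that by simp
    ultimately have "dist w0 (1 - of_nat l) < d"
      using dist_triangle[of w0 "1 - of_nat l" w] by (simp add: e_def)
    then have "1 - of_nat l \<in> - {w::complex. \<exists>l::nat. w = 1 - of_nat l}"
      using d by auto
    then show False by blast
  qed
  define A where "A = norm w0 + e + 1 + real j"
  define C where "C = inverse e * 2 powr (1 - Re w0 + e)"
  have "norm (bin_coeff a l * pow_prim j (w + of_nat l) 2) \<le> C * (norm (bin_coeff a l) * (A + real l) ^ j * (1/2) ^ l)"
    if w: "w \<in> ball w0 e" for w l
  proof -
    have nw: "norm w \<le> norm w0 + e"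
      using w norm_triangle_ineq2[of w w0] by (auto simp: dist_norm norm_minus_commute)
    have "norm (w + of_nat l - 1) \<le> norm w + real l + 1"
      using norm_triangle_ineq4[of "w + of_nat l" 1] norm_triangle_ineq[of w "of_nat l"] by simp
    then have 1: "norm (pochhammer (w + of_nat l - 1) j) \<le> (A + real l) ^ j"
      using nw by (intro order_trans[OF norm_pochhammer_le] power_mono) (auto simp: A_def)
    have 2: "inverse (norm (w + of_nat l - 1)) \<le> inverse e"
      using low[OF w, of l] e by (intro le_imp_inverse_le) auto
    have "Re w0 - Re w \<le> e"
      using w abs_Re_le_cmod[of "w0 - w"] by (auto simp: dist_norm)
    then have "norm (2 powr (1 - (w + of_nat l) - of_nat j)) \<le> 2 powr ((1 - Re w0 + e) - real l)"
      by (subst norm_powr_real_powr) (auto intro!: powr_mono)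
    also have "\<dots> = 2 powr (1 - Re w0 + e) * (1/2) ^ l"
      by (simp only: powr_diff[of 2 "1 - Re w0 + e" "real l"] powr_realpow power_one_over divide_inverse zero_less_numeral mult_1_left power_inverse)
    finally have 3: "norm (2 powr (1 - (w + of_nat l) - of_nat j)) \<le> 2 powr (1 - Re w0 + e) * (1/2) ^ l" .
    have "norm (bin_coeff a l * pow_prim j (w + of_nat l) 2) =
       norm (bin_coeff a l) * (norm (pochhammer (w + of_nat l - 1) j) * inverse (norm (w + of_nat l - 1)) *
         norm (2 powr (1 - (w + of_nat l) - of_nat j)))"
      by (simp add: pow_prim_def norm_mult norm_divide divide_inverse norm_inverse)
    also have "\<dots> \<le> norm (bin_coeff a l) * ((A + real l) ^ j * inverse e * (2 powr (1 - Re w0 + e) * (1/2) ^ l))"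
      using e by (intro mult_left_mono mult_mono 1 2 3) (auto simp: A_def)
    finally show ?thesis by (simp add: C_def mult_ac)
  qed
  moreover have "C \<ge> 0" "A \<ge> 0" using e by (auto simp: C_def A_def)
  ultimately show ?thesis using e by blast
qed

lemma AV2_Q_summable:
  assumes w0: "\<And>l. w + of_nat l \<noteq> 1"
  shows "(\<lambda>l. norm (bin_coeff a l * pow_prim j (w + of_nat l) 2)) summable_on UNIV"
proof -
  obtain e C A where **: "e > 0" "C \<ge> 0" "A \<ge> 0" "\<forall>w\<in>ball w e. \<forall>l.
    norm (bin_coeff a l * pow_prim j (w + of_nat l) 2) \<le> C * (norm (bin_coeff a l) * (A + real l) ^ j * (1/2) ^ l)"
    using AV2_Q_term_bound[OF assms, of a j] by blast
  then have *: "e > 0" "C \<ge> 0" "A \<ge> 0" "\<And>l.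
    norm (bin_coeff a l * pow_prim j (w + of_nat l) 2) \<le> C * (norm (bin_coeff a l) * (A + real l) ^ j * (1/2) ^ l)"
    by auto
  show ?thesis
    by (rule Infinite_Sum.abs_summable_on_comparison_test'[OF summable_on_cmult_right[OF bin_coeff_poly_summable[OF *(3)]]])
       (use * in auto)
qed

lemma AV2_Q_holomorphic: "AV2_Q a j holomorphic_on - {w. \<exists>l::nat. w = 1 - of_nat l}"
  unfolding AV2_Q_def
proof (rule holomorphic_on_infsum)
  show "open (- {w::complex. \<exists>l::nat. w = 1 - of_nat l})"
    using closed_one_minus_nat by (rule open_Compl)
next
  fix l :: nat
  show "(\<lambda>w. bin_coeff a l * pow_prim j (w + of_nat l) 2) holomorphic_on - {w. \<exists>l::nat. w = 1 - of_nat l}"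
    unfolding pow_prim_def by (intro holomorphic_intros) (auto simp: algebra_simps)
next
  fix w0 :: complex assume "w0 \<in> - {w. \<exists>l::nat. w = 1 - of_nat l}"
  then have "\<And>l. w0 + of_nat l \<noteq> 1" by (auto simp: algebra_simps)
  from AV2_Q_term_bound[OF this, of a j] obtain e C A where *: "e > 0" "C \<ge> 0" "A \<ge> 0" "\<And>w l. w \<in> ball w0 e \<Longrightarrow>
    norm (bin_coeff a l * pow_prim j (w + of_nat l) 2) \<le> C * (norm (bin_coeff a l) * (A + real l) ^ j * (1/2) ^ l)"
    by blast
  show "\<exists>e>0. \<exists>M. M summable_on UNIV \<and> (\<forall>l\<in>UNIV. \<forall>w\<in>ball w0 e \<inter> - {w. \<exists>l::nat. w = 1 - of_nat l}.
     norm (bin_coeff a l * pow_prim j (w + of_nat l) 2) \<le> M l)"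
    by (rule exI[of _ e], intro conjI exI[of _ "\<lambda>l. C * (norm (bin_coeff a l) * (A + real l) ^ j * (1/2) ^ l)"]
        summable_on_cmult_right bin_coeff_poly_summable) (use * in auto)
qed

text \<open>Identifies \<open>1 + em_sum J 1 v\<close> with the Riemann zeta function at v; the
  leading 1 is the term n = 1.\<close>

lemma zeta_em:
  assumes "Re v > 1"
  shows "((\<lambda>n. of_nat n powr (-v)) has_sum 1 + em_sum J 1 v) {1..}"
proof -
  have "{1..} = insert 1 {1::nat<..}" by auto
  moreover have "((\<lambda>n. of_nat n powr (-v)) has_sum of_nat 1 powr (-v) + em_sum J 1 v) (insert 1 {1::nat<..})"
    by (rule has_sum_insert) (use em_sum_eq[OF assms, of 1 J] in auto)
  ultimately show ?thesis by simp
qed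

lemma has_sum_finite_sum:
  fixes f :: "'i \<Rightarrow> 'a \<Rightarrow> complex"
  assumes "finite I" "\<And>i. i \<in> I \<Longrightarrow> (f i has_sum s i) A"
  shows "((\<lambda>x. \<Sum>i\<in>I. f i x) has_sum (\<Sum>i\<in>I. s i)) A"
  using assms by (induction I rule: finite_induct) (auto intro: has_sum_add)

text \<open>The exponents 1 - w - l - j and l - s2 of n add up to an exponent free of l. Hence the
  double sum factors into the zeta function at w + s2 - 1 + j and
  \<open>AV2_Q s1 j w\<close>.\<close>

lemma main_part_has_sum:
  assumes "Re s2 > 1" "Re w > 1"
  shows "((\<lambda>(n, l). bin_coeff s1 l * of_nat n powr (of_nat l - s2) *
        (\<Sum>j\<le>J. bern_coeff j * pow_prim j (w + of_nat l) (of_nat (2 * n)))) has_sum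
     (\<Sum>j\<le>J. bern_coeff j * ((1 + em_sum J' 1 (w + s2 - 1 + of_nat j)) * AV2_Q s1 j w))) ({1::nat..} \<times> UNIV)"
proof -
  have ne: "w + of_nat l \<noteq> 1" for l
  proof
    assume "w + of_nat l = 1"
    then have "Re w + real l = 1" by (metis Re_complex_of_real of_real_1 of_real_of_nat_eq plus_complex.simps(1))
    then show False using assms by simp
  qed
  have hs: "((\<lambda>(n, l). of_nat n powr (- (w + s2 - 1 + of_nat j)) * (bin_coeff s1 l * pow_prim j (w + of_nat l) 2))
     has_sum (1 + em_sum J' 1 (w + s2 - 1 + of_nat j)) * AV2_Q s1 j w) ({1::nat..} \<times> UNIV)" for j
  proof (rule has_sum_mult_complex)
    show "((\<lambda>n. of_nat n powr (- (w + s2 - 1 + of_nat j))) has_sum 1 + em_sum J' 1 (w + s2 - 1 + of_nat j)) {1..}"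
      using assms by (intro zeta_em) auto
    show "(\<lambda>n. norm (of_nat n powr (- (w + s2 - 1 + of_nat j)))) summable_on {1..}"
      using assms by (intro powr_tail_summable_complex) auto
    show "(\<lambda>l. norm (bin_coeff s1 l * pow_prim j (w + of_nat l) 2)) summable_on UNIV"
      by (rule AV2_Q_summable[OF ne])
    then show "((\<lambda>l. bin_coeff s1 l * pow_prim j (w + of_nat l) 2) has_sum AV2_Q s1 j w) UNIV"
      unfolding AV2_Q_def by (rule has_sum_infsum[OF abs_summable_summable])
  qed
  have "((\<lambda>x. \<Sum>j\<le>J. bern_coeff j * (case x of (n, l) \<Rightarrow> of_nat n powr (- (w + s2 - 1 + of_nat j)) * (bin_coeff s1 l * pow_prim j (w + of_nat l) 2)))
     has_sum (\<Sum>j\<le>J. bern_coeff j * ((1 + em_sum J' 1 (w + s2 - 1 + of_nat j)) * AV2_Q s1 j w))) ({1::nat..} \<times> UNIV)"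
    by (rule has_sum_finite_sum[OF finite_atMost], rule has_sum_cmult_right, rule hs)
  also have "?this \<longleftrightarrow> ?thesis"
  proof (rule has_sum_cong)
    fix x assume "x \<in> {1::nat..} \<times> (UNIV :: nat set)"
    then obtain n l :: nat where x: "x = (n, l)" "n \<ge> 1" by auto
    have eq: "pow_prim j (w + of_nat l) (of_nat (2 * n)) * of_nat n powr (of_nat l - s2) =
       of_nat n powr (- (w + s2 - 1 + of_nat j)) * pow_prim j (w + of_nat l) 2" for j
    proof -
      have "of_nat (2 * n) powr u = 2 powr u * (of_nat n powr u :: complex)" for u
        using powr_times_real_left[of 2 "of_nat n" u] by simp
      moreover have "of_nat n powr (1 - (w + of_nat l) - of_nat j) * of_nat n powr (of_nat l - s2) =
          (of_nat n powr (- (w + s2 - 1 + of_nat j)) :: complex)"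
        by (simp flip: powr_add add: algebra_simps)
      ultimately show ?thesis by (simp add: pow_prim_def mult_ac)
    qed
    have "bern_coeff j * (of_nat n powr (- (w + s2 - 1 + of_nat j)) * (bin_coeff s1 l * pow_prim j (w + of_nat l) 2))
      = bin_coeff s1 l * of_nat n powr (of_nat l - s2) * (bern_coeff j * pow_prim j (w + of_nat l) (of_nat (2 * n)))" for j
    proof -
      have "bin_coeff s1 l * of_nat n powr (of_nat l - s2) * (bern_coeff j * pow_prim j (w + of_nat l) (of_nat (2 * n)))
        = bin_coeff s1 l * bern_coeff j * (pow_prim j (w + of_nat l) (of_nat (2 * n)) * of_nat n powr (of_nat l - s2))"
        by (simp only: mult_ac)
      then show ?thesis unfolding eq by (simp only: mult_ac)
    qed
    then show "(\<Sum>j\<le>J. bern_coeff j * (case x of (n, l) \<Rightarrow> of_nat n powr (- (w + s2 - 1 + of_nat j)) * (bin_coeff s1 l * pow_prim j (w + of_nat l) 2)))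
      = (case x of (n, l) \<Rightarrow> bin_coeff s1 l * of_nat n powr (of_nat l - s2) *
        (\<Sum>j\<le>J. bern_coeff j * pow_prim j (w + of_nat l) (of_nat (2 * n))))"
      unfolding x(1) prod.case sum_distrib_left by (intro sum.cong refl)
  qed
  finally show ?thesis .
qed

text \<open>Boundary terms plus remainder at order \<open>J\<close>. The zeta factors account for
  the singularities at s1 + s2 + z = 2 - j, and \<open>AV2_Q\<close> for those at s1 + z = 1 -
  l.\<close>

definition AV2_cont :: "complex \<Rightarrow> complex \<Rightarrow> nat \<Rightarrow> complex \<Rightarrow> complex" where
  "AV2_cont s1 s2 J z =
     (\<Sum>j\<le>J. bern_coeff j * ((1 + em_sum J 1 (s1 + z + s2 - 1 + of_nat j)) * AV2_Q s1 j (s1 + z)))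
     + infsum (AV2_term s1 s2 (\<lambda>k l. em_rem J k (s1 + z + of_nat l))) (AV2_dom (\<lambda>n. 2 * n) \<times> UNIV)"

text \<open>Unfolding \<open>em_sum J (2 * n)\<close> separates boundary terms from remainders; each
  family is summable over n and l by itself, so the sum splits.\<close>

lemma AV2_cont_eq_series:
  assumes "Re s2 > 1" "Re (s1 + z) > 1"
  shows "AV2_cont s1 s2 J z = zeta_AV2_series s1 s2 z"
proof -
  define w where "w = s1 + z"
  have ne: "w + of_nat l \<noteq> 1" for l
  proof
    assume "w + of_nat l = 1"
    then have "Re w + real l = 1" by (metis Re_complex_of_real of_real_1 of_real_of_nat_eq plus_complex.simps(1))
    then show False using assms by (simp add: w_def)
  qed
  let ?E = "AV2_term s1 s2 (\<lambda>k l. em_rem J k (w + of_nat l))"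
  let ?c = "\<lambda>n l. bin_coeff s1 l * of_nat n powr (of_nat l - s2)"
  have E: "((\<lambda>(n, l). ?c n l * (\<Sum>\<^sub>\<infinity>k\<in>{2 * n<..}. em_rem J k (w + of_nat l))) has_sum infsum ?E (AV2_dom (\<lambda>n. 2 * n) \<times> UNIV)) ({1..} \<times> UNIV)"
    unfolding AV2_dom_def
  proof (rule has_sum_regroup)
    show "(\<lambda>x. norm (?E x)) summable_on (SIGMA n:{1..}. {2 * n<..}) \<times> UNIV"
      using em_term_summable[of s2 w J "\<lambda>n. 2 * n" s1] assms ne by (simp add: AV2_dom_def w_def)
  next
    fix n l :: nat assume n: "n \<in> {1..}"
    have "(\<lambda>k. em_rem J k (w + of_nat l)) summable_on {2 * n<..}"
      using n ne assms by (intro abs_summable_summable[OF em_rem_summable]) (auto simp: w_def)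
    then show "((\<lambda>k. ?E ((n, k), l)) has_sum (case (n, l) of (n, l) \<Rightarrow>
       ?c n l * (\<Sum>\<^sub>\<infinity>k\<in>{2 * n<..}. em_rem J k (w + of_nat l)))) {2 * n<..}"
      unfolding AV2_term_def prod.case by (intro has_sum_cmult_right has_sum_infsum)
  qed
  have "((\<lambda>(n, l). ?c n l * em_sum J (2 * n) (w + of_nat l)) has_sum zeta_AV2_series s1 s2 z) ({1..} \<times> UNIV)"
    unfolding AV2_series_eq_pair infsumI[OF AV2_pair_has_sum[OF assms, of "\<lambda>n. 2 * n", simplified]]
    using tail_eq_em_sum[of s2 w "\<lambda>n. 2 * n" s1 J] assms by (simp add: w_def)
  moreover have "((\<lambda>(n, l). ?c n l * em_sum J (2 * n) (w + of_nat l)) has_sum AV2_cont s1 s2 J z) ({1..} \<times> UNIV)"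
    using has_sum_add[OF main_part_has_sum[of s2 w s1 J J] E] assms
    by (simp add: AV2_cont_def w_def em_sum_def case_prod_unfold distrib_left)
  ultimately show ?thesis
    using has_sum_unique by blast
qed

lemma AV2_cont_holomorphic:
  assumes s2: "Re s2 > 1" and J: "J \<ge> 1"
  shows "AV2_cont s1 s2 J holomorphic_on {z. Re z > 1 - Re s1 - real J} - AV2_sing s1 s2" (is "_ holomorphic_on ?S")
proof -
  have op: "open ?S"
    by (intro open_Diff open_halfspace_Re_gt closed_AV2_sing)
  have w_ne: "s1 + z + of_nat l \<noteq> 1" if "z \<in> ?S" for z and l :: nat
    using that by (auto simp: AV2_sing_def algebra_simps)
  have "(\<lambda>z. infsum (AV2_term s1 s2 (\<lambda>k l. em_rem J k (s1 + z + of_nat l))) (AV2_dom (\<lambda>n. 2 * n) \<times> UNIV)) holomorphic_on ?S"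
  proof (rule holomorphic_on_infsum[OF op])
    fix x assume "x \<in> AV2_dom (\<lambda>n. 2 * n) \<times> (UNIV :: nat set)"
    then obtain n k l where x: "x = ((n, k), l)" "n \<ge> 1" "2 * n < k" by (rule AV2_dom_cases)
    have "(em_rem J k \<circ> (\<lambda>z. s1 + z + of_nat l)) holomorphic_on ?S"
      by (rule holomorphic_on_compose_gen[OF _ em_rem_holomorphic])
         (use x w_ne in \<open>auto intro!: holomorphic_intros\<close>)
    then show "(\<lambda>z. AV2_term s1 s2 (\<lambda>k l. em_rem J k (s1 + z + of_nat l)) x) holomorphic_on ?S"
      unfolding AV2_term_def x(1) prod.case o_def by (intro holomorphic_intros)
  next
    fix z assume z: "z \<in> ?S"
    obtain B where B: "B \<ge> 0" "\<And>w k l. k \<ge> 3 \<Longrightarrow> w + of_nat l \<noteq> 1 \<Longrightarrow> Re w + real (max 1 J) \<ge> 0 \<Longrightarrow>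
       norm (em_rem J k (w + of_nat l)) \<le> B * ((norm w + real (max 1 J)) + real l) ^ max 1 J *
          real (k - 1) powr (- (Re w + real (max 1 J)) - real l)"
      using em_term_bound[of J] by blast
    \<comment> \<open>Again half the room left in the half-plane, so the majorant can use the
      exponent 1 + d throughout the ball.\<close>
    define d where "d = (Re (s1 + z) + real J - 1) / 2"
    define A where "A = norm (s1 + z) + d + real J"
    have d: "d > 0" using z by (simp add: d_def)
    show "\<exists>e>0. \<exists>M. M summable_on AV2_dom (\<lambda>n. 2 * n) \<times> UNIV \<and> (\<forall>x\<in>AV2_dom (\<lambda>n. 2 * n) \<times> UNIV. \<forall>y\<in>ball z e \<inter> ?S.
       norm (AV2_term s1 s2 (\<lambda>k l. em_rem J k (s1 + y + of_nat l)) x) \<le> M x)"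
    proof (intro exI[of _ d] conjI exI[of _ "\<lambda>x. B * AV2_majorant s1 s2 (1 + d) A J x"] ballI summable_on_cmult_right
        AV2_majorant_summable)
      fix x y assume "x \<in> AV2_dom (\<lambda>n. 2 * n) \<times> (UNIV :: nat set)" and y: "y \<in> ball z d \<inter> ?S"
      then obtain n k l where x: "x = ((n, k), l)" "n \<ge> 1" "2 * n < k" by (elim AV2_dom_cases)
      define w where "w = s1 + y"
      have "dist (s1 + z) w < d" using y by (simp add: w_def dist_norm)
      then have nw: "norm w \<le> norm (s1 + z) + d" "Re w \<ge> Re (s1 + z) - d"
        using norm_triangle_ineq2[of w "s1 + z"] abs_Re_le_cmod[of "s1 + z - w"]
        by (auto simp: dist_norm norm_minus_commute)
      then have re: "Re w + real J \<ge> 1 + d" by (simp add: d_def field_simps)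
      have "norm (em_rem J k (w + of_nat l)) \<le> B * ((norm w + real J) + real l) ^ J * real (k - 1) powr (- (Re w + real J) - real l)"
        using B(2)[of k w l] x w_ne[of y l] y re d J by (simp add: w_def max_def)
      also have "\<dots> \<le> B * (A + real l) ^ J * real (k - 1) powr (- (1 + d) - real l)"
        using x nw re B(1) d by (intro mult_mono power_mono powr_mono) (auto simp: A_def)
      finally show "norm (AV2_term s1 s2 (\<lambda>k l. em_rem J k (s1 + y + of_nat l)) x) \<le> B * AV2_majorant s1 s2 (1 + d) A J x"
        unfolding x(1) by (intro norm_AV2_term_le) (use x B(1) d in \<open>auto simp: A_def w_def\<close>)
    qed (use s2 d in \<open>auto simp: A_def\<close>)
  qed
  moreover have "(\<lambda>z. em_sum J 1 (s1 + z + s2 - 1 + of_nat j)) holomorphic_on ?S" for j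
  proof -
    have "(em_sum J 1 \<circ> (\<lambda>z. s1 + z + s2 - 1 + of_nat j)) holomorphic_on ?S"
    proof (rule holomorphic_on_compose_gen[OF _ em_sum_holomorphic])
      \<comment> \<open>\<open>Re s2 > 1\<close> keeps the argument in the half-plane of
        \<open>em_sum\<close>; the value 1 would mean s1 + s2 + z = 2 - j, which is a removed
        point.\<close>
      show "(\<lambda>z. s1 + z + s2 - 1 + of_nat j) ` ?S \<subseteq> {u. Re u + real (max 1 J) > 1} - {1}"
        using s2 J by (auto simp: AV2_sing_def algebra_simps max_def)
    qed (auto intro!: holomorphic_intros)
    then show ?thesis by (simp add: o_def)
  qed
  moreover have "(\<lambda>z. AV2_Q s1 j (s1 + z)) holomorphic_on ?S" for j
  proof -
    have "(AV2_Q s1 j \<circ> (\<lambda>z. s1 + z)) holomorphic_on ?S"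
      by (rule holomorphic_on_compose_gen[OF _ AV2_Q_holomorphic])
         (auto intro!: holomorphic_intros simp: AV2_sing_def)
    then show ?thesis by (simp add: o_def)
  qed
  ultimately show ?thesis
    unfolding AV2_cont_def by (intro holomorphic_intros)
qed

text \<open>A half-plane without a countable closed set is connected, so the identity theorem makes
  \<open>g m\<close> and \<open>g n\<close> agree wherever both live, and any large enough index may
  be used at a given point.\<close>

lemma glue_continuations:
  fixes g :: "nat \<Rightarrow> complex \<Rightarrow> complex"
  assumes S: "closed S" "countable S"
    and hol: "\<And>n. g n holomorphic_on {z. Re z > a - real n} - S"
    and eq: "\<And>n z. Re z > a \<Longrightarrow> g n z = h z"
  obtains f where "f holomorphic_on - S" "\<And>z. z \<in> S \<Longrightarrow> f z = 0" "\<And>z. Re z > a \<Longrightarrow> z \<notin> S \<Longrightarrow> f z = h z"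
proof -
  let ?H = "\<lambda>n. {z. Re z > a - real n} - S"
  have op: "open (?H n)" for n
    by (intro open_Diff open_halfspace_Re_gt S)
  have con: "connected (?H n)" for n
    by (intro connected_open_diff_countable open_halfspace_Re_gt S convex_connected convex_halfspace_Re_gt) auto
  have ne: "?H 0 \<noteq> {}"
  proof
    assume "?H 0 = {}"
    then have "{z. Re z > a} \<subseteq> S" by auto
    then have "countable {z. Re z > a}" using S countable_subset by blast
    moreover have "uncountable {z. Re z > a}"
    proof -
      have "ball (of_real (a + 1)) 1 \<subseteq> {z. Re z > a}"
      proof
        fix z assume "z \<in> ball (complex_of_real (a + 1)) 1"
        then have "\<bar>Re (of_real (a + 1) - z)\<bar> < 1"
          using abs_Re_le_cmod[of "of_real (a + 1) - z"] by (simp add: dist_norm del: of_real_add)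
        then show "z \<in> {z. Re z > a}" by simp
      qed
      then show ?thesis
        using uncountable_ball[of 1 "complex_of_real (a + 1)"] countable_subset by auto
    qed
    ultimately show False by blast
  qed
  have agree: "g m z = g n z" if "m \<le> n" "z \<in> ?H m" for m n z
  proof (rule analytic_continuation_open[where f = "g m" and g = "g n", OF op[of 0] op[of m] ne con[of m]])
    show "g m holomorphic_on ?H m" by (rule hol)
    show "g n holomorphic_on ?H m" by (rule holomorphic_on_subset[OF hol[of n]]) (use that in auto)
  qed (use that eq in auto)
  \<comment> \<open>The added 1 makes a - J z < Re z strict.\<close>
  define J where "J = (\<lambda>z. nat \<lceil>a - Re z\<rceil> + 1)"
  define f where "f = (\<lambda>z. if z \<in> S then 0 else g (J z) z)"
  have fg: "f z = g n z" if "z \<in> ?H n" for z n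
  proof -
    have "z \<in> ?H (J z)" using that by (auto simp: J_def) linarith
    then have "g (J z) z = g n z"
      using agree[of n "J z" z] agree[of "J z" n z] that by (metis nle_le)
    then show ?thesis
      using that by (simp add: f_def)
  qed
  show ?thesis
  proof (rule that[of f])
    have "\<exists>e>0. f holomorphic_on ball z e" if z: "z \<in> - S" for z
    proof -
      have "z \<in> ?H (J z)" using z by (auto simp: J_def) linarith
      then obtain e where e: "e > 0" "ball z e \<subseteq> ?H (J z)"
        using op open_contains_ball by blast
      have "f holomorphic_on ?H (J z)"
        using hol[of "J z"] by (rule holomorphic_transform) (use fg in auto)
      then show ?thesis using e holomorphic_on_subset by blast
    qed
    then show "f holomorphic_on - S"
      using S(1) by (metis analytic_on_def analytic_on_open open_Compl)
    show "f z = h z" if "Re z > a" "z \<notin> S" for z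
      using fg[of z 0] eq[of z 0] that by simp
  qed (auto simp: f_def)
qed

text \<open>The definite description needs existence, by gluing, and uniqueness, by the identity
  theorem off the singular locus together with the value 0 prescribed on it. For
  \<open>Re s2 > 1\<close> the region of absolute convergence reduces to Re (s1 + z) > 1.\<close>

lemma zeta_AV2_spec:
  assumes s2: "Re s2 > 1"
  shows "zeta_AV2 s1 s2 holomorphic_on UNIV - AV2_sing s1 s2"
    and "Re (s1 + z) > 1 \<Longrightarrow> zeta_AV2 s1 s2 z = zeta_AV2_series s1 s2 z"
proof -
  define P where "P = (\<lambda>f. f holomorphic_on (UNIV - AV2_sing s1 s2)
          \<and> (\<forall>z\<in>AV2_sing s1 s2. f z = 0)
          \<and> (\<forall>z. Re s1 + Re z > 1 \<and> Re s1 + Re s2 + Re z > 2 \<longrightarrow> f z = zeta_AV2_series s1 s2 z))"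
  have reg: "z \<notin> AV2_sing s1 s2" if "Re (s1 + z) > 1" for z
    using that s2 by (auto simp: AV2_sing_def complex_eq_iff)
  obtain f where f: "f holomorphic_on - AV2_sing s1 s2" "\<And>z. z \<in> AV2_sing s1 s2 \<Longrightarrow> f z = 0"
    "\<And>z. Re z > 1 - Re s1 \<Longrightarrow> z \<notin> AV2_sing s1 s2 \<Longrightarrow> f z = zeta_AV2_series s1 s2 z"
  proof (rule glue_continuations[where g = "\<lambda>n. AV2_cont s1 s2 (n + 1)" and a = "1 - Re s1"
        and h = "zeta_AV2_series s1 s2" and S = "AV2_sing s1 s2", OF closed_AV2_sing countable_AV2_sing])
    fix n show "AV2_cont s1 s2 (n + 1) holomorphic_on {z. Re z > 1 - Re s1 - real n} - AV2_sing s1 s2"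
      by (rule holomorphic_on_subset[OF AV2_cont_holomorphic[OF s2]]) auto
  next
    fix n z assume "Re z > 1 - Re s1"
    then show "AV2_cont s1 s2 (n + 1) z = zeta_AV2_series s1 s2 z"
      by (intro AV2_cont_eq_series s2) simp
  qed auto
  have "P f" unfolding P_def using f reg by (auto simp: Compl_eq_Diff_UNIV)
  moreover have "g = f" if "P g" for g
  proof
    fix z
    show "g z = f z"
    proof (cases "z \<in> AV2_sing s1 s2")
      case True
      then show ?thesis using that f by (simp add: P_def)
    next
      case False
      show ?thesis
      proof (rule analytic_continuation_open[of "{z. Re z > 1 - Re s1}" "UNIV - AV2_sing s1 s2" g f])
        show "open (UNIV - AV2_sing s1 s2)" by (intro open_Diff open_UNIV closed_AV2_sing)
        show "connected (UNIV - AV2_sing s1 s2)"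
          by (intro connected_open_diff_countable countable_AV2_sing) auto
        show "{z. Re z > 1 - Re s1} \<noteq> {}" by (auto intro: exI[of _ "of_real (2 - Re s1)"])
        show "g holomorphic_on UNIV - AV2_sing s1 s2" using that by (simp add: P_def)
        show "f holomorphic_on UNIV - AV2_sing s1 s2" using f(1) by (simp add: Compl_eq_Diff_UNIV)
        show "g z = f z" if "z \<in> {z. Re z > 1 - Re s1}" for z
          using that \<open>P g\<close> f(3)[of z] reg[of z] s2 by (simp add: P_def)
      qed (use False reg in \<open>auto simp: open_halfspace_Re_gt\<close>)
    qed
  qed
  ultimately have "P (THE f. P f)" by (rule theI)
  moreover have "(THE f. P f) = zeta_AV2 s1 s2"
    unfolding P_def zeta_AV2_def by (rule ext) simp
  ultimately have Pz: "P (zeta_AV2 s1 s2)" by simp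
  then show "zeta_AV2 s1 s2 holomorphic_on UNIV - AV2_sing s1 s2" by (simp add: P_def)
  show "zeta_AV2 s1 s2 z = zeta_AV2_series s1 s2 z" if "Re (s1 + z) > 1"
    using Pz that s2 by (simp add: P_def)
qed

subsection \<open>The tail at large height\<close>

lemma tail_norm_le:
  assumes "Re v > 1" "K \<ge> 1"
  shows "norm (em_sum 0 K v) \<le> real K powr (1 - Re v) / (Re v - 1)"
proof -
  have "norm (em_sum 0 K v) \<le> (\<Sum>\<^sub>\<infinity>k\<in>{K<..}. real k powr (- Re v))"
    by (rule norm_infsum_le[OF em_sum_eq[OF assms] has_sum_infsum[OF powr_tail_summable(1)[OF assms]]])
       (simp add: norm_nat_powr)
  also have "\<dots> \<le> real K powr (1 - Re v) / (Re v - 1)"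
    by (rule powr_tail_summable(2)[OF assms])
  finally show ?thesis .
qed

lemma pochhammer_fact_nonneg: "0 \<le> pochhammer (norm (u::complex)) n / fact n"
  by (rule order_trans[OF norm_ge_zero norm_bin_coeff_le])

lemma pochhammer_step_has_sum:
  fixes a y :: real
  assumes "0 < y" "y < 1" 
  shows "((\<lambda>q. pochhammer (norm (u::complex)) (q + 1) / fact (q + 1) * y ^ (q + 1)) has_sum (1 - y) powr (- norm u) - 1) UNIV"
proof -
  have "(\<lambda>l. pochhammer (norm u) l / fact l * y ^ l) sums (1 - y) powr (- norm u)"
    by (rule pochhammer_sums) (use assms in auto)
  from sums_split_initial_segment[OF this, of 1]
  have "(\<lambda>q. pochhammer (norm u) (q + 1) / fact (q + 1) * y ^ (q + 1)) sums ((1 - y) powr (- norm u) - 1)"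
    by simp
  moreover have "0 \<le> pochhammer (norm u) (q + 1) / fact (q + 1) * y ^ (q + 1)" for q
    by (rule mult_nonneg_nonneg[OF pochhammer_fact_nonneg]) (use assms in auto)
  ultimately show ?thesis
    by (intro sums_nonneg_imp_has_sum) auto
qed

text \<open>Equals \<open>bin_coeff (u - 1) (q + 2) / (u - 1)\<close> for u \<noteq> 1, with the
  division carried out.\<close>

definition rec_coeff :: "complex \<Rightarrow> nat \<Rightarrow> complex" where
  "rec_coeff u q = pochhammer u (q + 1) / fact (q + 2)"

text \<open>The factor 1/2 comes from the shift in the factorial, since q + 2 \<ge> 2; it later
  cancels the 2 in the bound of \<open>em_sum_bound\<close>.\<close>

lemma norm_rec_coeff_le: "norm (rec_coeff u q) \<le> pochhammer (norm u) (q + 1) / fact (q + 1) / 2"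
proof -
  have "norm (rec_coeff u q) = norm (bin_coeff u (q + 1)) / real (q + 2)"
    by (simp add: rec_coeff_def bin_coeff_def norm_divide norm_mult field_simps
      flip: of_nat_Suc)
  also have "\<dots> \<le> norm (bin_coeff u (q + 1)) / 2"
    by (intro divide_left_mono) auto
  also have "\<dots> \<le> pochhammer (norm u) (q + 1) / fact (q + 1) / 2"
    by (intro divide_right_mono norm_bin_coeff_le) auto
  finally show ?thesis .
qed

lemma norm_rec_coeff_le': "norm (rec_coeff u q) \<le> pochhammer (norm u) (q + 1) / fact (q + 1)"
proof -
  have "x / 2 \<le> x" if "x \<ge> 0" for x :: real using that by simp
  from order_trans[OF norm_rec_coeff_le this[OF pochhammer_fact_nonneg]] show ?thesis .
qed

text \<open>Expand \<open>(1 - 1 / k) powr (1 - u)\<close>: the terms of degree 0 and 1 cancel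
  against \<open>pow_prim 0 u k\<close> and \<open>k powr (-u)\<close>, so the series starts at
  degree 2.\<close>

lemma em_rem_0_has_sum:
  assumes u: "u \<noteq> 1" and k: "k \<ge> 2"
  shows "((\<lambda>q. - rec_coeff u q * of_nat k powr (- (u + 1 + of_nat q))) has_sum em_rem 0 k u) UNIV"
proof -
  define y where "y = 1 / real k"
  have y: "0 < y" "y < 1" using k by (auto simp: y_def)
  define P where "P = (of_nat k :: complex) powr (1 - u)"
  have "(\<lambda>r. bin_coeff (u - 1) r * of_real y ^ r) sums (1 - of_real y) powr (- (u - 1))"
    by (rule bin_coeff_sums) (use y in auto)
  from sums_split_initial_segment[OF this, of 2]
  have "(\<lambda>q. bin_coeff (u - 1) (q + 2) * of_real y ^ (q + 2)) sums
      ((1 - of_real y) powr (1 - u) - 1 - (u - 1) * of_real y)"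
    by (simp add: numeral_2_eq_2 bin_coeff_def algebra_simps)
  from sums_mult[OF this, of "- P / (u - 1)"]
  have "(\<lambda>q. - P / (u - 1) * (bin_coeff (u - 1) (q + 2) * of_real y ^ (q + 2))) sums
      (- P / (u - 1) * ((1 - of_real y) powr (1 - u) - 1 - (u - 1) * of_real y))" .
  moreover have "- P / (u - 1) * (bin_coeff (u - 1) (q + 2) * of_real y ^ (q + 2)) =
      - rec_coeff u q * of_nat k powr (- (u + 1 + of_nat q))" for q
  proof -
    have "bin_coeff (u - 1) (q + 2) = (u - 1) * rec_coeff u q"
      by (simp add: bin_coeff_def rec_coeff_def pochhammer_rec[of "u - 1"])
    moreover have "P * of_real y ^ (q + 2) = of_nat k powr (- (u + 1 + of_nat q))"
    proof -
      have "of_nat k powr (- (u + 1 + of_nat q)) = of_nat k powr ((1 - u) - of_nat (q + 2))"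
        by (simp add: algebra_simps)
      also have "\<dots> = P / of_nat k powr (of_nat (q + 2))"
        unfolding P_def by (rule powr_diff)
      also have "\<dots> = P / of_nat k ^ (q + 2)"
        using k by (subst powr_nat') auto
      finally show ?thesis by (simp add: y_def power_divide)
    qed
    ultimately show ?thesis using u by (simp add: mult_ac)
  qed
  moreover have "- P / (u - 1) * ((1 - of_real y) powr (1 - u) - 1 - (u - 1) * of_real y) = em_rem 0 k u"
  proof -
    have "of_nat k * (1 - complex_of_real y) = of_nat (k - 1)"
      using k by (simp add: y_def of_nat_diff field_simps)
    then have 1: "of_nat (k - 1) powr (1 - u) = P * (1 - complex_of_real y) powr (1 - u)"
      using powr_times_real_left[of "of_nat k" "1 - complex_of_real y" "1 - u"] by (simp add: P_def)
    have 2: "of_nat k powr (- u) = P * of_real y"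
      using k powr_diff[of "of_nat k :: complex" "1 - u" 1] by (simp add: P_def y_def)
    have "em_rem 0 k u = P * of_real y - (P * (1 - of_real y) powr (1 - u) - P) / (u - 1)"
      unfolding em_rem_def pow_prim_def using u
      by (simp add: bern_coeff_0 1[simplified] 2 diff_divide_distrib P_def[symmetric])
    also have "\<dots> = - P / (u - 1) * ((1 - of_real y) powr (1 - u) - 1 - (u - 1) * of_real y)"
      using u by (simp add: field_simps)
    finally show ?thesis by simp
  qed
  ultimately have s: "(\<lambda>q. - rec_coeff u q * of_nat k powr (- (u + 1 + of_nat q))) sums em_rem 0 k u"
    by simp
  show ?thesis
  proof (rule norm_summable_imp_has_sum[OF _ s])
    show "summable (\<lambda>q. norm (- rec_coeff u q * of_nat k powr (- (u + 1 + of_nat q))))"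
    proof (rule summable_comparison_test)
      show "summable (\<lambda>q. real k powr (- Re u) * (pochhammer (norm u) (q + 1) / fact (q + 1) * y ^ (q + 1)))"
        by (intro summable_mult summable_on_imp_summable has_sum_imp_summable[OF pochhammer_step_has_sum[OF y]])
      show "\<exists>N. \<forall>q\<ge>N. norm (norm (- rec_coeff u q * of_nat k powr (- (u + 1 + of_nat q))))
         \<le> real k powr (- Re u) * (pochhammer (norm u) (q + 1) / fact (q + 1) * y ^ (q + 1))"
      proof (intro exI allI impI)
        fix q :: nat
        have "norm (of_nat k powr (- (u + 1 + of_nat q))) = real k powr (- Re u) * y ^ (q + 1)"
        proof -
          have "Re (- (u + 1 + of_nat q)) = - Re u - real (q + 1)" by simp
          then have "norm (of_nat k powr (- (u + 1 + of_nat q))) = real k powr (- Re u - real (q + 1))"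
            by (simp only: norm_nat_powr)
          also have "\<dots> = real k powr (- Re u) / real k powr (real (q + 1))"
            by (rule powr_diff)
          also have "\<dots> = real k powr (- Re u) / real k ^ (q + 1)"
            using k by (subst powr_realpow) auto
          finally show ?thesis by (simp add: y_def power_divide)
        qed
        moreover have "norm (rec_coeff u q) \<le> pochhammer (norm u) (q + 1) / fact (q + 1)"
          by (rule norm_rec_coeff_le')
        ultimately have "norm (- rec_coeff u q * of_nat k powr (- (u + 1 + of_nat q)))
           \<le> (pochhammer (norm u) (q + 1) / fact (q + 1)) * (real k powr (- Re u) * y ^ (q + 1))"
          using y by (simp only: norm_mult norm_minus_cancel) (intro mult_right_mono, auto)
        then show "norm (norm (- rec_coeff u q * of_nat k powr (- (u + 1 + of_nat q))))
         \<le> real k powr (- Re u) * (pochhammer (norm u) (q + 1) / fact (q + 1) * y ^ (q + 1))"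
          by (simp only: real_norm_def abs_norm_cancel mult_ac)
      qed
    qed
  qed
qed

text \<open>Sum the expansion of the remainder over k > K and exchange the sums. All arguments u + 1
  + q have real part above 1, so the value at u, possibly a continued one, is expressed through
  genuine tails.\<close>

lemma em_sum_0_recurrence:
  assumes u: "u \<noteq> 1" "Re u > 0" and K: "K \<ge> 1"
  shows "((\<lambda>q. rec_coeff u q * em_sum 0 K (u + 1 + of_nat q)) has_sum pow_prim 0 u (of_nat K) - em_sum 0 K u) UNIV"
proof -
  let ?f = "\<lambda>(k, q). - rec_coeff u q * of_nat k powr (- (u + 1 + of_nat q))"
  have abs: "(\<lambda>x. norm (?f x)) summable_on {K<..} \<times> UNIV"
  proof (rule Infinite_Sum.abs_summable_on_comparison_test')
    \<comment> \<open>k > K \<ge> 1 gives 1 / k \<le> 1/2. The factor 2 raises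
      \<open>(1/2) ^ (q + 1)\<close> to \<open>(1/2) ^ q\<close>.\<close>
    show "(\<lambda>(k, q). real k powr (- (1 + Re u)) * (2 * (pochhammer (norm u) (q + 1) / fact (q + 1) * (1/2) ^ (q + 1)))) summable_on {K<..} \<times> UNIV"
    proof (rule summable_on_mult_nonneg)
      show "(\<lambda>k. real k powr (- (1 + Re u))) summable_on {K<..}"
        by (rule powr_summable) (use u in auto)
      show "(\<lambda>q. 2 * (pochhammer (norm u) (q + 1) / fact (q + 1) * (1/2) ^ (q + 1))) summable_on UNIV"
        by (intro summable_on_cmult_right has_sum_imp_summable[OF pochhammer_step_has_sum]) auto
      show "0 \<le> 2 * (pochhammer (norm u) (q + 1) / fact (q + 1) * (1/2) ^ (q + 1))" for q
        by (intro mult_nonneg_nonneg[of 2] mult_nonneg_nonneg[OF pochhammer_fact_nonneg]) auto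
    qed auto
  next
    fix x assume "x \<in> {K<..} \<times> (UNIV :: nat set)"
    then obtain k q where x: "x = (k, q)" "k \<ge> 2" using K by auto
    have "norm (of_nat k powr (- (u + 1 + of_nat q))) = real k powr (- (1 + Re u)) * inverse (real k) ^ q"
    proof -
      have "norm (of_nat k powr (- (u + 1 + of_nat q))) = real k powr (- (1 + Re u) - real q)"
        by (simp add: norm_nat_powr algebra_simps)
      also have "\<dots> = real k powr (- (1 + Re u)) / real k powr (real q)"
        by (rule powr_diff)
      also have "\<dots> = real k powr (- (1 + Re u)) / real k ^ q"
        using x by (subst powr_realpow) auto
      finally show ?thesis by (simp add: divide_inverse power_inverse)
    qed
    also have "\<dots> \<le> real k powr (- (1 + Re u)) * (1 / 2) ^ q"
      using x by (intro mult_left_mono power_mono) (auto simp: field_simps)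
    finally have 1: "norm (of_nat k powr (- (u + 1 + of_nat q))) \<le> real k powr (- (1 + Re u)) * (1 / 2) ^ q" .
    have 2: "norm (rec_coeff u q) \<le> pochhammer (norm u) (q + 1) / fact (q + 1)"
      by (rule norm_rec_coeff_le')
    have "norm (?f x) = norm (rec_coeff u q) * norm (of_nat k powr (- (u + 1 + of_nat q)))"
      by (simp add: x(1) norm_mult)
    also have "\<dots> \<le> (pochhammer (norm u) (q + 1) / fact (q + 1)) * (real k powr (- (1 + Re u)) * (1 / 2) ^ q)"
      by (rule mult_mono[OF 2 1 pochhammer_fact_nonneg norm_ge_zero])
    finally show "norm (?f x) \<le> (case x of (k, q) \<Rightarrow> real k powr (- (1 + Re u)) * (2 * (pochhammer (norm u) (q + 1) / fact (q + 1) * (1/2) ^ (q + 1))))"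
      by (simp add: x(1) mult_ac del: fact_Suc)
  qed
  have "(?f has_sum infsum ?f ({K<..} \<times> UNIV)) ({K<..} \<times> UNIV)"
    by (rule has_sum_infsum[OF abs_summable_summable[OF abs]])
  then have "((\<lambda>k. em_rem 0 k u) has_sum infsum ?f ({K<..} \<times> UNIV)) {K<..}"
  proof (rule has_sum_Sigma')
    fix k assume "k \<in> {K<..}"
    then show "((\<lambda>q. ?f (k, q)) has_sum em_rem 0 k u) UNIV"
      using em_rem_0_has_sum[OF u(1), of k] K by simp
  qed
  then have 1: "infsum ?f ({K<..} \<times> UNIV) = em_sum 0 K u - pow_prim 0 u (of_nat K)"
    by (simp add: em_sum_def bern_coeff_0 infsumI)
  have "((\<lambda>(q, k). ?f (k, q)) has_sum infsum ?f ({K<..} \<times> UNIV)) (UNIV \<times> {K<..})"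
    using has_sum_infsum[OF abs_summable_summable[OF abs]] by (subst has_sum_swap) simp
  then have "((\<lambda>q. - rec_coeff u q * em_sum 0 K (u + 1 + of_nat q)) has_sum infsum ?f ({K<..} \<times> UNIV)) UNIV"
  proof (rule has_sum_Sigma')
    fix q :: nat
    show "((\<lambda>k. case (q, k) of (q, k) \<Rightarrow> ?f (k, q)) has_sum - rec_coeff u q * em_sum 0 K (u + 1 + of_nat q)) {K<..}"
      unfolding prod.case by (intro has_sum_cmult_right em_sum_eq) (use u K in auto)
  qed
  from has_sum_uminusI[OF this] show ?thesis
    unfolding 1 by simp
qed

text \<open>The exponent -a * ln (1 - y) is at most a * y * (1 + 2 * y) \<le> 1/2 * 7/6 = 7/12, and
  exp (7/12) < 2. The bound 1/12 on y reflects K \<ge> 12.\<close>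

lemma one_minus_powr_le_2:
  fixes a y :: real
  assumes "0 < y" "y \<le> 1/12" "0 \<le> a" "a * y \<le> 1/2"
  shows "(1 - y) powr (- a) \<le> 2"
proof -
  have "- y - 2 * y\<^sup>2 \<le> ln (1 - y)"
    by (rule ln_one_minus_pos_lower_bound) (use assms in auto)
  then have "- a * ln (1 - y) \<le> a * (y + 2 * y\<^sup>2)"
    using mult_left_mono[of "- y - 2 * y\<^sup>2" "ln (1 - y)" a] assms by (simp add: algebra_simps)
  also have "\<dots> = (a * y) * (1 + 2 * y)" by (simp add: power2_eq_square algebra_simps)
  also have "\<dots> \<le> (1/2) * (1 + 2 * (1/12))"
    using assms by (intro mult_mono) auto
  finally have x: "- a * ln (1 - y) \<le> 7/12" by simp
  have "exp (- a * ln (1 - y)) \<le> exp (7/12)" using x by simp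
  also have "\<dots> \<le> 1 + 7/12 + (7/12)\<^sup>2" by (rule exp_bound) auto
  also have "\<dots> \<le> (2::real)" by (simp add: power2_eq_square)
  finally show ?thesis
    using assms by (simp add: powr_def)
qed

text \<open>For \<open>j\<close> beyond the imaginary part the trivial bound suffices; the recurrence expresses
  \<open>j\<close> through larger indices with total weight at most one half, which gives the bound for
  all \<open>j\<close> by descending induction.\<close>

lemma em_sum_bound:
  assumes re: "0 < Re u" "Re u \<le> 1" and im: "Im u \<ge> 2" and K: "real K \<ge> 6 * Im u"
  shows "norm (em_sum 0 K (u + of_nat j)) \<le> 2 * real K powr (1 - Re u - real j) / Im u"
proof -
  define \<tau> where "\<tau> = Im u"
  have \<tau>: "\<tau> \<ge> 2" "real K \<ge> 6 * \<tau>" using im K by (auto simp: \<tau>_def)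
  have K1: "K \<ge> 1" "real K \<ge> 12" using \<tau> by auto
  \<comment> \<open>\<open>m\<close> measures how far below \<tau> + 1 the claim has descended. The
    recurrence at j calls only j + 1 and above, which the previous threshold covers.\<close>
  have "\<forall>j. real j \<ge> \<tau> + 1 - real m \<longrightarrow> norm (em_sum 0 K (u + of_nat j)) \<le> 2 * real K powr (1 - Re u - real j) / \<tau>" for m
  proof (induction m)
    case 0
    show ?case
    proof (intro allI impI)
      fix j assume j: "real j \<ge> \<tau> + 1 - real 0"
      have "norm (em_sum 0 K (u + of_nat j)) \<le> real K powr (1 - Re (u + of_nat j)) / (Re (u + of_nat j) - 1)"
        by (rule tail_norm_le) (use j re \<tau> K1 in auto)
      also have "\<dots> \<le> real K powr (1 - Re (u + of_nat j)) / \<tau>"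
        using j re \<tau> by (intro divide_left_mono) auto
      also have "\<dots> \<le> 2 * real K powr (1 - Re u - real j) / \<tau>"
        using \<tau> by (auto simp: field_simps)
      finally show "norm (em_sum 0 K (u + of_nat j)) \<le> 2 * real K powr (1 - Re u - real j) / \<tau>" .
    qed
  next
    case (Suc m)
    show ?case
    proof (intro allI impI)
      fix j assume j: "real j \<ge> \<tau> + 1 - real (Suc m)"
      show "norm (em_sum 0 K (u + of_nat j)) \<le> 2 * real K powr (1 - Re u - real j) / \<tau>"
      proof (cases "real j \<ge> \<tau> + 1 - real m")
        case True
        then show ?thesis using Suc by blast
      next
        case False
        define v where "v = u + of_nat j"
        have v: "v \<noteq> 1" "Re v > 0" "Im v = \<tau>" "Re v = Re u + real j"
          using re im by (auto simp: v_def \<tau>_def complex_eq_iff)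
        have "norm v \<le> \<bar>Re v\<bar> + \<bar>Im v\<bar>" by (rule cmod_le)
        \<comment> \<open>Here Re v \<le> 1 + j < \<tau> + 2 \<le> 2 * \<tau>. With K \<ge> 6 *
          \<tau> this makes \<open>norm v / K\<close> at most 1/2, which is where the 6 comes
          from.\<close>
        then have nv: "norm v \<le> 3 * \<tau>" using False v re \<tau> by auto
        define y where "y = 1 / real K"
        have y: "0 < y" "y \<le> 1/12" "y < 1" "norm v * y \<le> 1/2"
          using nv \<tau> K1 by (auto simp: y_def field_simps)
        \<comment> \<open>Half of the claimed bound: the boundary term and the sum of the later
          tails contribute at most \<open>M\<close> each.\<close>
        define M where "M = real K powr (1 - Re v) / \<tau>"
        have M: "M \<ge> 0" using \<tau> by (simp add: M_def)
        have bd: "norm (rec_coeff v q * em_sum 0 K (v + 1 + of_nat q)) \<le>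
            M * (pochhammer (norm v) (q + 1) / fact (q + 1) * y ^ (q + 1))" for q
        proof -
          have a: "norm (em_sum 0 K (u + of_nat (j + 1 + q))) \<le> 2 * real K powr (1 - Re u - real (j + 1 + q)) / \<tau>"
          proof (rule Suc.IH[rule_format])
            show "real (j + 1 + q) \<ge> \<tau> + 1 - real m" using j by simp
          qed
          have b: "u + of_nat (j + 1 + q) = v + 1 + of_nat q" by (simp add: v_def)
          have c: "real K powr (1 - Re u - real (j + 1 + q)) = real K powr (1 - Re v) * y ^ (q + 1)"
          proof -
            have "real K powr (1 - Re u - real (j + 1 + q)) = real K powr ((1 - Re v) - real (q + 1))"
              by (simp add: v algebra_simps)
            also have "\<dots> = real K powr (1 - Re v) / real K powr (real (q + 1))"
              by (rule powr_diff)
            also have "\<dots> = real K powr (1 - Re v) / real K ^ (q + 1)"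
              using K1 by (subst powr_realpow) auto
            finally show ?thesis by (simp add: y_def power_divide)
          qed
          have 1: "norm (em_sum 0 K (v + 1 + of_nat q)) \<le> 2 * (M * y ^ (q + 1))"
            using a unfolding b c by (simp add: M_def)
          \<comment> \<open>The half from \<open>rec_coeff\<close> cancels the 2 of the induction
            hypothesis, leaving a binomial series at 1 / K without its constant term.\<close>
          have "norm (rec_coeff v q * em_sum 0 K (v + 1 + of_nat q)) \<le>
             (pochhammer (norm v) (q + 1) / fact (q + 1) / 2) * (2 * (M * y ^ (q + 1)))"
            unfolding norm_mult
            by (rule mult_mono[OF norm_rec_coeff_le 1 divide_nonneg_nonneg[OF pochhammer_fact_nonneg] norm_ge_zero]) simp
          also have "\<dots> = M * (pochhammer (norm v) (q + 1) / fact (q + 1) * y ^ (q + 1))"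
            by (simp only: times_divide_eq_left times_divide_eq_right mult_ac) simp
          finally show ?thesis .
        qed
        have "norm (pow_prim 0 v (of_nat K) - em_sum 0 K v) \<le> M * ((1 - y) powr (- norm v) - 1)"
          by (rule norm_infsum_le[OF em_sum_0_recurrence[OF v(1,2) K1(1)] has_sum_cmult_right[OF pochhammer_step_has_sum[OF y(1,3)]] bd])
        also have "\<dots> \<le> M * 1"
          using M one_minus_powr_le_2[of y "norm v"] y by (intro mult_left_mono) auto
        finally have 1: "norm (pow_prim 0 v (of_nat K) - em_sum 0 K v) \<le> M" by simp
        have "norm (v - 1) \<ge> \<tau>"
          using abs_Im_le_cmod[of "v - 1"] v \<tau> by simp
        then have "norm (pow_prim 0 v (of_nat K)) \<le> M"
          unfolding pow_prim_def M_def using \<tau> v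
          by (simp add: norm_mult norm_divide norm_nat_powr) (intro divide_left_mono, auto)
        then have "norm (em_sum 0 K v) \<le> M + M"
          using 1 norm_triangle_ineq4[of "pow_prim 0 v (of_nat K)" "pow_prim 0 v (of_nat K) - em_sum 0 K v"] by simp
        then show ?thesis
          by (simp add: M_def v_def[symmetric] v(4) diff_diff_eq)
      qed
    qed
  qed
  from this[of "nat \<lceil>\<tau> + 1\<rceil>"] have "norm (em_sum 0 K (u + of_nat j)) \<le> 2 * real K powr (1 - Re u - real j) / \<tau>"
    using \<tau> by (smt (verit) of_nat_0_le_iff real_nat_ceiling_ge)
  then show ?thesis by (simp add: \<tau>_def)
qed

section \<open>The truncated Dirichlet series and its remainder\<close>

definition AV2_coeff :: "complex \<Rightarrow> complex \<Rightarrow> nat \<Rightarrow> complex" where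
  "AV2_coeff s1 s2 k = (\<Sum>m\<in>{m. k < 2 * m \<and> m \<le> k - 1}. of_nat m powr (-s1) * of_nat (k - m) powr (-s2))"

text \<open>Cutting at k \<le> N leaves, for each n, the range k > max N (2 * n). Order 0 of
  \<open>em_sum\<close> suffices, since only Re (s1 + z) > 0 is needed.\<close>

definition AV2_tail :: "complex \<Rightarrow> complex \<Rightarrow> nat \<Rightarrow> complex \<Rightarrow> complex" where
  "AV2_tail s1 s2 N z = (\<Sum>\<^sub>\<infinity>(n, l)\<in>{1..} \<times> UNIV.
     bin_coeff s1 l * of_nat n powr (of_nat l - s2) * em_sum 0 (max N (2 * n)) (s1 + z + of_nat l))"

lemma AV2_series_split:
  assumes "Re s2 > 1" "Re (s1 + z) > 1"
  shows "zeta_AV2_series s1 s2 z = (\<Sum>k=1..N. AV2_coeff s1 s2 k * of_nat k powr (-z)) + AV2_tail s1 s2 N z"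
proof -
  define K where "K = (\<lambda>n. max N (2 * n))"
  define F where "F = {(n, k). 1 \<le> n \<and> 2 * n < k \<and> k \<le> N}"
  have K: "K n \<ge> 2 * n" for n by (simp add: K_def)
  have "F \<subseteq> {..N} \<times> {..N}" by (auto simp: F_def)
  then have fin: "finite F" by (rule finite_subset) auto
  let ?T = "AV2_term s1 s2 (\<lambda>k l. of_nat k powr (- (s1 + z + of_nat l)))"
  have "AV2_dom (\<lambda>n. 2 * n) = F \<union> AV2_dom K" "F \<inter> AV2_dom K = {}"
    by (auto simp: AV2_dom_def F_def K_def)
  then have "(AV2_pair s1 s2 z has_sum (sum (AV2_pair s1 s2 z) F + infsum ?T (AV2_dom K \<times> UNIV))) (AV2_dom (\<lambda>n. 2 * n))"
    using has_sum_Un_disjoint[OF has_sum_finite[OF fin] AV2_pair_has_sum[of s2 s1 z K]] assms K by simp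
  then have "zeta_AV2_series s1 s2 z = sum (AV2_pair s1 s2 z) F + infsum ?T (AV2_dom K \<times> UNIV)"
    unfolding AV2_series_eq_pair by (rule infsumI)
  also have "infsum ?T (AV2_dom K \<times> UNIV) = AV2_tail s1 s2 N z"
    unfolding AV2_tail_def using infsumI[OF tail_eq_em_sum[of s2 "s1 + z" K s1 0]] assms K
    by (simp add: K_def)
  also have "sum (AV2_pair s1 s2 z) F = (\<Sum>(k, m)\<in>(SIGMA k:{1..N}. {m. k < 2 * m \<and> m \<le> k - 1}).
      of_nat m powr (-s1) * of_nat (k - m) powr (-s2) * of_nat k powr (-z))"
    by (rule sum.reindex_bij_witness[where i = "\<lambda>(k, m). (k - m, k)" and j = "\<lambda>(n, k). (k, k - n)"])
       (auto simp: F_def AV2_pair_def)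
  also have "\<dots> = (\<Sum>k=1..N. AV2_coeff s1 s2 k * of_nat k powr (-z))"
    unfolding AV2_coeff_def sum_distrib_right
    by (rule sum.Sigma[symmetric]) auto
  finally show ?thesis .
qed

lemma pred_powr_tail_le:
  fixes x :: real
  assumes x: "x > 0" and K: "K \<ge> 1"
  shows "(\<Sum>\<^sub>\<infinity>k\<in>{K<..}. real (k - 1) powr (- (1 + x))) \<le> real K powr (1 - x) * (1 + 1 / x)"
proof -
  have "(\<Sum>\<^sub>\<infinity>k\<in>{K<..}. real (k - 1) powr (- (1 + x))) = (\<Sum>\<^sub>\<infinity>k\<in>{K..}. real k powr (- (1 + x)))"
    by (rule infsum_reindex_bij_witness[where i = Suc and j = "\<lambda>k. k - 1"]) auto
  also have "{K..} = insert K {K<..}" by auto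
  also have "(\<Sum>\<^sub>\<infinity>k\<in>insert K {K<..}. real k powr (- (1 + x))) = real K powr (- (1 + x)) + (\<Sum>\<^sub>\<infinity>k\<in>{K<..}. real k powr (- (1 + x)))"
    using x by (intro infsum_insert powr_summable) auto
  also have "\<dots> \<le> real K powr (- (1 + x)) + real K powr (1 - (1 + x)) / (1 + x - 1)"
    using x K by (intro add_left_mono powr_tail_summable) auto
  also have "\<dots> \<le> real K powr (1 - x) + real K powr (1 - x) / x"
    using x K by (intro add_mono divide_right_mono powr_mono) (auto intro!: divide_right_mono powr_mono)
  finally show ?thesis by (simp add: algebra_simps)
qed

text \<open>Supplies the local majorant for holomorphy, uniform in K and l but without any gain in
  the height. For l \<ge> 1 the real part exceeds 1 and the plain tail bound applies; l = 0 needs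
  the remainder estimate.\<close>

lemma em_sum_0_local_bound:
  assumes u0: "u0 \<noteq> 1" "Re u0 > 0" and e1: "e1 > 0"
  shows "\<exists>e>0. \<exists>C\<ge>0. e \<le> e1 \<and> (\<forall>u\<in>ball u0 e. \<forall>K\<ge>1. \<forall>l.
     norm (em_sum 0 K (u + of_nat l)) \<le> C * real K powr (1 - Re u - real l))"
proof -
  obtain B where B: "B \<ge> 0" "\<And>u k. u \<noteq> 1 \<Longrightarrow> k \<ge> 2 \<Longrightarrow> Re u + 1 \<ge> 0 \<Longrightarrow>
     norm (em_rem 0 k u) \<le> B * norm u * real (k - 1) powr (- Re u - 1)"
    using em_rem_bound_max[of 0] by auto
  define \<rho> where "\<rho> = Re u0 / 2"
  define \<delta> where "\<delta> = norm (u0 - 1) / 2"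
  define e where "e = min e1 (min \<rho> \<delta>)"
  have pos: "\<rho> > 0" "\<delta> > 0" "e > 0" "e \<le> e1" "e \<le> \<rho>" "e \<le> \<delta>"
    using u0 e1 by (auto simp: \<rho>_def \<delta>_def e_def)
  define C0 where "C0 = 1 / \<delta> + B * (norm u0 + e) * (1 + 1 / \<rho>)"
  define C where "C = 1 / \<rho> + C0"
  have C0: "C0 \<ge> 0" using pos B by (auto simp: C0_def)
  have "norm (em_sum 0 K (u + of_nat l)) \<le> C * real K powr (1 - Re u - real l)"
    if u: "u \<in> ball u0 e" and K: "K \<ge> 1" for u K l
  proof -
    have ud: "norm (u0 - u) < e" using u by (simp add: dist_norm)
    have reu: "Re u \<ge> \<rho>" using abs_Re_le_cmod[of "u0 - u"] ud pos by (simp add: \<rho>_def)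
    have u1: "norm (u - 1) \<ge> \<delta>"
      using norm_triangle_ineq[of "u0 - u" "u - 1"] ud pos by (simp add: \<delta>_def)
    have nu: "norm u \<le> norm u0 + e"
      using norm_triangle_ineq2[of u u0] ud by (simp add: norm_minus_commute)
    show ?thesis
    proof (cases l)
      case 0
      have une: "u \<noteq> 1" using u1 pos by auto
      have s: "(\<lambda>k. B * norm u * real (k - 1) powr (- (1 + Re u))) summable_on {K<..}"
        by (rule summable_on_subset[OF summable_on_cmult_right[OF powr_pred_summable[of "1 + Re u"]]])
           (use reu pos K in auto)
      have "norm (\<Sum>\<^sub>\<infinity>k\<in>{K<..}. em_rem 0 k u) \<le> (\<Sum>\<^sub>\<infinity>k\<in>{K<..}. B * norm u * real (k - 1) powr (- (1 + Re u)))"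
      proof (rule norm_infsum_le[OF has_sum_infsum has_sum_infsum[OF s]])
        show "(\<lambda>k. em_rem 0 k u) summable_on {K<..}"
          by (rule abs_summable_summable[OF em_rem_summable]) (use une K reu pos in auto)
        show "norm (em_rem 0 k u) \<le> B * norm u * real (k - 1) powr (- (1 + Re u))" if "k \<in> {K<..}" for k
        proof -
          have "- Re u - 1 = - (1 + Re u)" by simp
          moreover have "norm (em_rem 0 k u) \<le> B * norm u * real (k - 1) powr (- Re u - 1)"
            by (rule B(2)) (use une that K reu pos in auto)
          ultimately show ?thesis by (simp only:)
        qed
      qed
      also have "\<dots> = B * norm u * (\<Sum>\<^sub>\<infinity>k\<in>{K<..}. real (k - 1) powr (- (1 + Re u)))"
        by (rule infsum_cmult_right')
      also have "\<dots> \<le> B * (norm u0 + e) * (real K powr (1 - Re u) * (1 + 1 / Re u))"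
        using B(1) nu pos reu K pred_powr_tail_le[of "Re u" K]
        by (intro mult_mono) (auto intro!: infsum_nonneg)
      also have "\<dots> \<le> B * (norm u0 + e) * (real K powr (1 - Re u) * (1 + 1 / \<rho>))"
        using B(1) pos reu by (intro mult_left_mono add_left_mono divide_left_mono) auto
      finally have 1: "norm (\<Sum>\<^sub>\<infinity>k\<in>{K<..}. em_rem 0 k u) \<le> B * (norm u0 + e) * (1 + 1 / \<rho>) * real K powr (1 - Re u)"
        by (simp add: mult_ac)
      have "norm (pow_prim 0 u (of_nat K)) = real K powr (1 - Re u) / norm (u - 1)"
        by (simp add: pow_prim_def norm_mult norm_divide norm_nat_powr)
      also have "\<dots> \<le> 1 / \<delta> * real K powr (1 - Re u)"
        using u1 pos by (simp add: frac_le)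
      finally have "norm (pow_prim 0 u (of_nat K) + (\<Sum>\<^sub>\<infinity>k\<in>{K<..}. em_rem 0 k u)) \<le> C0 * real K powr (1 - Re u)"
        using 1 by (intro order_trans[OF norm_triangle_ineq]) (simp add: C0_def algebra_simps)
      also have "\<dots> \<le> C * real K powr (1 - Re u)"
        using pos by (intro mult_right_mono) (auto simp: C_def)
      finally show ?thesis
        by (simp add: 0 em_sum_def bern_coeff_0)
    next
      case (Suc l')
      have "norm (em_sum 0 K (u + of_nat l)) \<le> real K powr (1 - Re (u + of_nat l)) / (Re (u + of_nat l) - 1)"
        by (rule tail_norm_le) (use Suc reu pos K in auto)
      also have "\<dots> \<le> real K powr (1 - Re (u + of_nat l)) / \<rho>"
        using Suc reu pos by (intro divide_left_mono) auto
      also have "\<dots> \<le> C * real K powr (1 - Re u - real l)"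
        using C0 by (simp add: C_def distrib_right diff_diff_eq)
      finally show ?thesis .
    qed
  qed
  moreover have "C \<ge> 0" using pos C0 by (simp add: C_def)
  ultimately show ?thesis using pos by blast
qed

text \<open>For K = max N (2 * n), K \<ge> 2 * n gives the geometric factor in l, and K \<le> 2 * N
  * n separates N from n at the price of \<open>n powr e\<close>, which the decay in n has to pay
  for.\<close>

lemma cut_weight_le:
  assumes n: "n \<ge> 1" and N: "N \<ge> 1" and e: "0 \<le> e" "1 - x \<le> e"
  shows "real n powr (real l - a) * real (max N (2 * n)) powr (1 - x - real l)
     \<le> (2 * real N) powr e * (real n powr (- (a - e)) * (1 / 2) ^ l)"
proof -
  define K where "K = real (max N (2 * n))"
  have K: "K \<ge> 2 * real n" "K \<ge> 1" "K \<le> (2 * real N) * real n"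
  proof -
    show "K \<ge> 2 * real n" "K \<ge> 1" using n by (auto simp: K_def)
    have "real n \<le> real N * real n" "real N \<le> 2 * real N * real n"
      using n N by (auto simp: mult_le_cancel_left mult_le_cancel_right intro: order_trans[of _ "real N * 1"])
    then show "K \<le> (2 * real N) * real n" by (auto simp: K_def)
  qed
  have "K powr (1 - x) \<le> K powr e" using K e by (intro powr_mono) auto
  also have "\<dots> \<le> ((2 * real N) * real n) powr e" using K e by (intro powr_mono2) auto
  also have "\<dots> = (2 * real N) powr e * real n powr e" by (simp add: powr_mult)
  finally have 1: "K powr (1 - x) \<le> (2 * real N) powr e * real n powr e" .
  have "real n powr (real l) * K powr (- real l) = (real n / K) ^ l"
    using K n by (simp add: powr_minus powr_realpow power_divide divide_inverse power_mult_distrib power_inverse)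
  also have "\<dots> \<le> (1 / 2) ^ l"
    using K n by (intro power_mono) (auto simp: field_simps)
  finally have 2: "real n powr (real l) * K powr (- real l) \<le> (1 / 2) ^ l" .
  have "real n powr (real l - a) * K powr (1 - x - real l) =
     K powr (1 - x) * (real n powr (real l) * K powr (- real l)) * real n powr (- a)"
  proof -
    have "real n powr (real l - a) = real n powr (real l) * real n powr (- a)"
         "K powr (1 - x - real l) = K powr (1 - x) * K powr (- real l)"
      by (simp_all flip: powr_add)
    then show ?thesis by simp
  qed
  also have "\<dots> \<le> (2 * real N) powr e * real n powr e * (1 / 2) ^ l * real n powr (- a)"
    using 1 2 by (intro mult_right_mono mult_mono) auto
  also have "\<dots> = (2 * real N) powr e * (real n powr (- (a - e)) * (1 / 2) ^ l)"
  proof -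
    have "real n powr (- (a - e)) = real n powr e * real n powr (- a)" by (simp flip: powr_add)
    then show ?thesis by simp
  qed
  finally show ?thesis by (simp add: K_def)
qed

text \<open>The factor \<open>(0 + real l) ^ 0\<close> is 1; it gives the weight the shape of
  \<open>bin_coeff_poly_summable\<close>.\<close>

definition tail_weight :: "complex \<Rightarrow> real \<Rightarrow> nat \<times> nat \<Rightarrow> real" where
  "tail_weight s1 b = (\<lambda>(n, l). real n powr (- b) * (norm (bin_coeff s1 l) * (0 + real l) ^ 0 * (1 / 2) ^ l))"

lemma tail_weight_summable:
  assumes "b > 1"
  shows "tail_weight s1 b summable_on {1..} \<times> UNIV"
  unfolding tail_weight_def
  by (intro summable_on_mult_nonneg powr_summable assms bin_coeff_poly_summable) auto

lemma norm_tail_term_le: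
  assumes "n \<ge> 1" "N \<ge> 1" "0 \<le> e" "1 - Re w \<le> e" "C \<ge> 0"
    and em: "norm (em_sum 0 (max N (2 * n)) (w + of_nat l)) \<le> C * real (max N (2 * n)) powr (1 - Re w - real l)"
  shows "norm (bin_coeff s1 l * of_nat n powr (of_nat l - s2) * em_sum 0 (max N (2 * n)) (w + of_nat l))
     \<le> C * (2 * real N) powr e * tail_weight s1 (Re s2 - e) (n, l)"
proof -
  have "norm (bin_coeff s1 l * of_nat n powr (of_nat l - s2) * em_sum 0 (max N (2 * n)) (w + of_nat l))
     = norm (bin_coeff s1 l) * real n powr (real l - Re s2) * norm (em_sum 0 (max N (2 * n)) (w + of_nat l))"
    by (simp add: norm_mult norm_nat_powr)
  also have "\<dots> \<le> norm (bin_coeff s1 l) * real n powr (real l - Re s2) * (C * real (max N (2 * n)) powr (1 - Re w - real l))"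
    by (intro mult_left_mono em) auto
  also have "\<dots> = C * norm (bin_coeff s1 l) * (real n powr (real l - Re s2) * real (max N (2 * n)) powr (1 - Re w - real l))"
    by (simp only: mult_ac)
  also have "\<dots> \<le> C * norm (bin_coeff s1 l) * ((2 * real N) powr e * (real n powr (- (Re s2 - e)) * (1 / 2) ^ l))"
    using assms by (intro mult_left_mono cut_weight_le) auto
  finally show ?thesis by (simp add: tail_weight_def mult_ac)
qed

lemma AV2_tail_holomorphic:
  assumes "Re s2 > 1" "N \<ge> 1"
  shows "AV2_tail s1 s2 N holomorphic_on {z. Re z > max (- Re s1) (2 - Re s1 - Re s2)} - {1 - s1}" (is "_ holomorphic_on ?S")
  unfolding AV2_tail_def case_prod_unfold
proof (rule holomorphic_on_infsum)
  show "open ?S" by (intro open_delete open_halfspace_Re_gt)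
next
  fix x assume "x \<in> {1::nat..} \<times> (UNIV :: nat set)"
  then obtain n l where x: "x = (n, l)" "n \<ge> 1" by auto
  have "(em_sum 0 (max N (2 * n)) \<circ> (\<lambda>z. s1 + z + of_nat l)) holomorphic_on ?S"
  proof (rule holomorphic_on_compose_gen[OF _ em_sum_holomorphic])
    show "(\<lambda>z. s1 + z + of_nat l) ` ?S \<subseteq> {u. Re u + real (max 1 0) > 1} - {1}"
    proof safe
      fix z assume z: "Re z > max (- Re s1) (2 - Re s1 - Re s2)" "z \<noteq> 1 - s1" "s1 + z + of_nat l = 1"
      then have "Re (s1 + z + of_nat l) = 1" by simp
      then have "Re s1 + Re z + real l = 1" by simp
      moreover have "Re s1 + Re z > 0" using z(1) by simp
      ultimately have "l = 0" by linarith
      then have "s1 + z = 1" using z(3) by simp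
      then show False using z by (metis add_diff_cancel_left')
    qed auto
  qed (use assms in \<open>auto intro!: holomorphic_intros\<close>)
  then show "(\<lambda>z. bin_coeff s1 (snd x) * of_nat (fst x) powr (of_nat (snd x) - s2) *
      em_sum 0 (max N (2 * fst x)) (s1 + z + of_nat (snd x))) holomorphic_on ?S"
    by (auto simp: x(1) o_def intro!: holomorphic_intros)
next
  fix z assume z: "z \<in> ?S"
  \<comment> \<open>Half the slack in Re (s1 + s2 + z) > 2, so that Re s2 - \<eta> > 1 persists on
    the whole ball.\<close>
  define e2 where "e2 = (Re s2 + Re (s1 + z) - 2) / 2"
  have e2: "e2 > 0" using z by (simp add: e2_def)
  have w0: "s1 + z \<noteq> 1" "Re (s1 + z) > 0" using z by (auto simp: algebra_simps)
  obtain e C where e: "e > 0" "C \<ge> 0" "e \<le> e2" "\<And>u K l. u \<in> ball (s1 + z) e \<Longrightarrow> K \<ge> 1 \<Longrightarrow>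
     norm (em_sum 0 K (u + of_nat l)) \<le> C * real K powr (1 - Re u - real l)"
    using em_sum_0_local_bound[OF w0 e2] by blast
  define \<eta> where "\<eta> = max 0 (1 - Re (s1 + z) + e)"
  have \<eta>: "\<eta> \<ge> 0" "Re s2 - \<eta> > 1"
  proof -
    have "e \<le> (Re s2 + Re (s1 + z) - 2) / 2" using e(3) by (simp add: e2_def)
    moreover have "Re s2 + Re (s1 + z) > 2" using z by simp
    ultimately show "Re s2 - \<eta> > 1" using assms by (auto simp: \<eta>_def field_simps)
  qed (simp add: \<eta>_def)
  show "\<exists>e>0. \<exists>M. M summable_on {1..} \<times> UNIV \<and> (\<forall>x\<in>{1..} \<times> UNIV. \<forall>y\<in>ball z e \<inter> ?S.
     norm (bin_coeff s1 (snd x) * of_nat (fst x) powr (of_nat (snd x) - s2) *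
      em_sum 0 (max N (2 * fst x)) (s1 + y + of_nat (snd x))) \<le> M x)"
  proof (intro exI[of _ e] conjI exI[of _ "\<lambda>x. C * (2 * real N) powr \<eta> * tail_weight s1 (Re s2 - \<eta>) x"] ballI
      summable_on_cmult_right tail_weight_summable)
    fix x y assume "x \<in> {1::nat..} \<times> (UNIV :: nat set)" and y: "y \<in> ball z e \<inter> ?S"
    then obtain n l where x: "x = (n, l)" "n \<ge> 1" by auto
    have yb: "s1 + y \<in> ball (s1 + z) e" using y by (simp add: dist_norm)
    then have "Re (s1 + y) \<ge> Re (s1 + z) - e"
      using abs_Re_le_cmod[of "s1 + z - (s1 + y)"] by (simp add: dist_norm)
    then have "1 - Re (s1 + y) \<le> \<eta>" by (simp add: \<eta>_def)
    then show "norm (bin_coeff s1 (snd x) * of_nat (fst x) powr (of_nat (snd x) - s2) *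
      em_sum 0 (max N (2 * fst x)) (s1 + y + of_nat (snd x))) \<le> C * (2 * real N) powr \<eta> * tail_weight s1 (Re s2 - \<eta>) x"
      unfolding x(1) fst_conv snd_conv
      by (intro norm_tail_term_le e(4)[OF yb]) (use x \<eta> e assms in auto)
  qed (use e \<eta> in auto)
qed

text \<open>The split is known for Re (s1 + z) > 1. In the larger half-plane 1 - s1 is the only
  singular point, so both sides are holomorphic on a connected set and the identity theorem
  transports the equation.\<close>

lemma zeta_AV2_eq_sum_tail:
  assumes s2: "Re s2 > 1" and N: "N \<ge> 1" and z: "Re (s1 + z) > 0" "Re (s1 + s2 + z) > 2" "s1 + z \<noteq> 1"
  shows "zeta_AV2 s1 s2 z = (\<Sum>k=1..N. AV2_coeff s1 s2 k * of_nat k powr (-z)) + AV2_tail s1 s2 N z"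
proof -
  define a where "a = max (- Re s1) (2 - Re s1 - Re s2)"
  let ?S = "{z. Re z > a} - {1 - s1}"
  let ?g = "\<lambda>z. (\<Sum>k=1..N. AV2_coeff s1 s2 k * of_nat k powr (-z)) + AV2_tail s1 s2 N z"
  have sub: "?S \<subseteq> UNIV - AV2_sing s1 s2"
  proof
    fix y assume y: "y \<in> ?S"
    have "y \<notin> AV2_sing s1 s2"
    proof
      assume "y \<in> AV2_sing s1 s2"
      then obtain l :: nat where "s1 + y = 1 - of_nat l \<or> s1 + s2 + y = 2 - of_nat l"
        by (auto simp: AV2_sing_def)
      then show False
      proof
        assume *: "s1 + y = 1 - of_nat l"
        then have "Re (s1 + y) = 1 - real l" by simp
        then have "real l < 1" using y by (simp add: a_def)
        then have "s1 + y = 1" using * by simp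
        then show False using y by (metis DiffE add_diff_cancel_left' singletonI)
      next
        assume "s1 + s2 + y = 2 - of_nat l"
        then have "Re (s1 + s2 + y) = 2 - real l" by simp
        then show False using y by (simp add: a_def)
      qed
    qed
    then show "y \<in> UNIV - AV2_sing s1 s2" by simp
  qed
  show ?thesis
  proof (rule analytic_continuation_open[of "{z. Re z > 1 - Re s1}" ?S "zeta_AV2 s1 s2" ?g])
    show "open ?S" by (intro open_delete open_halfspace_Re_gt)
    show "connected ?S"
      by (intro connected_open_diff_countable open_halfspace_Re_gt convex_connected convex_halfspace_Re_gt) auto
    show "{z. Re z > 1 - Re s1} \<noteq> {}" by (auto intro: exI[of _ "of_real (2 - Re s1)"])
    show "{z. Re z > 1 - Re s1} \<subseteq> ?S" using s2 by (auto simp: a_def)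
    show "zeta_AV2 s1 s2 holomorphic_on ?S"
      using zeta_AV2_spec(1)[OF s2] sub by (rule holomorphic_on_subset)
    show "?g holomorphic_on ?S"
      using AV2_tail_holomorphic[OF s2 N] unfolding a_def by (intro holomorphic_intros) auto
    show "zeta_AV2 s1 s2 y = ?g y" if "y \<in> {z. Re z > 1 - Re s1}" for y
      using that zeta_AV2_spec(2)[OF s2] AV2_series_split[OF s2] by simp
    show "open {z. Re z > 1 - Re s1}" by (rule open_halfspace_Re_gt)
    show "z \<in> ?S" using z by (auto simp: a_def)
  qed
qed

text \<open>\<open>em_sum_bound\<close> applies for every n because max N (2 * n) \<ge> N. The
  weights are summable since \<open>Re s2 - e > 1\<close> restates Re s1 + Re s2 + \<sigma>3 >
  2.\<close>

lemma zeta_AV2_approx: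
  assumes s2: "Re s2 > 1" and \<sigma>: "0 < Re s1 + \<sigma>3" "Re s1 + \<sigma>3 \<le> 1" "Re s1 + Re s2 + \<sigma>3 > 2"
  shows "\<exists>C\<ge>0. \<forall>t N. Im s1 + t \<ge> 2 \<and> real N \<ge> 6 * (Im s1 + t) \<longrightarrow>
     norm (zeta_AV2 s1 s2 (Complex \<sigma>3 t) - (\<Sum>k=1..N. AV2_coeff s1 s2 k * of_nat k powr (- Complex \<sigma>3 t)))
       \<le> C * real N powr (1 - Re s1 - \<sigma>3) / (Im s1 + t)"
proof -
  define e where "e = 1 - Re s1 - \<sigma>3"
  define W where "W = infsum (tail_weight s1 (Re s2 - e)) ({1..} \<times> UNIV)"
  have e: "e \<ge> 0" "Re s2 - e > 1" using \<sigma> by (auto simp: e_def)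
  have W: "W \<ge> 0" unfolding W_def by (rule infsum_nonneg) (auto simp: tail_weight_def)
  have "norm (zeta_AV2 s1 s2 (Complex \<sigma>3 t) - (\<Sum>k=1..N. AV2_coeff s1 s2 k * of_nat k powr (- Complex \<sigma>3 t)))
       \<le> (2 * 2 powr e * W) * real N powr (1 - Re s1 - \<sigma>3) / (Im s1 + t)"
    if t: "Im s1 + t \<ge> 2" and N: "real N \<ge> 6 * (Im s1 + t)" for t N
  proof -
    define w where "w = s1 + Complex \<sigma>3 t"
    have w: "Re w = 1 - e" "Im w = Im s1 + t" by (auto simp: w_def e_def)
    have N1: "N \<ge> 1" using N t by simp
    let ?f = "\<lambda>(n, l). bin_coeff s1 l * of_nat n powr (of_nat l - s2) * em_sum 0 (max N (2 * n)) (w + of_nat l)"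
    let ?M = "\<lambda>x. 2 / Im w * (2 * real N) powr e * tail_weight s1 (Re s2 - e) x"
    have bd: "norm (?f x) \<le> ?M x" if x_in: "x \<in> {1::nat..} \<times> (UNIV :: nat set)" for x
    proof -
      obtain n l where x: "x = (n, l)" "n \<ge> 1" using x_in by auto
      have "norm (em_sum 0 (max N (2 * n)) (w + of_nat l)) \<le> 2 * real (max N (2 * n)) powr (1 - Re w - real l) / Im w"
        by (rule em_sum_bound) (use w e \<sigma> t N in \<open>auto simp: e_def\<close>)
      then have "norm (em_sum 0 (max N (2 * n)) (w + of_nat l)) \<le> 2 / Im w * real (max N (2 * n)) powr (1 - Re w - real l)"
        by simp
      then show ?thesis
        unfolding x(1) prod.case by (intro norm_tail_term_le) (use x e w t N1 in auto)
    qed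
    have sM: "?M summable_on {1..} \<times> UNIV"
      by (intro summable_on_cmult_right tail_weight_summable e)
    have sf: "?f summable_on {1..} \<times> UNIV"
      by (rule abs_summable_summable[OF Infinite_Sum.abs_summable_on_comparison_test'[OF sM bd]])
    have "norm (AV2_tail s1 s2 N (Complex \<sigma>3 t)) \<le> infsum ?M ({1..} \<times> UNIV)"
      unfolding AV2_tail_def w_def[symmetric]
      by (rule norm_infsum_le[OF has_sum_infsum[OF sf] has_sum_infsum[OF sM] bd])
    also have "\<dots> = 2 / Im w * (2 * real N) powr e * W"
      unfolding W_def by (rule infsum_cmult_right')
    also have "\<dots> = (2 * 2 powr e * W) * real N powr (1 - Re s1 - \<sigma>3) / (Im s1 + t)"
      by (simp add: powr_mult w) (simp add: e_def)
    finally have "norm (AV2_tail s1 s2 N (Complex \<sigma>3 t)) \<le> (2 * 2 powr e * W) * real N powr (1 - Re s1 - \<sigma>3) / (Im s1 + t)" .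
    moreover have "zeta_AV2 s1 s2 (Complex \<sigma>3 t) = (\<Sum>k=1..N. AV2_coeff s1 s2 k * of_nat k powr (- Complex \<sigma>3 t)) + AV2_tail s1 s2 N (Complex \<sigma>3 t)"
      by (rule zeta_AV2_eq_sum_tail[OF s2 N1]) (use \<sigma> t in \<open>auto simp: complex_eq_iff\<close>)
    ultimately show ?thesis by simp
  qed
  moreover have "2 * 2 powr e * W \<ge> 0" using W by simp
  ultimately show ?thesis by blast
qed

subsection \<open>Mean squares\<close>

lemma exp_integral_bound:
  fixes a b c :: real
  assumes "a \<le> b"
  shows "(\<lambda>t. exp (\<i> * of_real (c * t))) integrable_on {a..b}"
    and "c \<noteq> 0 \<Longrightarrow> norm (integral {a..b} (\<lambda>t. exp (\<i> * of_real (c * t)))) \<le> 2 / \<bar>c\<bar>"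
proof -
  show "(\<lambda>t. exp (\<i> * of_real (c * t))) integrable_on {a..b}"
    by (intro integrable_continuous_real continuous_intros)
  assume c: "c \<noteq> 0"
  have "((\<lambda>t. exp (\<i> * of_real (c * t))) has_integral
     (exp (\<i> * of_real (c * b)) / (\<i> * c) - exp (\<i> * of_real (c * a)) / (\<i> * c))) {a..b}"
  proof (rule fundamental_theorem_of_calculus[OF assms])
    fix x assume "x \<in> {a..b}"
    have "((\<lambda>z. exp (\<i> * (of_real c * z)) / (\<i> * c)) has_field_derivative exp (\<i> * (of_real c * of_real x))) (at (of_real x))"
      using c by (auto intro!: derivative_eq_intros simp: mult_ac)
    from has_vector_derivative_real_field[OF this, of "{a..b}"]
    show "((\<lambda>t. exp (\<i> * of_real (c * t)) / (\<i> * c)) has_vector_derivative exp (\<i> * of_real (c * x))) (at x within {a..b})"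
      by simp
  qed
  then have "integral {a..b} (\<lambda>t. exp (\<i> * of_real (c * t))) =
    (exp (\<i> * of_real (c * b)) - exp (\<i> * of_real (c * a))) / (\<i> * c)"
    by (simp add: integral_unique diff_divide_distrib)
  also have "norm \<dots> = norm (exp (\<i> * of_real (c * b)) - exp (\<i> * of_real (c * a))) / \<bar>c\<bar>"
    by (simp add: norm_divide norm_mult)
  also have "\<dots> \<le> 2 / \<bar>c\<bar>"
  proof (rule divide_right_mono)
    have "norm (exp (\<i> * of_real (c * b))) = 1" "norm (exp (\<i> * of_real (c * a))) = 1"
      by (simp_all only: norm_exp_i_times)
    then show "norm (exp (\<i> * of_real (c * b)) - exp (\<i> * of_real (c * a))) \<le> 2"
      using norm_triangle_ineq4[of "exp (\<i> * of_real (c * b))" "exp (\<i> * of_real (c * a))"] by simp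
  qed auto
  finally show "norm (integral {a..b} (\<lambda>t. exp (\<i> * of_real (c * t)))) \<le> 2 / \<bar>c\<bar>" .
qed

lemma dirichlet_poly_mean_square:
  fixes A :: "nat \<Rightarrow> complex"
  assumes "a \<le> b"
  shows "\<bar>integral {a..b} (\<lambda>t. (norm (\<Sum>k=1..N. A k * exp (- \<i> * of_real (ln (real k) * t))))\<^sup>2)
      - (b - a) * (\<Sum>k=1..N. (norm (A k))\<^sup>2)\<bar>
    \<le> (\<Sum>j=1..N. \<Sum>k\<in>{1..N} - {j}. 2 * norm (A j) * norm (A k) / \<bar>ln (real k) - ln (real j)\<bar>)"
proof -
  define S where "S = (\<lambda>t. \<Sum>k=1..N. A k * exp (- \<i> * of_real (ln (real k) * t)))"
  define E where "E = (\<lambda>j k. integral {a..b} (\<lambda>t. exp (\<i> * of_real ((ln (real k) - ln (real j)) * t))))"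
  have sq: "complex_of_real ((norm (S t))\<^sup>2) =
     (\<Sum>j=1..N. \<Sum>k=1..N. A j * cnj (A k) * exp (\<i> * of_real ((ln (real k) - ln (real j)) * t)))" for t
  proof -
    have "complex_of_real ((norm (S t))\<^sup>2) = S t * cnj (S t)"
      by (metis complex_norm_square)
    also have "\<dots> = (\<Sum>j=1..N. \<Sum>k=1..N. (A j * exp (- \<i> * of_real (ln (real j) * t))) *
        (cnj (A k) * exp (\<i> * of_real (ln (real k) * t))))"
      by (simp add: S_def sum_product exp_cnj)
    also have "\<dots> = (\<Sum>j=1..N. \<Sum>k=1..N. A j * cnj (A k) * exp (\<i> * of_real ((ln (real k) - ln (real j)) * t)))"
    proof (intro sum.cong refl)
      fix j k
      have "exp (\<i> * of_real ((ln (real k) - ln (real j)) * t)) =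
         exp (- \<i> * of_real (ln (real j) * t)) * exp (\<i> * of_real (ln (real k) * t))"
        unfolding exp_add[symmetric] by (simp add: algebra_simps)
      then show "(A j * exp (- \<i> * of_real (ln (real j) * t))) * (cnj (A k) * exp (\<i> * of_real (ln (real k) * t)))
        = A j * cnj (A k) * exp (\<i> * of_real ((ln (real k) - ln (real j)) * t))"
        by (simp only: mult_ac)
    qed
    finally show ?thesis .
  qed
  have "((\<lambda>t. complex_of_real ((norm (S t))\<^sup>2)) has_integral (\<Sum>j=1..N. \<Sum>k=1..N. A j * cnj (A k) * E j k)) {a..b}"
    unfolding sq E_def
    by (intro has_integral_sum has_integral_mult_right integrable_integral exp_integral_bound(1) assms) auto
  moreover have "((\<lambda>t. (norm (S t))\<^sup>2) has_integral integral {a..b} (\<lambda>t. (norm (S t))\<^sup>2)) {a..b}"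
    unfolding S_def by (intro integrable_integral integrable_continuous_real continuous_intros)
  then have "((\<lambda>t. complex_of_real ((norm (S t))\<^sup>2)) has_integral of_real (integral {a..b} (\<lambda>t. (norm (S t))\<^sup>2))) {a..b}"
    using has_integral_linear[OF _ bounded_linear_of_real, of _ _ "{a..b}"] by (fastforce simp: o_def)
  ultimately have eq: "of_real (integral {a..b} (\<lambda>t. (norm (S t))\<^sup>2)) = (\<Sum>j=1..N. \<Sum>k=1..N. A j * cnj (A k) * E j k)"
    by (rule has_integral_unique[rotated])
  have "(\<Sum>k=1..N. A j * cnj (A k) * E j k) = of_real ((b - a) * (norm (A j))\<^sup>2) +
     (\<Sum>k\<in>{1..N} - {j}. A j * cnj (A k) * E j k)" if "j \<in> {1..N}" for j
  proof -
    have "E j j = of_real (b - a)" using assms by (simp add: E_def scaleR_conv_of_real)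
    then have "A j * cnj (A j) * E j j = of_real ((b - a) * (norm (A j))\<^sup>2)"
      by (simp add: complex_norm_square[symmetric] mult.commute flip: of_real_power)
    then show ?thesis using that by (subst sum.remove[of _ j]) auto
  qed
  then have "(\<Sum>j=1..N. \<Sum>k=1..N. A j * cnj (A k) * E j k) =
     of_real ((b - a) * (\<Sum>k=1..N. (norm (A k))\<^sup>2)) + (\<Sum>j=1..N. \<Sum>k\<in>{1..N} - {j}. A j * cnj (A k) * E j k)"
    by (simp add: sum.distrib sum_distrib_left)
  with eq have eq2: "of_real (integral {a..b} (\<lambda>t. (norm (S t))\<^sup>2) - (b - a) * (\<Sum>k=1..N. (norm (A k))\<^sup>2))
    = (\<Sum>j=1..N. \<Sum>k\<in>{1..N} - {j}. A j * cnj (A k) * E j k)"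
    by simp
  then have "\<bar>integral {a..b} (\<lambda>t. (norm (S t))\<^sup>2) - (b - a) * (\<Sum>k=1..N. (norm (A k))\<^sup>2)\<bar>
    = norm (\<Sum>j=1..N. \<Sum>k\<in>{1..N} - {j}. A j * cnj (A k) * E j k)"
    by (simp only: eq2[symmetric] norm_of_real)
  also have "\<dots> \<le> (\<Sum>j=1..N. \<Sum>k\<in>{1..N} - {j}. 2 * norm (A j) * norm (A k) / \<bar>ln (real k) - ln (real j)\<bar>)"
  proof (intro sum_norm_le)
    fix j k assume j: "j \<in> {1..N}" and k: "k \<in> {1..N} - {j}"
    then have "ln (real k) - ln (real j) \<noteq> 0" by (auto simp: ln_inj_iff)
    then have "norm (E j k) \<le> 2 / \<bar>ln (real k) - ln (real j)\<bar>"
      unfolding E_def by (intro exp_integral_bound assms)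
    then have "norm (A j) * norm (A k) * norm (E j k) \<le> norm (A j) * norm (A k) * (2 / \<bar>ln (real k) - ln (real j)\<bar>)"
      by (intro mult_left_mono) auto
    then show "norm (A j * cnj (A k) * E j k) \<le> 2 * norm (A j) * norm (A k) / \<bar>ln (real k) - ln (real j)\<bar>"
      by (simp add: norm_mult mult_ac)
  qed
  finally show ?thesis by (simp add: S_def)
qed

text \<open>For j < k, ln (k / j) \<ge> 1 - j / k, so the inverse is at most k / (k - j) = 1 + j /
  (k - j), and j \<le> sqrt (j * k). The square roots make the bound symmetric in j and k.\<close>

lemma inverse_ln_diff_le:
  assumes "1 \<le> j" "1 \<le> k" "j \<noteq> k"
  shows "1 / \<bar>ln (real k) - ln (real j)\<bar> \<le> 1 + sqrt (real j) * sqrt (real k) / \<bar>real k - real j\<bar>"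
  using assms
proof (induction j k rule: linorder_wlog)
  case (le j k)
  then have jk: "0 < real j" "real j < real k" by auto
  have "ln (real j / real k) \<le> real j / real k - 1"
    using jk by (intro ln_le_minus_one) auto
  then have l: "ln (real k) - ln (real j) \<ge> (real k - real j) / real k"
    using jk by (simp add: ln_div field_simps)
  have pos: "(real k - real j) / real k > 0" using jk by simp
  have "1 / \<bar>ln (real k) - ln (real j)\<bar> \<le> 1 / ((real k - real j) / real k)"
    using l pos by (intro frac_le) auto
  also have "\<dots> = 1 + sqrt (real j) * sqrt (real j) / (real k - real j)"
    using jk by (simp add: field_simps)
  also have "\<dots> \<le> 1 + sqrt (real j) * sqrt (real k) / (real k - real j)"
    using jk by (intro add_left_mono divide_right_mono mult_left_mono) auto
  finally show ?case using jk by simp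
next
  case (sym j k)
  then show ?case by (simp add: abs_minus_commute mult.commute)
qed

lemma harmonic_le:
  assumes "N \<ge> 1"
  shows "(\<Sum>r=1..N. 1 / real r) \<le> 1 + ln (real N)"
  using assms
proof (induction N rule: dec_induct)
  case (step n)
  have "ln (real n / real (Suc n)) \<le> real n / real (Suc n) - 1"
    using step by (intro ln_le_minus_one) auto
  also have "real n / real (Suc n) - 1 = - (1 / real (Suc n))"
    by (simp add: field_simps)
  also have "ln (real n / real (Suc n)) = ln (real n) - ln (real (Suc n))"
    using step by (subst ln_div) auto
  finally show ?case using step by simp
qed simp

lemma sum_inverse_dist_le:
  assumes "j \<in> {1..N}"
  shows "(\<Sum>k\<in>{1..N} - {j}. 1 / \<bar>real k - real j\<bar>) \<le> 2 * (1 + ln (real N))"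
proof -
  have N: "N \<ge> 1" using assms by auto
  have h: "(\<Sum>r=1..N. 1 / real r) \<le> 1 + ln (real N)"
    by (rule harmonic_le[OF N])
  have eq: "{1..N} - {j} = {1..<j} \<union> {j<..N}" using assms by auto
  have "(\<Sum>k\<in>{1..N} - {j}. 1 / \<bar>real k - real j\<bar>) =
     (\<Sum>k\<in>{1..<j}. 1 / \<bar>real k - real j\<bar>) + (\<Sum>k\<in>{j<..N}. 1 / \<bar>real k - real j\<bar>)"
    unfolding eq by (rule sum.union_disjoint) auto
  also have "(\<Sum>k\<in>{1..<j}. 1 / \<bar>real k - real j\<bar>) = (\<Sum>r\<in>{1..<j}. 1 / real r)"
    by (rule sum.reindex_bij_witness[where i = "\<lambda>r. j - r" and j = "\<lambda>k. j - k"]) auto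
  also have "(\<Sum>k\<in>{j<..N}. 1 / \<bar>real k - real j\<bar>) = (\<Sum>r\<in>{1..N - j}. 1 / real r)"
    by (rule sum.reindex_bij_witness[where i = "\<lambda>r. j + r" and j = "\<lambda>k. k - j"]) auto
  also have "(\<Sum>r\<in>{1..<j}. 1 / real r) + (\<Sum>r\<in>{1..N - j}. 1 / real r) \<le> (\<Sum>r=1..N. 1 / real r) + (\<Sum>r=1..N. 1 / real r)"
    using assms by (intro add_mono sum_mono2) auto
  finally show ?thesis using h by simp
qed

text \<open>The constant 1 gives the square of the sum of \<open>x\<close>. In the other part the
  square roots join the coefficients, and splitting the resulting product into
  \<open>y j + y k\<close> leaves a sum of inverse distances, which costs only a logarithm.\<close>

lemma off_diagonal_bound:
  fixes A :: "nat \<Rightarrow> complex" and s C :: real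
  assumes s: "1/2 < s" "s < 1" and C: "C \<ge> 0" and N: "N \<ge> 1"
    and A: "\<And>k. k \<ge> 1 \<Longrightarrow> norm (A k) \<le> C * real k powr (- s)"
  shows "(\<Sum>j=1..N. \<Sum>k\<in>{1..N} - {j}. 2 * norm (A j) * norm (A k) / \<bar>ln (real k) - ln (real j)\<bar>)
     \<le> 2 * C\<^sup>2 * (1 / (1 - s)\<^sup>2 + 1 / (1 - s)) * (real N powr (2 - 2 * s) * (1 + ln (real N)))"
proof -
  define x where "x = (\<lambda>k::nat. real k powr (- s))"
  define y where "y = (\<lambda>k::nat. real k powr (- (2 * s - 1)))"
  have lnN: "ln (real N) \<ge> 0" using N by simp
  have tm: "2 * norm (A j) * norm (A k) / \<bar>ln (real k) - ln (real j)\<bar> \<le>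
     2 * C\<^sup>2 * (x j * x k) + C\<^sup>2 * (y j / \<bar>real k - real j\<bar> + y k / \<bar>real k - real j\<bar>)"
    if "j \<in> {1..N}" "k \<in> {1..N} - {j}" for j k
  proof -
    have jk: "1 \<le> j" "1 \<le> k" "j \<noteq> k" using that by auto
    have d: "\<bar>real k - real j\<bar> > 0" using jk by auto
    have xy: "sqrt (real i) * x i = sqrt (y i)" "x i \<ge> 0" "y i \<ge> 0" if "1 \<le> i" for i
    proof -
      have "sqrt (y i) = y i powr (1/2)" using that by (simp add: powr_half_sqrt y_def)
      also have "\<dots> = real i powr (1/2 - s)" by (simp add: y_def powr_powr field_simps)
      also have "\<dots> = real i powr (1/2) * x i" by (simp add: x_def flip: powr_add)
      also have "\<dots> = sqrt (real i) * x i" by (simp add: powr_half_sqrt)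
      finally show "sqrt (real i) * x i = sqrt (y i)" ..
    qed (auto simp: x_def y_def)
    have "norm (A j) * norm (A k) \<le> (C * x j) * (C * x k)"
      using A[of j] A[of k] jk C by (intro mult_mono) (auto simp: x_def)
    then have "2 * norm (A j) * norm (A k) / \<bar>ln (real k) - ln (real j)\<bar> \<le>
       (2 * ((C * x j) * (C * x k))) * (1 / \<bar>ln (real k) - ln (real j)\<bar>)"
      by (simp add: divide_right_mono mult.assoc)
    also have "\<dots> \<le> (2 * ((C * x j) * (C * x k))) * (1 + sqrt (real j) * sqrt (real k) / \<bar>real k - real j\<bar>)"
      using C jk xy by (intro mult_left_mono inverse_ln_diff_le) auto
    also have "\<dots> = 2 * C\<^sup>2 * (x j * x k) + C\<^sup>2 * (2 * ((sqrt (real j) * x j) * (sqrt (real k) * x k)) / \<bar>real k - real j\<bar>)"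
      by (simp add: power2_eq_square algebra_simps)
    \<comment> \<open>The arithmetic-geometric mean inequality for \<open>sqrt (y j)\<close> and
      \<open>sqrt (y k)\<close>.\<close>
    also have "2 * ((sqrt (real j) * x j) * (sqrt (real k) * x k)) / \<bar>real k - real j\<bar> \<le> (y j + y k) / \<bar>real k - real j\<bar>"
    proof (rule divide_right_mono)
      have "0 \<le> (sqrt (y j) - sqrt (y k))\<^sup>2" by simp
      then show "2 * ((sqrt (real j) * x j) * (sqrt (real k) * x k)) \<le> y j + y k"
        using xy[of j] xy[of k] jk by (simp add: power2_diff)
    qed auto
    finally show ?thesis
      by (simp add: add_divide_distrib mult_left_mono)
  qed
  have sx: "(\<Sum>k=1..N. x k) \<le> real N powr (1 - s) / (1 - s)"
    unfolding x_def by (rule sum_powr_le) (use s in auto)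
  have sy: "(\<Sum>k=1..N. y k) \<le> real N powr (2 - 2 * s) / (2 - 2 * s)"
    using sum_powr_le[of "2 * s - 1" N] s unfolding y_def by simp
  have Y: "(\<Sum>j=1..N. \<Sum>k\<in>{1..N} - {j}. y j / \<bar>real k - real j\<bar>) \<le> real N powr (2 - 2 * s) / (1 - s) * (1 + ln (real N))"
  proof -
    have "(\<Sum>j=1..N. \<Sum>k\<in>{1..N} - {j}. y j / \<bar>real k - real j\<bar>) = (\<Sum>j=1..N. y j * (\<Sum>k\<in>{1..N} - {j}. 1 / \<bar>real k - real j\<bar>))"
      by (simp add: sum_distrib_left)
    also have "\<dots> \<le> (\<Sum>j=1..N. y j * (2 * (1 + ln (real N))))"
      by (intro sum_mono mult_left_mono sum_inverse_dist_le) (auto simp: y_def)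
    also have "\<dots> = (\<Sum>j=1..N. y j) * (2 * (1 + ln (real N)))"
      by (simp add: sum_distrib_right)
    also have "\<dots> \<le> real N powr (2 - 2 * s) / (2 - 2 * s) * (2 * (1 + ln (real N)))"
      using lnN by (intro mult_right_mono sy) auto
    also have "\<dots> = real N powr (2 - 2 * s) / (1 - s) * (1 + ln (real N))"
      using s by (simp add: field_simps)
    finally show ?thesis .
  qed
  have Y': "(\<Sum>j=1..N. \<Sum>k\<in>{1..N} - {j}. y k / \<bar>real k - real j\<bar>) = (\<Sum>j=1..N. \<Sum>k\<in>{1..N} - {j}. y j / \<bar>real k - real j\<bar>)"
  proof -
    have "(\<Sum>j=1..N. \<Sum>k\<in>{1..N} - {j}. y k / \<bar>real k - real j\<bar>) = (\<Sum>j=1..N. \<Sum>k=1..N. y k / \<bar>real k - real j\<bar>)"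
      by (intro sum.cong refl sum.mono_neutral_left) auto
    also have "\<dots> = (\<Sum>k=1..N. \<Sum>j=1..N. y k / \<bar>real k - real j\<bar>)" by (rule sum.swap)
    also have "\<dots> = (\<Sum>k=1..N. \<Sum>j\<in>{1..N} - {k}. y k / \<bar>real j - real k\<bar>)"
      by (intro sum.cong[OF refl] trans[OF sum.cong[OF refl] sum.mono_neutral_right]) (auto simp: abs_minus_commute)
    finally show ?thesis .
  qed
  have X: "(\<Sum>j=1..N. \<Sum>k\<in>{1..N} - {j}. x j * x k) \<le> real N powr (2 - 2 * s) / (1 - s)\<^sup>2"
  proof -
    have "(\<Sum>j=1..N. \<Sum>k\<in>{1..N} - {j}. x j * x k) \<le> (\<Sum>j=1..N. \<Sum>k=1..N. x j * x k)"
      by (intro sum_mono sum_mono2) (auto simp: x_def)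
    also have "\<dots> = (\<Sum>j=1..N. x j) * (\<Sum>k=1..N. x k)" by (simp add: sum_product)
    also have "\<dots> \<le> (real N powr (1 - s) / (1 - s)) * (real N powr (1 - s) / (1 - s))"
      using s by (intro mult_mono sx) (auto intro!: sum_nonneg simp: x_def)
    also have "\<dots> = real N powr (2 - 2 * s) / (1 - s)\<^sup>2"
      by (simp add: power2_eq_square flip: powr_add)
    finally show ?thesis .
  qed
  have "(\<Sum>j=1..N. \<Sum>k\<in>{1..N} - {j}. 2 * norm (A j) * norm (A k) / \<bar>ln (real k) - ln (real j)\<bar>) \<le>
     (\<Sum>j=1..N. \<Sum>k\<in>{1..N} - {j}. 2 * C\<^sup>2 * (x j * x k) + C\<^sup>2 * (y j / \<bar>real k - real j\<bar> + y k / \<bar>real k - real j\<bar>))"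
    by (intro sum_mono tm)
  also have "\<dots> = 2 * C\<^sup>2 * (\<Sum>j=1..N. \<Sum>k\<in>{1..N} - {j}. x j * x k) +
     C\<^sup>2 * ((\<Sum>j=1..N. \<Sum>k\<in>{1..N} - {j}. y j / \<bar>real k - real j\<bar>) + (\<Sum>j=1..N. \<Sum>k\<in>{1..N} - {j}. y k / \<bar>real k - real j\<bar>))"
    by (simp only: sum.distrib sum_distrib_left[symmetric])
  also have "\<dots> \<le> 2 * C\<^sup>2 * (real N powr (2 - 2 * s) / (1 - s)\<^sup>2) +
     C\<^sup>2 * (real N powr (2 - 2 * s) / (1 - s) * (1 + ln (real N)) + real N powr (2 - 2 * s) / (1 - s) * (1 + ln (real N)))"
    unfolding Y' by (intro add_mono mult_left_mono X Y) auto
  also have "\<dots> \<le> 2 * C\<^sup>2 * (real N powr (2 - 2 * s) / (1 - s)\<^sup>2 * (1 + ln (real N))) +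
     C\<^sup>2 * (real N powr (2 - 2 * s) / (1 - s) * (1 + ln (real N)) + real N powr (2 - 2 * s) / (1 - s) * (1 + ln (real N)))"
  proof -
    have le: "P \<le> P * (1 + ln (real N))" if "P \<ge> 0" for P using that lnN by (simp add: mult_le_cancel_left1)
    show ?thesis by (intro add_right_mono mult_left_mono le) auto
  qed
  also have "\<dots> = 2 * C\<^sup>2 * (1 / (1 - s)\<^sup>2 + 1 / (1 - s)) * (real N powr (2 - 2 * s) * (1 + ln (real N)))"
    by (simp add: algebra_simps add_divide_distrib)
  finally show ?thesis .
qed

text \<open>Since m > k / 2 and Re s1 \<ge> 0, the first factor is at most a constant times
  \<open>k powr (- Re s1)\<close>; the sum over n = k - m is bounded by the convergent series with
  exponent \<open>Re s2\<close>.\<close>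

lemma AV2_coeff_bound:
  assumes "Re s1 \<ge> 0" "Re s2 > 1"
  shows "\<exists>C\<ge>0. \<forall>k\<ge>1. norm (AV2_coeff s1 s2 k) \<le> C * real k powr (- Re s1)"
proof -
  define Z where "Z = (\<Sum>\<^sub>\<infinity>n. real n powr (- Re s2))"
  have Z: "Z \<ge> 0" unfolding Z_def by (rule infsum_nonneg) auto
  have "norm (AV2_coeff s1 s2 k) \<le> 2 powr Re s1 * Z * real k powr (- Re s1)" if k: "k \<ge> 1" for k
  proof -
    let ?M = "{m. k < 2 * m \<and> m \<le> k - 1}"
    have fin: "finite ?M" by (rule finite_subset[of _ "{..k}"]) auto
    have "norm (AV2_coeff s1 s2 k) \<le> (\<Sum>m\<in>?M. real m powr (- Re s1) * real (k - m) powr (- Re s2))"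
      unfolding AV2_coeff_def by (rule sum_norm_le) (simp add: norm_mult norm_nat_powr)
    also have "\<dots> \<le> (\<Sum>m\<in>?M. (real k / 2) powr (- Re s1) * real (k - m) powr (- Re s2))"
      using assms k by (intro sum_mono mult_right_mono powr_mono2') auto
    also have "\<dots> = (real k / 2) powr (- Re s1) * (\<Sum>m\<in>?M. real (k - m) powr (- Re s2))"
      by (simp add: sum_distrib_left)
    also have "(\<Sum>m\<in>?M. real (k - m) powr (- Re s2)) = (\<Sum>n\<in>(\<lambda>m. k - m) ` ?M. real n powr (- Re s2))"
      by (subst sum.reindex) (auto simp: inj_on_def)
    also have "\<dots> \<le> Z"
      unfolding Z_def using fin by (intro finite_sum_le_infsum powr_summable assms) auto
    finally have "norm (AV2_coeff s1 s2 k) \<le> (real k / 2) powr (- Re s1) * Z"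
      by (simp add: mult_left_mono)
    also have "(real k / 2) powr (- Re s1) = 2 powr Re s1 * real k powr (- Re s1)"
      by (simp add: powr_divide powr_minus field_simps)
    finally show ?thesis by (simp add: mult_ac)
  qed
  then show ?thesis using Z by (intro exI[of _ "2 powr Re s1 * Z"]) auto
qed

text \<open>Halving T repeatedly ends in \<open>[2, 4]\<close>. As b > 0, the increments grow
  geometrically and the last one dominates, so no second logarithm arises.\<close>

lemma dyadic_growth:
  fixes g :: "real \<Rightarrow> real"
  assumes b: "b > 0" and C: "C \<ge> 0"
    and step: "\<And>T. T \<ge> 2 \<Longrightarrow> \<bar>g (2 * T) - g T\<bar> \<le> C * (T powr b * ln T)"
    and init: "\<And>T. T \<in> {2..4} \<Longrightarrow> \<bar>g T\<bar> \<le> M0"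
  shows "\<exists>M. \<forall>T\<ge>2. \<bar>g T\<bar> \<le> M * (T powr b * ln T)"
proof -
  define q where "q = 2 powr b - 1"
  have q: "q > 0" using b by (simp add: q_def gr_one_powr)
  \<comment> \<open>The first entry covers the initial range; the second gives M + C \<le>
    \<open>M * 2 powr b\<close>, exactly what one doubling needs.\<close>
  define M where "M = max (M0 / (2 powr b * ln 2)) (C / q)"
  have M: "M \<ge> 0" "M * q \<ge> C" "M * (2 powr b * ln 2) \<ge> M0"
  proof -
    have "C / q \<ge> 0" using C q by simp
    then show "M \<ge> 0" by (simp add: M_def)
    have "C / q \<le> M" by (simp add: M_def)
    then show "M * q \<ge> C" using q by (simp add: pos_divide_le_eq)
    have "M0 / (2 powr b * ln 2) \<le> M" by (simp add: M_def)
    then show "M * (2 powr b * ln 2) \<ge> M0" by (simp add: pos_divide_le_eq)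
  qed
  have "\<forall>T. 2 \<le> T \<and> T \<le> 4 * 2 ^ n \<longrightarrow> \<bar>g T\<bar> \<le> M * (T powr b * ln T)" for n :: nat
  proof (induction n)
    case 0
    show ?case
    proof (intro allI impI)
      fix T :: real assume T: "2 \<le> T \<and> T \<le> 4 * 2 ^ 0"
      then have "\<bar>g T\<bar> \<le> M * (2 powr b * ln 2)" using init[of T] M by auto
      also have "\<dots> \<le> M * (T powr b * ln T)"
        using T b M by (intro mult_left_mono mult_mono powr_mono2) auto
      finally show "\<bar>g T\<bar> \<le> M * (T powr b * ln T)" .
    qed
  next
    case (Suc n)
    show ?case
    proof (intro allI impI)
      fix T :: real assume T: "2 \<le> T \<and> T \<le> 4 * 2 ^ Suc n"
      show "\<bar>g T\<bar> \<le> M * (T powr b * ln T)"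
      proof (cases "T \<le> 4")
        case True
        then have "\<bar>g T\<bar> \<le> M * (2 powr b * ln 2)" using init[of T] T M by auto
        also have "\<dots> \<le> M * (T powr b * ln T)"
          using T b M by (intro mult_left_mono mult_mono powr_mono2) auto
        finally show ?thesis .
      next
        case False
        define U where "U = T / 2"
        have U: "U \<ge> 2" "U \<le> 4 * 2 ^ n" "T = 2 * U" using False T by (auto simp: U_def)
        have "\<bar>g T\<bar> \<le> \<bar>g U\<bar> + \<bar>g (2 * U) - g U\<bar>" by (simp add: U(3))
        also have "\<dots> \<le> M * (U powr b * ln U) + C * (U powr b * ln U)"
          using Suc U step[of U] by (intro add_mono) auto
        also have "\<dots> = (M + C) * (U powr b * ln U)" by (simp add: algebra_simps)
        also have "\<dots> \<le> (M * 2 powr b) * (U powr b * ln U)"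
          using M U by (intro mult_right_mono) (auto simp: q_def algebra_simps)
        also have "\<dots> = M * (T powr b * ln U)" using U by (simp add: powr_mult)
        also have "\<dots> \<le> M * (T powr b * ln T)" using M U by (intro mult_left_mono) auto
        finally show ?thesis .
      qed
    qed
  qed
  moreover have "\<exists>n::nat. T \<le> 4 * 2 ^ n" for T :: real
  proof -
    obtain n where "T < 2 ^ n" using real_arch_pow[of 2 T] by auto
    then have "T \<le> 4 * 2 ^ n" by (smt (verit) zero_le_power)
    then show ?thesis by blast
  qed
  ultimately show ?thesis by blast
qed

section \<open>The double zeta-function on a vertical line\<close>

definition AV2_vcoeff :: "complex \<Rightarrow> complex \<Rightarrow> real \<Rightarrow> nat \<Rightarrow> complex" where
  "AV2_vcoeff s1 s2 \<sigma>3 k = AV2_coeff s1 s2 k * of_nat k powr (- of_real \<sigma>3)"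

text \<open>With the real part \<sigma>3 absorbed into the coefficient, t enters only through a
  phase.\<close>

lemma AV2_vcoeff_exp:
  assumes "k \<ge> 1"
  shows "AV2_coeff s1 s2 k * of_nat k powr (- Complex \<sigma>3 t) = AV2_vcoeff s1 s2 \<sigma>3 k * exp (- \<i> * of_real (ln (real k) * t))"
proof -
  have "- Complex \<sigma>3 t = - of_real \<sigma>3 + - \<i> * of_real t"
    by (simp add: complex_eq_iff)
  then have "of_nat k powr (- Complex \<sigma>3 t) = of_nat k powr (- of_real \<sigma>3) * (of_nat k powr (- \<i> * of_real t) :: complex)"
    by (simp only: powr_add)
  moreover have "of_nat k powr (- \<i> * of_real t) = exp (- \<i> * of_real (ln (real k) * t))"
    using assms by (simp add: powr_def Ln_of_nat mult_ac)
  ultimately show ?thesis by (simp add: AV2_vcoeff_def)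
qed

lemma norm_AV2_vcoeff: "norm (AV2_vcoeff s1 s2 \<sigma>3 k) = norm (AV2_coeff s1 s2 k) * real k powr (- \<sigma>3)"
  by (simp add: AV2_vcoeff_def norm_mult norm_nat_powr)

lemma zeta_AV2_sq_eq: "zeta_AV2_sq s1 s2 (2 * \<sigma>3) = (\<Sum>\<^sub>\<infinity>k\<in>{2..}. (norm (AV2_vcoeff s1 s2 \<sigma>3 k))\<^sup>2)"
proof -
  have "(real k powr (- \<sigma>3))\<^sup>2 = real k powr (- (2 * \<sigma>3))" for k
    by (simp add: power2_eq_square flip: powr_add)
  then show ?thesis
    unfolding zeta_AV2_sq_def norm_AV2_vcoeff power_mult_distrib AV2_coeff_def by simp
qed

lemma AV2_vcoeff_bound:
  assumes "Re s1 \<ge> 0" "Re s2 > 1" "s \<le> Re s1 + \<sigma>3"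
  shows "\<exists>C\<ge>0. \<forall>k\<ge>1. norm (AV2_vcoeff s1 s2 \<sigma>3 k) \<le> C * real k powr (- s)"
proof -
  obtain C where C: "C \<ge> 0" "\<And>k. k \<ge> 1 \<Longrightarrow> norm (AV2_coeff s1 s2 k) \<le> C * real k powr (- Re s1)"
    using AV2_coeff_bound[OF assms(1,2)] by blast
  have "norm (AV2_vcoeff s1 s2 \<sigma>3 k) \<le> C * real k powr (- s)" if k: "k \<ge> 1" for k
  proof -
    have "norm (AV2_vcoeff s1 s2 \<sigma>3 k) \<le> C * real k powr (- Re s1) * real k powr (- \<sigma>3)"
      unfolding norm_AV2_vcoeff using C k by (intro mult_right_mono) auto
    also have "\<dots> = C * real k powr (- (Re s1 + \<sigma>3))" by (simp flip: powr_add)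
    also have "\<dots> \<le> C * real k powr (- s)"
      using C k assms by (intro mult_left_mono powr_mono) auto
    finally show ?thesis .
  qed
  then show ?thesis using C by blast
qed

lemma zeta_AV2_sq_split:
  assumes s: "s > 1/2" and C: "C \<ge> 0" and N: "N \<ge> 1"
    and A: "\<And>k. k \<ge> 1 \<Longrightarrow> norm (AV2_vcoeff s1 s2 \<sigma>3 k) \<le> C * real k powr (- s)"
  defines "D \<equiv> (\<Sum>k=1..N. (norm (AV2_vcoeff s1 s2 \<sigma>3 k))\<^sup>2)"
  shows "D \<le> zeta_AV2_sq s1 s2 (2 * \<sigma>3)"
    and "zeta_AV2_sq s1 s2 (2 * \<sigma>3) - D \<le> C\<^sup>2 / (2 * s - 1) * real N powr (1 - 2 * s)"
proof -
  let ?A = "\<lambda>k. (norm (AV2_vcoeff s1 s2 \<sigma>3 k))\<^sup>2"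
  \<comment> \<open>The coefficient at k = 1 is an empty sum, which reconciles sums from 1 with the
    series starting at 2.\<close>
  have A1: "?A 1 = 0"
  proof -
    have "{m. 1 < 2 * m \<and> m \<le> 1 - (1::nat)} = {}" by auto
    then show ?thesis by (simp add: norm_AV2_vcoeff AV2_coeff_def)
  qed
  have bd: "?A k \<le> C\<^sup>2 * real k powr (- (2 * s))" if "k \<ge> 1" for k
  proof -
    have "?A k \<le> (C * real k powr (- s))\<^sup>2"
      using A[OF that] by (intro power_mono) auto
    also have "\<dots> = C\<^sup>2 * real k powr (- (2 * s))"
      by (simp add: power2_eq_square flip: powr_add)
    finally show ?thesis .
  qed
  have sm: "?A summable_on {1..}"
  proof (rule summable_on_comparison_test)
    show "(\<lambda>k. C\<^sup>2 * real k powr (- (2 * s))) summable_on {1..}"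
      by (intro summable_on_cmult_right powr_summable) (use s in auto)
  qed (use bd in auto)
  have tail: "?A summable_on {N<..}" by (rule summable_on_subset[OF sm]) (use N in auto)
  have "zeta_AV2_sq s1 s2 (2 * \<sigma>3) = infsum ?A {1..}"
    unfolding zeta_AV2_sq_eq
  proof (rule infsum_cong_neutral)
    fix k :: nat assume "k \<in> {1..} - {2..}"
    then have "k = (1::nat)" by auto
    then show "?A k = 0" using A1 by simp
  qed auto
  also have "{1..} = {1..N} \<union> {N<..}" using N by auto
  also have "infsum ?A ({1..N} \<union> {N<..}) = infsum ?A {1..N} + infsum ?A {N<..}"
    by (rule infsum_Un_disjoint) (use tail in auto)
  finally have eq: "zeta_AV2_sq s1 s2 (2 * \<sigma>3) = D + infsum ?A {N<..}"
    by (simp add: D_def)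
  have "infsum ?A {N<..} \<ge> 0" by (rule infsum_nonneg) auto
  then show "D \<le> zeta_AV2_sq s1 s2 (2 * \<sigma>3)" using eq by simp
  have "infsum ?A {N<..} \<le> (\<Sum>\<^sub>\<infinity>k\<in>{N<..}. C\<^sup>2 * real k powr (- (2 * s)))"
    by (intro infsum_mono tail summable_on_cmult_right powr_summable bd) (use s N in auto)
  also have "\<dots> = C\<^sup>2 * (\<Sum>\<^sub>\<infinity>k\<in>{N<..}. real k powr (- (2 * s)))"
    by (rule infsum_cmult_right')
  also have "\<dots> \<le> C\<^sup>2 * (real N powr (1 - 2 * s) / (2 * s - 1))"
    by (intro mult_left_mono powr_tail_summable(2)) (use s N in auto)
  finally show "zeta_AV2_sq s1 s2 (2 * \<sigma>3) - D \<le> C\<^sup>2 / (2 * s - 1) * real N powr (1 - 2 * s)"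
    using eq by simp
qed

text \<open>Im s1 \<ge> 0 and t \<ge> 2 keep s1 + z off the real axis, away from the first family of
  singularities; the bound on the real parts excludes the second.\<close>

lemma zeta_AV2_continuous_on:
  assumes "Re s2 > 1" "Re s1 + \<sigma>3 > 0" "Re s1 + Re s2 + \<sigma>3 > 2" "Im s1 \<ge> 0"
  shows "continuous_on {2..} (\<lambda>t. zeta_AV2 s1 s2 (Complex \<sigma>3 t))"
proof (rule continuous_on_compose2[OF holomorphic_on_imp_continuous_on[OF zeta_AV2_spec(1)[OF assms(1)]]])
  show "continuous_on {2..} (Complex \<sigma>3)"
    unfolding Complex_eq by (intro continuous_intros)
  show "Complex \<sigma>3 ` {2..} \<subseteq> UNIV - AV2_sing s1 s2"
  proof
    fix z assume "z \<in> Complex \<sigma>3 ` {2..}"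
    then obtain t where t: "t \<ge> 2" "z = Complex \<sigma>3 t" by auto
    then have "Im (s1 + z) \<noteq> 0" "Re (s1 + s2 + z) > 2" using assms by auto
    then have "z \<notin> AV2_sing s1 s2"
      by (auto simp: AV2_sing_def complex_eq_iff)
    then show "z \<in> UNIV - AV2_sing s1 s2" by simp
  qed
qed

text \<open>From 2 * |g| \<le> |g|^2 + 1. After integration only the mean square of g occurs, and no
  Cauchy-Schwarz inequality for integrals is called for.\<close>

lemma square_diff_le:
  fixes f g :: complex
  assumes "norm (f - g) \<le> \<rho>"
  shows "\<bar>(norm f)\<^sup>2 - (norm g)\<^sup>2\<bar> \<le> \<rho> * ((norm g)\<^sup>2 + 1) + \<rho>\<^sup>2"
proof -
  have \<rho>: "\<rho> \<ge> 0" using assms norm_ge_zero order_trans by blast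
  have 1: "\<bar>norm f - norm g\<bar> \<le> \<rho>" using assms norm_triangle_ineq3[of f g] by linarith
  have "\<bar>(norm f)\<^sup>2 - (norm g)\<^sup>2\<bar> = \<bar>norm f - norm g\<bar> * (norm f + norm g)"
    by (simp add: power2_eq_square square_diff_square_factored abs_mult mult.commute)
  also have "\<dots> \<le> \<rho> * (2 * norm g + \<rho>)"
    using 1 \<rho> by (intro mult_mono) auto
  also have "\<dots> \<le> \<rho> * (((norm g)\<^sup>2 + 1) + \<rho>)"
    using \<rho> sum_squares_ge_zero[of "norm g - 1" 0] by (intro mult_left_mono) (auto simp: power2_eq_square algebra_simps)
  finally show ?thesis by (simp add: power2_eq_square algebra_simps)
qed

text \<open>The off-diagonal terms have the full size of the bound. The diagonal beyond N costs
  \<open>T * N powr (1 - 2 * s)\<close>, and the pointwise error of order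
  \<open>T powr (- s)\<close> costs about \<open>T powr (1 - s)\<close>; both fit.\<close>

lemma dyadic_mean_square:
  fixes s1 s2 :: complex and \<sigma>3 s :: real
  assumes s1: "Re s1 \<ge> 0" and s2: "Re s2 > 1" and \<sigma>: "Re s1 + \<sigma>3 \<le> 1" "Re s1 + Re s2 + \<sigma>3 > 2"
    and im: "Im s1 \<ge> 0" and s: "1/2 < s" "s < 1" "s \<le> Re s1 + \<sigma>3"
  shows "\<exists>C\<ge>0. \<forall>T\<ge>2. \<bar>integral {T..2 * T} (\<lambda>t. (norm (zeta_AV2 s1 s2 (Complex \<sigma>3 t)))\<^sup>2)
     - zeta_AV2_sq s1 s2 (2 * \<sigma>3) * T\<bar> \<le> C * (T powr (2 - 2 * s) * ln T)"
proof -
  define \<sigma> where "\<sigma> = Re s1 + \<sigma>3"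
  define F where "F = (\<lambda>t. zeta_AV2 s1 s2 (Complex \<sigma>3 t))"
  define c where "c = zeta_AV2_sq s1 s2 (2 * \<sigma>3)"
  define A where "A = AV2_vcoeff s1 s2 \<sigma>3"
  have c: "c \<ge> 0" unfolding c_def zeta_AV2_sq_eq by (rule infsum_nonneg) auto
  obtain C1 where C1: "C1 \<ge> 0" "\<And>k. k \<ge> 1 \<Longrightarrow> norm (A k) \<le> C1 * real k powr (- s)"
    using AV2_vcoeff_bound[OF s1 s2 s(3)] unfolding A_def by blast
  obtain C3 where C3: "C3 \<ge> 0" "\<And>t N. Im s1 + t \<ge> 2 \<Longrightarrow> real N \<ge> 6 * (Im s1 + t) \<Longrightarrow>
     norm (F t - (\<Sum>k=1..N. AV2_coeff s1 s2 k * of_nat k powr (- Complex \<sigma>3 t)))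
       \<le> C3 * real N powr (1 - Re s1 - \<sigma>3) / (Im s1 + t)"
    using zeta_AV2_approx[OF s2, of s1 \<sigma>3] \<sigma> s unfolding F_def by auto
  \<comment> \<open>Chosen so that the cutoff, at most 6 * (Im s1 + 2 * T) + 1, stays below C2 *
    T.\<close>
  define C2 where "C2 = 6 * Im s1 + 13"
  define C4 where "C4 = C3 * C2 powr (1 - \<sigma>)"
  define C5 where "C5 = 2 * C1\<^sup>2 * (1 / (1 - s)\<^sup>2 + 1 / (1 - s))"
  define C6 where "C6 = C5 * (C2 powr (2 - 2 * s) * (2 * (1 + ln C2) + 1))"
  define C7 where "C7 = 2 * (C1\<^sup>2 / (2 * s - 1))"
  define C where "C = 2 * C4 * (c + 1) + C4 * C6 + 2 * C4\<^sup>2 + C6 + C7"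
  have C2: "C2 \<ge> 13" using im by (simp add: C2_def)
  then have lnC2: "ln C2 \<ge> 0" by simp
  have C4: "C4 \<ge> 0" using C3 by (simp add: C4_def)
  have C5: "C5 \<ge> 0" using s by (simp add: C5_def)
  have C6: "C6 \<ge> 0" using C5 lnC2 by (simp add: C6_def)
  have C7: "C7 \<ge> 0" using s by (simp add: C7_def)
  have main: "\<bar>integral {T..2 * T} (\<lambda>t. (norm (F t))\<^sup>2) - c * T\<bar> \<le> C * (T powr (2 - 2 * s) * ln T)" if T: "T \<ge> 2" for T
  proof -
    define X where "X = T powr (2 - 2 * s) * ln T"
    have "ln T \<ge> ln 2" using T by simp
    \<comment> \<open>Lets errors without a logarithm be counted as multiples of \<open>X\<close>;
      the factors 2 in the constants come from here.\<close>
    then have lnT: "2 * ln T \<ge> 1" using ln2_ge_two_thirds by simp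
    have TX: "T powr (2 - 2 * s) \<le> 2 * X"
      using mult_left_mono[OF lnT, of "T powr (2 - 2 * s)"] by (simp add: X_def)
    have X: "X \<ge> 0" using T by (simp add: X_def)
    \<comment> \<open>One cutoff for the whole interval, dictated by its upper end t = 2 *
      T.\<close>
    define N where "N = nat \<lceil>6 * (Im s1 + 2 * T)\<rceil>"
    have N: "real N \<ge> 6 * (Im s1 + 2 * T)" "real N \<le> 6 * (Im s1 + 2 * T) + 1"
      using T im by (auto simp: N_def)
    have NT: "real N \<ge> T" "N \<ge> 1" using N T im by auto
    have NC: "real N \<le> C2 * T"
    proof -
      have "Im s1 * 1 \<le> Im s1 * T" using T im by (intro mult_left_mono) auto
      then show ?thesis using N T by (simp add: C2_def algebra_simps)
    qed
    define S where "S = (\<lambda>t. \<Sum>k=1..N. A k * exp (- \<i> * of_real (ln (real k) * t)))"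
    define D where "D = (\<Sum>k=1..N. (norm (A k))\<^sup>2)"
    define \<rho> where "\<rho> = C4 * T powr (- s)"
    have \<rho>: "\<rho> \<ge> 0" "\<rho> \<le> C4"
    proof -
      have "T powr (- s) \<le> T powr 0" using T s by (intro powr_mono) auto
      then show "\<rho> \<le> C4" using C4 T by (simp add: \<rho>_def mult_left_le)
    qed (use C4 in \<open>simp add: \<rho>_def\<close>)
    have R: "norm (F t - S t) \<le> \<rho>" if t: "t \<in> {T..2 * T}" for t
    proof -
      have "norm (F t - (\<Sum>k=1..N. AV2_coeff s1 s2 k * of_nat k powr (- Complex \<sigma>3 t)))
         \<le> C3 * real N powr (1 - Re s1 - \<sigma>3) / (Im s1 + t)"
        by (rule C3) (use t T im N in auto)
      also have "(\<Sum>k=1..N. AV2_coeff s1 s2 k * of_nat k powr (- Complex \<sigma>3 t)) = S t"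
        unfolding S_def A_def by (intro sum.cong refl AV2_vcoeff_exp) auto
      also have "1 - Re s1 - \<sigma>3 = 1 - \<sigma>" by (simp add: \<sigma>_def)
      also have "C3 * real N powr (1 - \<sigma>) / (Im s1 + t) \<le> C3 * (C2 * T) powr (1 - \<sigma>) / T"
        using C3 NC t T im \<sigma> by (intro frac_le mult_left_mono powr_mono2) (auto simp: \<sigma>_def)
      also have "\<dots> = C4 * T powr (- \<sigma>)"
        using T C2 by (simp add: C4_def powr_mult powr_diff powr_minus divide_inverse)
      also have "\<dots> \<le> \<rho>"
        unfolding \<rho>_def using C4 T s by (intro mult_left_mono powr_mono) (auto simp: \<sigma>_def)
      finally show ?thesis .
    qed
    define IS where "IS = integral {T..2 * T} (\<lambda>t. (norm (S t))\<^sup>2)"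
    have intS: "(\<lambda>t. (norm (S t))\<^sup>2) integrable_on {T..2 * T}"
      unfolding S_def by (intro integrable_continuous_real continuous_intros)
    have intF: "(\<lambda>t. (norm (F t))\<^sup>2) integrable_on {T..2 * T}"
    proof (intro integrable_continuous_real continuous_intros)
      show "continuous_on {T..2 * T} F"
        unfolding F_def by (rule continuous_on_subset[OF zeta_AV2_continuous_on]) (use s2 \<sigma> s im T in auto)
    qed
    have "\<bar>IS - (2 * T - T) * D\<bar> \<le>
       (\<Sum>j=1..N. \<Sum>k\<in>{1..N} - {j}. 2 * norm (A j) * norm (A k) / \<bar>ln (real k) - ln (real j)\<bar>)"
      unfolding IS_def D_def S_def by (rule dirichlet_poly_mean_square) (use T in auto)
    also have "\<dots> \<le> C5 * (real N powr (2 - 2 * s) * (1 + ln (real N)))"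
      unfolding C5_def by (rule off_diagonal_bound) (use s C1 NT in auto)
    also have "\<dots> \<le> C5 * ((C2 powr (2 - 2 * s) * T powr (2 - 2 * s)) * ((2 * (1 + ln C2) + 1) * ln T))"
    proof (intro mult_left_mono mult_mono C5)
      have "real N powr (2 - 2 * s) \<le> (C2 * T) powr (2 - 2 * s)"
        using NC s by (intro powr_mono2) auto
      then show "real N powr (2 - 2 * s) \<le> C2 powr (2 - 2 * s) * T powr (2 - 2 * s)"
        by (simp add: powr_mult)
      have "ln (real N) \<le> ln (C2 * T)" using NC NT by simp
      also have "\<dots> = ln C2 + ln T" using C2 T by (simp add: ln_mult)
      finally have "1 + ln (real N) \<le> (1 + ln C2) * 1 + ln T" by simp
      also have "\<dots> \<le> (1 + ln C2) * (2 * ln T) + ln T"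
        using lnT lnC2 by (intro add_right_mono mult_left_mono) auto
      finally show "1 + ln (real N) \<le> (2 * (1 + ln C2) + 1) * ln T" by (simp add: algebra_simps)
      show "0 \<le> 1 + ln (real N)" using NT by simp
    qed auto
    also have "\<dots> = C6 * X" by (simp add: C6_def X_def mult_ac)
    finally have off: "\<bar>IS - T * D\<bar> \<le> C6 * X" by simp
    have D: "D \<le> c" "c - D \<le> C1\<^sup>2 / (2 * s - 1) * real N powr (1 - 2 * s)"
      using zeta_AV2_sq_split[OF s(1) C1(1) NT(2), of s1 s2 \<sigma>3] C1(2) unfolding D_def A_def c_def by auto
    have TN: "T * real N powr (1 - 2 * s) \<le> T powr (2 - 2 * s)"
    proof -
      have "real N powr (1 - 2 * s) \<le> T powr (1 - 2 * s)"
        using NT T s by (intro powr_mono2') auto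
      then have "T * real N powr (1 - 2 * s) \<le> T powr 1 * T powr (1 - 2 * s)" using T by simp
      also have "\<dots> = T powr (2 - 2 * s)" by (simp only: powr_add[symmetric]) simp
      finally show ?thesis .
    qed
    have diag: "\<bar>T * D - c * T\<bar> \<le> C7 * X"
    proof -
      have "\<bar>T * D - c * T\<bar> = T * (c - D)" using D T by (simp add: abs_if algebra_simps mult_le_cancel_left)
      also have "\<dots> \<le> T * (C1\<^sup>2 / (2 * s - 1) * real N powr (1 - 2 * s))"
        using D T by (intro mult_left_mono) auto
      also have "\<dots> = C1\<^sup>2 / (2 * s - 1) * (T * real N powr (1 - 2 * s))" by (simp only: mult_ac)
      also have "\<dots> \<le> C1\<^sup>2 / (2 * s - 1) * (2 * X)"
        using s TN TX by (intro mult_left_mono) auto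
      finally show ?thesis by (simp add: C7_def mult_ac)
    qed
    have "norm (integral {T..2 * T} (\<lambda>t. (norm (F t))\<^sup>2 - (norm (S t))\<^sup>2)) \<le>
       integral {T..2 * T} (\<lambda>t. \<rho> * ((norm (S t))\<^sup>2 + 1) + \<rho>\<^sup>2)"
    proof (rule Henstock_Kurzweil_Integration.integral_norm_bound_integral)
      show "(\<lambda>t. (norm (F t))\<^sup>2 - (norm (S t))\<^sup>2) integrable_on {T..2 * T}"
        by (intro integrable_diff intF intS)
      show "(\<lambda>t. \<rho> * ((norm (S t))\<^sup>2 + 1) + \<rho>\<^sup>2) integrable_on {T..2 * T}"
        unfolding S_def by (intro integrable_continuous_real continuous_intros)
      show "norm ((norm (F t))\<^sup>2 - (norm (S t))\<^sup>2) \<le> \<rho> * ((norm (S t))\<^sup>2 + 1) + \<rho>\<^sup>2" if "t \<in> {T..2 * T}" for t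
        using square_diff_le[OF R[OF that]] by simp
    qed
    also have "integral {T..2 * T} (\<lambda>t. (norm (F t))\<^sup>2 - (norm (S t))\<^sup>2) = integral {T..2 * T} (\<lambda>t. (norm (F t))\<^sup>2) - IS"
      unfolding IS_def by (rule Henstock_Kurzweil_Integration.integral_diff[OF intF intS])
    also have "integral {T..2 * T} (\<lambda>t. \<rho> * ((norm (S t))\<^sup>2 + 1) + \<rho>\<^sup>2) = \<rho> * (IS + T) + \<rho>\<^sup>2 * T"
    proof (rule integral_unique)
      have c1: "((\<lambda>t. c) has_integral c * T) {T..2 * T}" for c :: real
        using has_integral_const_real[of c T "2 * T"] T by (simp add: mult.commute)
      have "((\<lambda>t. \<rho> * ((norm (S t))\<^sup>2 + 1) + \<rho>\<^sup>2) has_integral \<rho> * (IS + 1 * T) + \<rho>\<^sup>2 * T) {T..2 * T}"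
        unfolding IS_def by (intro has_integral_add has_integral_mult_right integrable_integral intS c1)
      then show "((\<lambda>t. \<rho> * ((norm (S t))\<^sup>2 + 1) + \<rho>\<^sup>2) has_integral \<rho> * (IS + T) + \<rho>\<^sup>2 * T) {T..2 * T}"
        by simp
    qed
    finally have diff: "\<bar>integral {T..2 * T} (\<lambda>t. (norm (F t))\<^sup>2) - IS\<bar> \<le> \<rho> * (IS + T) + \<rho>\<^sup>2 * T" by simp
    have "IS \<le> T * D + C6 * X" using off by linarith
    also have "\<dots> \<le> T * c + C6 * X" using D T by (intro add_right_mono mult_left_mono) auto
    finally have "\<rho> * (IS + T) \<le> \<rho> * (T * (c + 1) + C6 * X)"
      using \<rho> by (intro mult_left_mono) (auto simp: algebra_simps)
    also have "\<dots> = C4 * (c + 1) * (T powr 1 * T powr (- s)) + \<rho> * (C6 * X)"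
      using T by (simp add: \<rho>_def algebra_simps)
    also have "\<dots> \<le> C4 * (c + 1) * (2 * X) + C4 * (C6 * X)"
    proof (intro add_mono mult_left_mono mult_right_mono \<rho>)
      have "T powr 1 * T powr (- s) = T powr (1 - s)" by (simp only: powr_add[symmetric]) simp
      \<comment> \<open>2 - 2 * s is twice 1 - s > 0, so the approximation error is
        absorbed.\<close>
      also have "\<dots> \<le> T powr (2 - 2 * s)" using T s by (intro powr_mono) auto
      finally show "T powr 1 * T powr (- s) \<le> 2 * X" using TX by simp
    qed (use C4 c C6 X in auto)
    finally have e1: "\<rho> * (IS + T) \<le> C4 * (c + 1) * (2 * X) + C4 * (C6 * X)" .
    have "\<rho>\<^sup>2 * T = C4\<^sup>2 * (T powr (- s) * T powr (- s) * T powr 1)"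
      using T by (simp add: \<rho>_def power2_eq_square mult_ac)
    also have "\<dots> \<le> C4\<^sup>2 * (2 * X)"
    proof (intro mult_left_mono)
      have "T powr (- s) * T powr (- s) * T powr 1 = T powr (1 - 2 * s)" by (simp only: powr_add[symmetric]) simp
      also have "\<dots> \<le> T powr (2 - 2 * s)" using T s by (intro powr_mono) auto
      finally show "T powr (- s) * T powr (- s) * T powr 1 \<le> 2 * X" using TX by simp
    qed auto
    finally have e2: "\<rho>\<^sup>2 * T \<le> C4\<^sup>2 * (2 * X)" .
    have "\<bar>integral {T..2 * T} (\<lambda>t. (norm (F t))\<^sup>2) - c * T\<bar> \<le>
       C4 * (c + 1) * (2 * X) + C4 * (C6 * X) + C4\<^sup>2 * (2 * X) + C6 * X + C7 * X"
      using diff off diag e1 e2 by linarith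
    also have "\<dots> = C * X" by (simp add: C_def algebra_simps)
    finally show ?thesis by (simp add: X_def)
  qed
  have "C \<ge> 0" using C4 C6 C7 c by (simp add: C_def)
  then show ?thesis using main unfolding F_def c_def by blast
qed

text \<open>The main term is linear in T, so its increment over \<open>[T, 2 * T]\<close> is exactly
  c * T. The starting point 2 affects only the initial range.\<close>

lemma mean_square_bound:
  fixes s1 s2 :: complex and \<sigma>3 s :: real
  assumes s1: "Re s1 \<ge> 0" and s2: "Re s2 > 1" and \<sigma>: "Re s1 + \<sigma>3 \<le> 1" "Re s1 + Re s2 + \<sigma>3 > 2"
    and im: "Im s1 \<ge> 0" and s: "1/2 < s" "s < 1" "s \<le> Re s1 + \<sigma>3"
  shows "\<exists>M. \<forall>T\<ge>2. \<bar>integral {2..T} (\<lambda>t. (norm (zeta_AV2 s1 s2 (Complex \<sigma>3 t)))\<^sup>2)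
     - zeta_AV2_sq s1 s2 (2 * \<sigma>3) * T\<bar> \<le> M * (T powr (2 - 2 * s) * ln T)"
proof -
  define f where "f = (\<lambda>t. (norm (zeta_AV2 s1 s2 (Complex \<sigma>3 t)))\<^sup>2)"
  define c where "c = zeta_AV2_sq s1 s2 (2 * \<sigma>3)"
  have c: "c \<ge> 0" unfolding c_def zeta_AV2_sq_eq by (rule infsum_nonneg) auto
  have int: "f integrable_on {2..T}" for T
    unfolding f_def
    by (intro integrable_continuous_real continuous_intros continuous_on_subset[OF zeta_AV2_continuous_on])
       (use s2 \<sigma> s im in auto)
  obtain C where C: "C \<ge> 0" "\<And>T. T \<ge> 2 \<Longrightarrow> \<bar>integral {T..2 * T} f - c * T\<bar> \<le> C * (T powr (2 - 2 * s) * ln T)"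
    using dyadic_mean_square[OF assms] unfolding f_def c_def by blast
  have "\<exists>M. \<forall>T\<ge>2. \<bar>integral {2..T} f - c * T\<bar> \<le> M * (T powr (2 - 2 * s) * ln T)"
  proof (rule dyadic_growth[of "2 - 2 * s" C "\<lambda>T. integral {2..T} f - c * T" "integral {2..4} f + 4 * c"])
    fix T :: real assume T: "T \<ge> 2"
    have "integral {2..T} f + integral {T..2 * T} f = integral {2..2 * T} f"
      by (rule Henstock_Kurzweil_Integration.integral_combine) (use T int in auto)
    then have "integral {2..2 * T} f - c * (2 * T) - (integral {2..T} f - c * T) = integral {T..2 * T} f - c * T"
      by (simp add: algebra_simps)
    then show "\<bar>integral {2..2 * T} f - c * (2 * T) - (integral {2..T} f - c * T)\<bar> \<le> C * (T powr (2 - 2 * s) * ln T)"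
      using C(2)[OF T] by (simp only:)
  next
    fix T :: real assume T: "T \<in> {2..4}"
    have "integral {2..T} f \<le> integral {2..4} f"
      by (rule integral_subset_le) (use T int in \<open>auto simp: f_def\<close>)
    moreover have "integral {2..T} f \<ge> 0"
      by (rule Henstock_Kurzweil_Integration.integral_nonneg[OF int]) (auto simp: f_def)
    moreover have "0 \<le> c * T" "c * T \<le> 4 * c" using T c mult_right_mono[of T 4 c] by (auto simp: mult.commute)
    ultimately show "\<bar>integral {2..T} f - c * T\<bar> \<le> integral {2..4} f + 4 * c" by linarith
  qed (use s C in auto)
  then show ?thesis by (simp add: f_def c_def)
qed

theorem theorem1p2:
  fixes s1 s2 :: complex and \<sigma>3 :: real
  assumes "Re s1 \<ge> 0" and "\<sigma>3 > 0"
    and "1/2 < Re s1 + \<sigma>3" and "Re s1 + \<sigma>3 \<le> 1"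
    and "Re s1 + Re s2 + \<sigma>3 > 2"
    and "Im s1 \<ge> 0"
    and "\<forall>t::real. t \<ge> 2 \<longrightarrow> s1 + Complex \<sigma>3 t \<noteq> 1"
  shows "(Re s1 + \<sigma>3 \<le> 3/4 \<longrightarrow>
            (\<lambda>T. integral {2..T} (\<lambda>t. (cmod (zeta_AV2 s1 s2 (Complex \<sigma>3 t)))^2)
                  - zeta_AV2_sq s1 s2 (2 * \<sigma>3) * T)
            \<in> O[at_top](\<lambda>T. T powr (2 - 2 * Re s1 - 2 * \<sigma>3) * ln T))
       \<and> (3/4 < Re s1 + \<sigma>3 \<longrightarrow>
            (\<lambda>T. integral {2..T} (\<lambda>t. (cmod (zeta_AV2 s1 s2 (Complex \<sigma>3 t)))^2)
                  - zeta_AV2_sq s1 s2 (2 * \<sigma>3) * T)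
            \<in> O[at_top](\<lambda>T. T powr (1/2)))"
proof -
  define g where "g = (\<lambda>T. integral {2..T} (\<lambda>t. (cmod (zeta_AV2 s1 s2 (Complex \<sigma>3 t)))^2)
                  - zeta_AV2_sq s1 s2 (2 * \<sigma>3) * T)"
  \<comment> \<open>Subtract Re s1 + \<sigma>3 \<le> 1 from Re s1 + Re s2 + \<sigma>3 > 2.\<close>
  have s2: "Re s2 > 1" using assms by linarith
  have bound: "g \<in> O[at_top](\<lambda>T. T powr (2 - 2 * s) * ln T)"
    if s: "1/2 < s" "s < 1" "s \<le> Re s1 + \<sigma>3" for s
  proof -
    obtain M where M: "\<And>T. T \<ge> 2 \<Longrightarrow> \<bar>g T\<bar> \<le> M * (T powr (2 - 2 * s) * ln T)"
      using mean_square_bound[OF assms(1) s2 assms(4,5,6) s] unfolding g_def by blast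
    show ?thesis
    proof (rule bigoI[of _ M])
      show "\<forall>\<^sub>F T in at_top. norm (g T) \<le> M * norm (T powr (2 - 2 * s) * ln T)"
        using eventually_ge_at_top[of "2::real"]
      proof eventually_elim
        case (elim T)
        then show ?case using M[of T] by simp
      qed
    qed
  qed
  have "g \<in> O[at_top](\<lambda>T. T powr (2 - 2 * Re s1 - 2 * \<sigma>3) * ln T)" if "Re s1 + \<sigma>3 \<le> 3/4"
  proof -
    have eq: "2 - 2 * (Re s1 + \<sigma>3) = 2 - 2 * Re s1 - 2 * \<sigma>3" by simp
    \<comment> \<open>In this range Re s1 + \<sigma>3 is itself below 1 and can serve as s.\<close>
    show ?thesis by (rule bound[of "Re s1 + \<sigma>3", unfolded eq]) (use assms that in auto)
  qed
  moreover have "g \<in> O[at_top](\<lambda>T. T powr (1/2))" if "3/4 < Re s1 + \<sigma>3"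
  proof -
    \<comment> \<open>The midpoint is above 3/4 and at most 7/8, also when Re s1 + \<sigma>3 = 1.
      Hence 2 - 2 * s = 1/2 - a with a > 0, and the spare \<open>T powr a\<close> swallows the
      logarithm.\<close>
    define s where "s = (3/4 + (Re s1 + \<sigma>3)) / 2"
    have s: "3/4 < s" "s < 1" "s \<le> Re s1 + \<sigma>3" using that assms by (auto simp: s_def)
    define a where "a = 2 * s - 3/2"
    have a: "a > 0" using s by (simp add: a_def)
    have "(\<lambda>T. T powr (2 - 2 * s) * ln T) \<in> O[at_top](\<lambda>T. T powr (1/2))"
    proof (rule bigoI[of _ "1 / a"])
      show "\<forall>\<^sub>F T in at_top. norm (T powr (2 - 2 * s) * ln T) \<le> 1 / a * norm (T powr (1/2))"
        using eventually_ge_at_top[of "2::real"]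
      proof eventually_elim
        case (elim T)
        have "T powr (2 - 2 * s) * ln T \<le> T powr (2 - 2 * s) * (T powr a / a)"
          using elim a by (intro mult_left_mono ln_powr_bound) auto
        also have "\<dots> = 1 / a * T powr (1/2)"
          by (simp add: a_def flip: powr_add)
        finally show ?case using elim by simp
      qed
    qed
    then show ?thesis
      using bound[of s] s by (auto intro: landau_o.big_trans)
  qed
  ultimately show ?thesis unfolding g_def by blast
qed

end
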